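(* Let $\theta>0$. Let $\mathbf{W}=(W_{n,k})_{n\in\mathbb{N},k\in[n]}$ be random weights and $(X_k)_{k\in\mathbb{N}}$ random counts such that: (A1) the $W_{n,k}$ are non-negative real random variables with $0=:W_{n,0}\le W_{n,1}\le\dots\le W_{n,n}=:W_{\max}^{(n)}$ and $\mathbb{E}[W_{\max}^{(n)}]<\infty$ for every $n$; (A2) conditionally given $\mathbf{W}$, $(X_k)_{k\in\mathbb{N}}$ are mutually independent non-negative integer-valued random variables, with $\lambda_k(\mathbf{W}):=\mathbb{E}[X_k\mid\mathbf{W}]\in[0,\infty)$. Let $S_n=\sum_{k=1}^n W_{n,k}X_k$ and $$\varepsilon_n(\mathbf{W}) := \delta_n+\frac{2}{\theta}D_n^*+\frac{2}{\theta}\sum_{k=1}^n\lambda_k(\mathbf{W})W_{n,k}\,\frac{d_{TV}(X_k^*,X_k+1\mid\mathbf{W})}{\mathbb{P}(X_k=x_{\min}^{(k)}(\mathbf{W})\mid\mathbf{W})}+|W_{\max}^{(n)}-1| .$$ Let $$C_1:=2\theta^2+(6\theta+10\theta\,\zeta(1+\theta))\max\Big\{\frac{e^{-\theta\gamma}}{\Gamma(\theta)},k_\theta\Big\},\qquad C_2:=3\,(2\theta+4\theta\,\zeta(1+\theta))^{\theta}.$$ Then for every $n\in\mathbb{N}$, $$d_K(S_n,D_\theta)\le\begin{cases}C_1\,\mathbb{E}[\varepsilon_n(\mathbf{W})],&\theta\ge1,\\ 2\theta^2\,\mathbb{E}[\varepsilon_n(\mathbf{W})]+C_2\,(\mathb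b{E}[\varepsilon_n(\mathbf{W})])^\theta,&\theta\in(0,1).\end{cases}$$
   Context: $[n]=\{1,\dots,n\}$. $D_\theta$ has the generalized Dickman distribution with mean $\theta$: the unique non-negative solution (in law) of $D\stackrel{d}{=}U^{1/\theta}(D+1)$ with $U$ uniform on $[0,1]$ independent of $D$. Let $p_\theta$ be its density; $k_\theta>0$ is a constant with $p_\theta(x)\le k_\theta$ for all $x\ge1$ (such a constant exists). $\gamma$ is the Euler–Mascheroni constant, $\zeta$ the Riemann zeta function, $\Gamma$ the Gamma function. $d_K(X,Y)=\sup_{t\ge0}|\mathbb{P}(X\le t)-\mathbb{P}(Y\le t)|$ for non-negative $X,Y$. For $k\in[n]$: $\Delta_{n,k}:=\theta(W_{n,k}-W_{n,k-1})$, $D_{n,k}:=\sum_{j=1}^k(\lambda_j(\mathbf{W})W_{n,j}-\Delta_{n,j})$, $\delta_n:=\max_{k\in[n]}(W_{n,k}-W_{n,k-1})$, $D_n^*:=\max_{k\in[n]}|D_{n,k}|$. $x_{\min}^{(k)}(\mathbf{W}):=\min\{x\in\mathbb{N}_0:\mathbb{P}(X_k=x\mid\mathbf{W})>0\}$. Conditionally given $\mathbf{W}$, $X_k^*$ has the size-biased law of $X_k$: $\mathbb{E}[X_kf(X_k)\mid\mathbf{W}]=\lambda_k(\mathbf{W})\,\mathbb{E}[f(X_k^* )\mid\mathbf{W}]$ for all $f$ for which the expectations exist. $d_{TV}(\cdot,\cdot\mid\mathbf{W})$ is the total variation distance (supremum over events of the difference of probabilities) between the conditional laws given $\mathbf{W}$.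 A summand with $\lambda_k(\mathbf{W})=0$ is read as $0$. The bound is trivial if $\mathbb{E}[\varepsilon_n(\mathbf{W})]=\infty$. *)

theory Defs
  imports "HOL-Probability.Probability"
begin

section \<open>Conditioning on a sub-sigma-algebra\<close>

definition cond_prob_sub :: "'a measure \<Rightarrow> 'a measure \<Rightarrow> 'a set \<Rightarrow> 'a \<Rightarrow> real" where
  "cond_prob_sub M F A = real_cond_exp M F (indicator A)"

definition cond_indep_vars ::
  "'a measure \<Rightarrow> 'a measure \<Rightarrow> ('i \<Rightarrow> 'b measure) \<Rightarrow> ('i \<Rightarrow> 'a \<Rightarrow> 'b) \<Rightarrow> 'i set \<Rightarrow> bool" where
  "cond_indep_vars M F N X I \<longleftrightarrow>
     (\<forall>i\<in>I. X i \<in> measurable M (N i)) \<and>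
     (\<forall>J A. finite J \<and> J \<subseteq> I \<and> (\<forall>j\<in>J. A j \<in> sets (N j)) \<longrightarrow>
        (AE \<omega> in M. cond_prob_sub M F {\<omega>' \<in> space M. \<forall>j\<in>J. X j \<omega>' \<in> A j} \<omega>
                   = (\<Prod>j\<in>J. cond_prob_sub M F {\<omega>' \<in> space M. X j \<omega>' \<in> A j} \<omega>)))"

text \<open>The regular conditional law of a random variable with values in the natural numbers.
  For almost every outcome the argument of \<^const>\<open>embed_pmf\<close> is a probability mass function
  (see \<open>pmf_cond_pmf\<close> below); on the remaining null set the value is irrelevant.\<close>

definition cond_pmf :: "'a measure \<Rightarrow> 'a measure \<Rightarrow> ('a \<Rightarrow> nat) \<Rightarrow> 'a \<Rightarrow> nat pmf" where
  "cond_pmf M F X \<omega> = embed_pmf (\<lambda>x. cond_prob_sub M F {\<omega>' \<in> space M. X \<omega>' = x} \<omega>)"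

lemma pmf_cond_pmf:
  assumes "prob_space M" and F: "subalgebra M F" and X: "X \<in> measurable M (count_space UNIV)"
  shows "AE \<omega> in M. \<forall>x. pmf (cond_pmf M F X \<omega>) x = cond_prob_sub M F {\<omega>' \<in> space M. X \<omega>' = x} \<omega>"
proof -
  interpret prob_space M by fact
  interpret finite_measure_subalgebra M F by unfold_locales fact
  note X[measurable]
  define A where "A x = {\<omega> \<in> space M. X \<omega> = x}" for x
  have A[measurable]: "A x \<in> sets M" for x unfolding A_def by measurable
  define g where "g = (\<lambda>x. nn_cond_exp M F (indicator (A x)))"
  have g[measurable]: "g x \<in> borel_measurable M" for x unfolding g_def by simp
  have gF[measurable]: "g x \<in> borel_measurable F" for x unfolding g_def by simp
  have sumg: "AE \<omega> in M. (\<Sum>x. g x \<omega>) = 1"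
  proof -
    have 1: "AE \<omega> in M. (\<Sum>x. g x \<omega>) = nn_cond_exp M F (\<lambda>_. 1) \<omega>"
    proof (rule nn_cond_exp_charact)
      fix B assume B: "B \<in> sets F"
      have BM[measurable]: "B \<in> sets M" using B F by (auto simp: subalgebra_def)
      have *: "(\<integral>\<^sup>+\<omega>. g x \<omega> * indicator B \<omega> \<partial>M) = emeasure M (A x \<inter> B)" for x
      proof -
        have "(\<integral>\<^sup>+\<omega>. indicator B \<omega> * g x \<omega> \<partial>M) = (\<integral>\<^sup>+\<omega>. indicator B \<omega> * indicator (A x) \<omega> \<partial>M)"
          unfolding g_def by (rule nn_cond_exp_intg) (use B in auto)
        also have "\<dots> = (\<integral>\<^sup>+\<omega>. indicator (A x \<inter> B) \<omega> \<partial>M)"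
          by (intro nn_integral_cong) (auto split: split_indicator)
        finally show ?thesis by (simp add: mult.commute)
      qed
      have "(\<integral>\<^sup>+\<omega>\<in>B. (\<Sum>x. g x \<omega>) \<partial>M) = (\<integral>\<^sup>+\<omega>. (\<Sum>x. g x \<omega> * indicator B \<omega>) \<partial>M)" by simp
      also have "\<dots> = (\<Sum>x. \<integral>\<^sup>+\<omega>. g x \<omega> * indicator B \<omega> \<partial>M)"
        by (rule nn_integral_suminf) measurable
      also have "\<dots> = (\<Sum>x. emeasure M (A x \<inter> B))" by (simp add: *)
      also have "\<dots> = emeasure M (\<Union>x. A x \<inter> B)"
        by (rule suminf_emeasure) (auto simp: disjoint_family_on_def A_def)
      also have "(\<Union>x. A x \<inter> B) = B" using sets.sets_into_space[OF BM] by (auto simp: A_def)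
      finally show "(\<integral>\<^sup>+\<omega>\<in>B. 1 \<partial>M) = (\<integral>\<^sup>+\<omega>\<in>B. (\<Sum>x. g x \<omega>) \<partial>M)" by simp
    qed simp_all
    have "AE \<omega> in M. 1 = nn_cond_exp M F (\<lambda>_. 1) \<omega>"
      by (rule nn_cond_exp_charact) simp_all
    with 1 show ?thesis by eventually_elim simp
  qed
  have neg: "AE \<omega> in M. nn_cond_exp M F (\<lambda>\<omega>. ennreal (- indicator (A x) \<omega>)) \<omega> = 0" for x
  proof -
    have "(\<lambda>\<omega>. ennreal (- indicator (A x) \<omega>)) = (\<lambda>_. 0)"
      by (auto simp: fun_eq_iff ennreal_neg)
    moreover have "AE \<omega> in M. 0 = nn_cond_exp M F (\<lambda>_. 0) \<omega>"
      by (rule nn_cond_exp_charact) simp_all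
    ultimately show ?thesis by (auto elim: eventually_mono)
  qed
  have "AE \<omega> in M. \<forall>x. nn_cond_exp M F (\<lambda>\<omega>. ennreal (- indicator (A x) \<omega>)) \<omega> = 0"
    using neg by (simp add: AE_all_countable)
  with sumg show ?thesis
  proof eventually_elim
    case (elim \<omega>)
    have fin: "g x \<omega> < \<infinity>" for x
    proof -
      have "g x \<omega> = (\<Sum>y\<in>{x}. g y \<omega>)" by simp
      also have "\<dots> \<le> (\<Sum>y. g y \<omega>)" by (rule sum_le_suminf) auto
      finally show ?thesis using elim(1) by (auto simp: less_top[symmetric] top_unique)
    qed
    have c: "cond_prob_sub M F (A x) \<omega> = enn2real (g x \<omega>)" for x
      using elim(2) by (simp add: cond_prob_sub_def real_cond_exp_def g_def ennreal_indicator)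
    have "(\<integral>\<^sup>+ x. ennreal (cond_prob_sub M F (A x) \<omega>) \<partial>count_space UNIV) = 1"
      using elim(1) fin by (simp add: c nn_integral_count_space_nat)
    then show ?case
      unfolding cond_pmf_def A_def by (subst pmf_embed_pmf) (auto simp: c[unfolded A_def] )
  qed
qed

section \<open>Size-biased laws and distances between laws\<close>

definition size_biased :: "nat pmf \<Rightarrow> nat pmf \<Rightarrow> bool" where
  "size_biased p q \<longleftrightarrow>
     (\<forall>f :: nat \<Rightarrow> real.
        integrable (measure_pmf p) (\<lambda>x. real x * f x) \<longrightarrow> integrable (measure_pmf q) f \<longrightarrow>
        measure_pmf.expectation p (\<lambda>x. real x * f x)
          = measure_pmf.expectation p real * measure_pmf.expectation q f)"

lemma size_biased_ex1:
  assumes int: "integrable (measure_pmf p) real" and pos: "measure_pmf.expectation p real > 0"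
  shows "\<exists>!q. size_biased p q"
proof -
  define m where "m = measure_pmf.expectation p real"
  have m: "m > 0" using pos by (simp add: m_def)
  define w where "w = (\<lambda>x. real x * pmf p x / m)"
  have "(\<integral>\<^sup>+x. ennreal (real x) \<partial>measure_pmf p) = ennreal m"
    unfolding m_def by (rule nn_integral_eq_integral[OF int]) simp
  also have "(\<integral>\<^sup>+x. ennreal (real x) \<partial>measure_pmf p)
      = (\<integral>\<^sup>+x. ennreal m * ennreal (w x) \<partial>count_space UNIV)"
    using m by (simp add: nn_integral_measure_pmf w_def ennreal_mult'[symmetric] mult.commute)
  also have "\<dots> = ennreal m * (\<integral>\<^sup>+x. ennreal (w x) \<partial>count_space UNIV)"
    by (rule nn_integral_cmult) simp
  finally have w1: "(\<integral>\<^sup>+x. ennreal (w x) \<partial>count_space UNIV) = 1"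
    using m by (metis ennreal_mult_cancel_left ennreal_neq_top ennreal_eq_0_iff mult.right_neutral not_less)
  have w0: "w x \<ge> 0" for x using m by (simp add: w_def)
  define q where "q = embed_pmf w"
  have q: "pmf q x = w x" for x unfolding q_def by (rule pmf_embed_pmf[OF w0 w1])
  show ?thesis
  proof (rule ex1I[of _ q])
    show "size_biased p q" unfolding size_biased_def
    proof (intro allI impI)
      fix f :: "nat \<Rightarrow> real"
      have "measure_pmf.expectation p (\<lambda>x. real x * f x)
          = (\<integral>x. pmf p x * (real x * f x) \<partial>count_space UNIV)"
        by (simp add: measure_pmf_eq_density integral_density)
      also have "\<dots> = (\<integral>x. m * (pmf q x * f x) \<partial>count_space UNIV)"
        using m by (intro Bochner_Integration.integral_cong) (auto simp: q w_def)
      also have "\<dots> = m * (\<integral>x. pmf q x * f x \<partial>count_space UNIV)" by simp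
      also have "(\<integral>x. pmf q x * f x \<partial>count_space UNIV) = measure_pmf.expectation q f"
        by (simp add: measure_pmf_eq_density integral_density)
      finally show "measure_pmf.expectation p (\<lambda>x. real x * f x)
          = measure_pmf.expectation p real * measure_pmf.expectation q f" by (simp add: m_def)
    qed
  next
    fix r assume r: "size_biased p r"
    show "r = q"
    proof (rule pmf_eqI)
      fix x
      have e: "(\<lambda>y. real y * indicator {x} y) = (\<lambda>y. real x * indicator {x} y)"
        by (auto simp: fun_eq_iff split: split_indicator)
      have "measure_pmf.expectation p (\<lambda>y. real y * indicator {x} y)
          = m * measure_pmf.expectation r (indicator {x})"
        unfolding m_def
        by (rule r[unfolded size_biased_def, rule_format])
           (simp_all add: e integrable_real_indicator measure_pmf.emeasure_eq_measure)
      then have "real x * pmf p x = m * pmf r x"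
        unfolding e by (simp add: pmf.rep_eq)
      then show "pmf r x = pmf q x" using m by (simp add: q w_def field_simps)
    qed
  qed
qed

text \<open>Meaningful only if the mean of \<open>p\<close> is positive and finite (see \<open>size_biased_ex1\<close>): if \<open>p\<close> is concentrated at 0,
  then every \<open>q\<close> satisfies \<^term>\<open>size_biased p q\<close>.\<close>

definition size_biased_pmf :: "nat pmf \<Rightarrow> nat pmf" where
  "size_biased_pmf p = (THE q. size_biased p q)"

definition tv_dist :: "'b pmf \<Rightarrow> 'b pmf \<Rightarrow> real" where
  "tv_dist p q = (SUP A. \<bar>measure (measure_pmf p) A - measure (measure_pmf q) A\<bar>)"

text \<open>Kolmogorov distance between the laws of two non-negative random variables, whence the
  restriction to \<open>t \<ge> 0\<close>.\<close>

definition kolmogorov_dist :: "real measure \<Rightarrow> real measure \<Rightarrow> real" where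
  "kolmogorov_dist \<mu> \<nu> = (SUP t\<in>{0..}. \<bar>cdf \<mu> t - cdf \<nu> t\<bar>)"

section \<open>The generalized Dickman distribution and the constants\<close>

text \<open>\<open>\<mu>\<close> is the law of \<open>D \<ge> 0\<close>, where \<open>D\<close> and \<open>U powr (1 / \<theta>) * (D + 1)\<close> have the same law for
  \<open>U\<close> uniform on \<open>[0, 1]\<close> and independent of \<open>D\<close>.\<close>

definition gen_dickman :: "real \<Rightarrow> real measure \<Rightarrow> bool" where
  "gen_dickman \<theta> \<mu> \<longleftrightarrow>
     prob_space \<mu> \<and> sets \<mu> = sets borel \<and> (AE x in \<mu>. 0 \<le> x) \<and>
     \<mu> = distr (uniform_measure lborel {0..1} \<Otimes>\<^sub>M \<mu>) borel (\<lambda>(u, x). u powr (1 / \<theta>) * (x + 1))"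

text \<open>The Riemann zeta function on the half-line \<open>s > 1\<close>.\<close>

definition zeta :: "real \<Rightarrow> real" where
  "zeta s = (\<Sum>m. 1 / real (Suc m) powr s)"

text \<open>\<open>k\<close> is a bound on \<open>[1, \<infinity>)\<close> for the density of the generalized Dickman distribution.\<close>

definition C1 :: "real \<Rightarrow> real \<Rightarrow> real" where
  "C1 \<theta> k = 2 * \<theta>\<^sup>2 + (6 * \<theta> + 10 * \<theta> * zeta (1 + \<theta>))
      * max (exp (- \<theta> * euler_mascheroni) / Gamma \<theta>) k"

definition C2 :: "real \<Rightarrow> real" where
  "C2 \<theta> = 3 * (2 * \<theta> + 4 * \<theta> * zeta (1 + \<theta>)) powr \<theta>"

section \<open>Weighted sums with random weights\<close>

text \<open>Weights are given as \<open>W n k\<close> for \<open>1 \<le> k \<le> n\<close>, with the convention \<open>W n 0 = 0\<close>.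
  The sigma-algebra below is the one generated by the whole triangular array.\<close>

definition weight_sigma :: "'a measure \<Rightarrow> (nat \<Rightarrow> nat \<Rightarrow> 'a \<Rightarrow> real) \<Rightarrow> 'a measure" where
  "weight_sigma M W =
     (let I = (SIGMA n:{1..}. {1..n})
      in vimage_algebra (space M) (\<lambda>\<omega>. \<lambda>(n, k)\<in>I. W n k \<omega>) (\<Pi>\<^sub>M i\<in>I. borel))"

definition cond_mean ::
  "'a measure \<Rightarrow> (nat \<Rightarrow> nat \<Rightarrow> 'a \<Rightarrow> real) \<Rightarrow> (nat \<Rightarrow> 'a \<Rightarrow> nat) \<Rightarrow> nat \<Rightarrow> 'a \<Rightarrow> ennreal" where
  "cond_mean M W X k = nn_cond_exp M (weight_sigma M W) (\<lambda>\<omega>. ennreal (real (X k \<omega>)))"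

definition lam ::
  "'a measure \<Rightarrow> (nat \<Rightarrow> nat \<Rightarrow> 'a \<Rightarrow> real) \<Rightarrow> (nat \<Rightarrow> 'a \<Rightarrow> nat) \<Rightarrow> nat \<Rightarrow> 'a \<Rightarrow> real" where
  "lam M W X k \<omega> = enn2real (cond_mean M W X k \<omega>)"

definition count_law ::
  "'a measure \<Rightarrow> (nat \<Rightarrow> nat \<Rightarrow> 'a \<Rightarrow> real) \<Rightarrow> (nat \<Rightarrow> 'a \<Rightarrow> nat) \<Rightarrow> nat \<Rightarrow> 'a \<Rightarrow> nat pmf" where
  "count_law M W X k = cond_pmf M (weight_sigma M W) (X k)"

definition x_min ::
  "'a measure \<Rightarrow> (nat \<Rightarrow> nat \<Rightarrow> 'a \<Rightarrow> real) \<Rightarrow> (nat \<Rightarrow> 'a \<Rightarrow> nat) \<Rightarrow> nat \<Rightarrow> 'a \<Rightarrow> nat" where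
  "x_min M W X k \<omega> = (LEAST x. pmf (count_law M W X k \<omega>) x > 0)"

definition Delta :: "real \<Rightarrow> (nat \<Rightarrow> nat \<Rightarrow> 'a \<Rightarrow> real) \<Rightarrow> nat \<Rightarrow> nat \<Rightarrow> 'a \<Rightarrow> real" where
  "Delta \<theta> W n k \<omega> = \<theta> * (W n k \<omega> - W n (k - 1) \<omega>)"

definition Dsum ::
  "real \<Rightarrow> 'a measure \<Rightarrow> (nat \<Rightarrow> nat \<Rightarrow> 'a \<Rightarrow> real) \<Rightarrow> (nat \<Rightarrow> 'a \<Rightarrow> nat) \<Rightarrow> nat \<Rightarrow> nat \<Rightarrow> 'a \<Rightarrow> real"
  where
  "Dsum \<theta> M W X n k \<omega> = (\<Sum>j=1..k. lam M W X j \<omega> * W n j \<omega> - Delta \<theta> W n j \<omega>)"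

definition Dstar ::
  "real \<Rightarrow> 'a measure \<Rightarrow> (nat \<Rightarrow> nat \<Rightarrow> 'a \<Rightarrow> real) \<Rightarrow> (nat \<Rightarrow> 'a \<Rightarrow> nat) \<Rightarrow> nat \<Rightarrow> 'a \<Rightarrow> real" where
  "Dstar \<theta> M W X n \<omega> = (MAX k\<in>{1..n}. \<bar>Dsum \<theta> M W X n k \<omega>\<bar>)"

definition mesh :: "(nat \<Rightarrow> nat \<Rightarrow> 'a \<Rightarrow> real) \<Rightarrow> nat \<Rightarrow> 'a \<Rightarrow> real" where
  "mesh W n \<omega> = (MAX k\<in>{1..n}. W n k \<omega> - W n (k - 1) \<omega>)"

text \<open>If \<^term>\<open>lam M W X k \<omega> = 0\<close>, then the size-biased law of \<open>X k\<close> is unspecified, but the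
  corresponding summand is 0, as it should be.\<close>

definition eps ::
  "real \<Rightarrow> 'a measure \<Rightarrow> (nat \<Rightarrow> nat \<Rightarrow> 'a \<Rightarrow> real) \<Rightarrow> (nat \<Rightarrow> 'a \<Rightarrow> nat) \<Rightarrow> nat \<Rightarrow> 'a \<Rightarrow> real" where
  "eps \<theta> M W X n \<omega> =
     mesh W n \<omega> + 2 / \<theta> * Dstar \<theta> M W X n \<omega>
     + 2 / \<theta> * (\<Sum>k=1..n. lam M W X k \<omega> * W n k \<omega>
         * (let p = count_law M W X k \<omega>
            in tv_dist (size_biased_pmf p) (map_pmf Suc p) / pmf p (x_min M W X k \<omega>)))
     + \<bar>W n n \<omega> - 1\<bar>"

end

theory Submission
  imports Defs
begin

text \<open>Conditioning on the weights and the concavity of the bound in \<open>\<epsilon>\<close> reduce the theorem to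
  deterministic weights, where Stein's method applies. The test function \<open>\<lambda>x. min x s\<close> has the solution
  \<open>u = stein_sol \<theta> s\<close>, which is non-negative and decreasing:
  \<open>min x s - E min D s = x / \<theta> * u x - (\<integral>v\<in>{0..1}. u (x + v))\<close>. For such \<open>u\<close>, size-biasing each summand,
  Abel summation and the comparison of a Riemann sum with its integral bound the expectation of the
  right-hand side at \<open>S\<close> by a multiple of \<open>\<epsilon> * E (u S)\<close>. An indicator smoothed over an interval of
  length \<open>h\<close> is a difference of two such test functions; the expectation of its solution at \<open>S\<close> is in turn
  bounded by the Kolmogorov distance \<open>d\<close> and the concentration function of the Dickman law, where summing
  over blocks of length \<open>s\<close> produces \<open>\<zeta>(1 + \<theta>)\<close>. With \<open>h = (2 * \<theta> + 4 * \<theta> * \<zeta>(1 + \<theta>)) * \<epsilon>\<close> the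
  resulting inequality for \<open>d\<close> has coefficient \<open>1 / 2\<close> on the right and can be solved for \<open>d\<close>.\<close>

section \<open>The generalized Dickman law\<close>

text \<open>Origin of the averages: differentiating the Stein equation formally and multiplying by
  \<open>\<theta> * x powr \<theta>\<close> shows that \<open>x powr (\<theta> + 1) * u x\<close>
  has derivative \<open>\<theta> * x powr \<theta> * (indicator {..s} x + u (x + 1))\<close>. So
  \<open>u\<close> is a fixed point of a unit shift followed by an averaging of total mass
  \<open>\<theta> / (\<theta> + 1) < 1\<close>, and it is built as a Neumann series whose terms are
  all decreasing. Only integrated forms of this equation are proved. For decreasing functions every
  error at \<open>S\<close> is a multiple of the single number \<open>E (u S)\<close>; this is also
  why the mass of the smallest atom suffices to control the size-bias error. The obstacle: the
  supremum of the solution for a smoothed indicator does not shrink with \<open>h\<close>. Using it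
  would give a bound of the shape \<open>\<epsilon> / h + h powr \<alpha>\<close>, which loses rate
  for every choice of \<open>h\<close>. Hence the mean of the solution at \<open>S\<close> is
  estimated instead. As \<open>S\<close> need not have a density, its concentration is borrowed from
  the Dickman law at the price of \<open>d\<close>, and the argument becomes
  self-referential.\<close>

lemma powr_add_le:
  fixes x y a :: real
  assumes "0 \<le> x" "0 \<le> y" "0 < a" "a \<le> 1"
  shows "(x + y) powr a \<le> x powr a + y powr a"
proof (cases "x + y = 0")
  case True
  then show ?thesis by simp
next
  case False
  then have s: "x + y > 0" using assms by auto
  have *: "z / (x + y) \<le> (z / (x + y)) powr a" if "0 \<le> z" "z \<le> x + y" for z
  proof (cases "z = 0")
    case False
    have "(z / (x + y)) powr 1 \<le> (z / (x + y)) powr a"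
      using that False s assms by (intro powr_mono') auto
    then show ?thesis using that s False by simp
  qed simp
  have "1 = x / (x + y) + y / (x + y)" using s by (simp add: add_divide_distrib[symmetric])
  also have "\<dots> \<le> (x / (x + y)) powr a + (y / (x + y)) powr a"
    using assms by (intro add_mono *) auto
  also have "\<dots> = (x powr a + y powr a) / (x + y) powr a"
    using assms by (simp add: powr_divide add_divide_distrib)
  finally show ?thesis using s by (simp add: field_simps)
qed

lemma Bernoulli_powr:
  fixes y a :: real
  assumes "0 \<le> y" "1 \<le> a"
  shows "1 + a * (y - 1) \<le> y powr a"
proof -
  have D: "((\<lambda>x. x powr a) has_real_derivative a * x powr (a - 1)) (at x)" if "x > 0" for x
    using that by (auto intro!: derivative_eq_intros)
  consider "y = 0" | "0 < y" "y < 1" | "y = 1" | "y > 1" using assms by linarith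
  then show ?thesis
  proof cases
    case 2
    then have "\<exists>z. z > y \<and> z < 1 \<and> 1 powr a - y powr a = (1 - y) * (a * z powr (a - 1))"
      by (intro MVT2) (auto intro!: D)
    then obtain z where z: "z > y" "z < 1" "1 - y powr a = (1 - y) * (a * z powr (a - 1))" by auto
    have "z powr (a - 1) \<le> 1" using z 2 assms by (intro powr_le1) auto
    then have "(1 - y) * (a * z powr (a - 1)) \<le> (1 - y) * (a * 1)"
      using 2 assms by (intro mult_left_mono) auto
    then show ?thesis using z by (simp add: algebra_simps)
  next
    case 4
    then have "\<exists>z. z > 1 \<and> z < y \<and> y powr a - 1 powr a = (y - 1) * (a * z powr (a - 1))"
      by (intro MVT2) (auto intro!: D)
    then obtain z where z: "z > 1" "z < y" "y powr a - 1 = (y - 1) * (a * z powr (a - 1))" by auto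
    have "z powr (a - 1) \<ge> 1" using z 4 assms by (intro ge_one_powr_ge_zero) auto
    then have "(y - 1) * (a * z powr (a - 1)) \<ge> (y - 1) * (a * 1)"
      using 4 assms by (intro mult_left_mono) auto
    then show ?thesis using z by (simp add: algebra_simps)
  qed (use assms in auto)
qed

lemma Bernoulli_powr_concave:
  fixes y a :: real
  assumes "0 \<le> y" "0 < a" "a \<le> 1"
  shows "y powr a \<le> 1 + a * (y - 1)"
proof -
  have "1 + (1 / a) * (y powr a - 1) \<le> (y powr a) powr (1 / a)"
    using assms by (intro Bernoulli_powr) auto
  also have "\<dots> = y" using assms by (simp add: powr_powr)
  finally show ?thesis using assms by (simp add: field_simps)
qed

lemma nn_integral_powr_Icc:
  fixes a c :: real
  assumes "0 < a" "0 \<le> c"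
  shows "(\<integral>\<^sup>+v\<in>{0..c}. ennreal (a * v powr (a - 1)) \<partial>lborel) = ennreal (c powr a)"
proof -
  have "((\<lambda>x. x powr (a - 1)) has_integral c powr (a - 1 + 1) / (a - 1 + 1)) {0..c}"
    using assms by (intro has_integral_powr_from_0) auto
  then have "((\<lambda>x. a * x powr (a - 1)) has_integral a * (c powr a / a)) {0..c}"
    by (intro has_integral_mult_right) simp
  then have "((\<lambda>x. a * x powr (a - 1)) has_integral c powr a) {0..c}"
    using assms by simp
  from nn_integral_has_integral_lebesgue[OF _ this] assms
  show ?thesis
    by (auto simp: nn_integral_completion ennreal_indicator ennreal_mult' mult.commute)
qed

lemma emeasure_lborel_powr_le:
  fixes a x :: real
  assumes "0 < a" "0 \<le> x"
  shows "emeasure lborel ({0..1} \<inter> {u. u powr (1 / a) \<le> x}) = ennreal ((min 1 x) powr a)"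
proof -
  have "({0..1} \<inter> {u. u powr (1 / a) \<le> x}) = {0..(min 1 x) powr a}"
  proof (intro set_eqI iffI)
    fix u assume u: "u \<in> {0..1} \<inter> {u. u powr (1 / a) \<le> x}"
    then have "u powr (1 / a) \<le> 1" using assms by (auto intro!: powr_le1)
    then have "u powr (1 / a) \<le> min 1 x" using u by auto
    then have "(u powr (1 / a)) powr a \<le> min 1 x powr a"
      using assms by (intro powr_mono2) auto
    then show "u \<in> {0..(min 1 x) powr a}" using u assms by (auto simp: powr_powr)
  next
    fix u assume u: "u \<in> {0..(min 1 x) powr a}"
    then have "u powr (1 / a) \<le> ((min 1 x) powr a) powr (1 / a)"
      using assms by (intro powr_mono2) auto
    also have "\<dots> = min 1 x" using assms by (simp add: powr_powr)
    finally have "u powr (1 / a) \<le> x" by simp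
    moreover have "(min 1 x) powr a \<le> 1" using assms by (intro powr_le1) auto
    ultimately show "u \<in> {0..1} \<inter> {u. u powr (1 / a) \<le> x}" using u by auto
  qed
  then show ?thesis by simp
qed

lemma distr_uniform_powr:
  fixes a :: real
  assumes a: "0 < a"
  shows "distr (uniform_measure lborel {0..1}) borel (\<lambda>u. u powr (1 / a))
    = density lborel (\<lambda>v. ennreal (a * v powr (a - 1)) * indicator {0..1} v)" (is "?L = ?R")
proof -
  interpret U: prob_space "uniform_measure lborel {0..1::real}"
    by (rule prob_space_uniform_measure) auto
  have cdfL: "emeasure ?L {..x} = (if x < 0 then 0 else ennreal ((min 1 x) powr a))" for x
  proof -
    have "emeasure ?L {..x} = emeasure lborel ({0..1} \<inter> {u. u powr (1 / a) \<le> x})"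
      by (subst emeasure_distr) (auto simp: vimage_def divide_ennreal_def)
    moreover have "{0..1} \<inter> {u. u powr (1 / a) \<le> x} = {}" if "x < 0"
      using that by (auto simp: not_le) (smt (verit) powr_ge_zero)
    ultimately show ?thesis using a by (auto simp: emeasure_lborel_powr_le)
  qed
  have cdfR: "emeasure ?R {..x} = (if x < 0 then 0 else ennreal ((min 1 x) powr a))" for x
  proof -
    have "emeasure ?R {..x} = (\<integral>\<^sup>+v. ennreal (a * v powr (a - 1)) * indicator {0..1} v * indicator {..x} v \<partial>lborel)"
      by (subst emeasure_density) auto
    also have "\<dots> = (\<integral>\<^sup>+v. (if x < 0 then 0 else ennreal (a * v powr (a - 1)) * indicator {0..min 1 x} v) \<partial>lborel)"
      by (intro nn_integral_cong) (auto split: split_indicator)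
    also have "\<dots> = (if x < 0 then 0 else ennreal ((min 1 x) powr a))"
      using a by (auto simp: nn_integral_powr_Icc)
    finally show ?thesis .
  qed
  have pL: "real_distribution ?L" by (intro U.real_distribution_distr) auto
  have "emeasure ?R (space ?R) = (\<integral>\<^sup>+v\<in>{0..1}. ennreal (a * v powr (a - 1)) \<partial>lborel)"
    by (subst emeasure_density) auto
  also have "\<dots> = 1" using a by (simp add: nn_integral_powr_Icc)
  finally have "prob_space ?R" by (rule prob_spaceI)
  then have pR: "real_distribution ?R"
    by (auto simp: real_distribution_def real_distribution_axioms_def)
  show ?thesis
    by (rule cdf_unique[OF pL pR]) (auto simp: cdf_def measure_def cdfL cdfR)
qed

section \<open>Distribution function, concentration and Stein identity of the law\<close>

locale dickman_law =
  fixes \<theta> :: real and \<mu> :: "real measure"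
  assumes theta: "\<theta> > 0" and gen: "gen_dickman \<theta> \<mu>"
begin

sublocale real_distribution \<mu>
  using gen by (auto simp: gen_dickman_def real_distribution_def real_distribution_axioms_def)

lemma AE_nonneg: "AE x in \<mu>. 0 \<le> x"
  using gen by (auto simp: gen_dickman_def)

lemma nn_integral_law:
  assumes [measurable]: "f \<in> borel_measurable borel"
  shows "(\<integral>\<^sup>+x. f x \<partial>\<mu>)
    = (\<integral>\<^sup>+y. (\<integral>\<^sup>+v\<in>{0..1}. f (v * (y + 1)) * ennreal (\<theta> * v powr (\<theta> - 1)) \<partial>lborel) \<partial>\<mu>)"
proof -
  let ?U = "uniform_measure lborel {0..1::real}"
  interpret U: prob_space ?U by (rule prob_space_uniform_measure) auto
  interpret P: pair_prob_space ?U \<mu> ..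
  have mu: "\<mu> = distr (?U \<Otimes>\<^sub>M \<mu>) borel (\<lambda>(u, x). u powr (1 / \<theta>) * (x + 1))"
    using gen by (simp add: gen_dickman_def)
  have [measurable_cong]: "sets ?U = sets borel" by simp
  have "(\<integral>\<^sup>+x. f x \<partial>\<mu>) = (\<integral>\<^sup>+z. f (case z of (u, x) \<Rightarrow> u powr (1 / \<theta>) * (x + 1)) \<partial>(?U \<Otimes>\<^sub>M \<mu>))"
    by (subst mu, subst nn_integral_distr) auto
  also have "\<dots> = (\<integral>\<^sup>+y. (\<integral>\<^sup>+u. f (u powr (1 / \<theta>) * (y + 1)) \<partial>?U) \<partial>\<mu>)"
    by (subst P.nn_integral_snd[symmetric]) (auto simp: case_prod_beta)
  also have "\<dots> = (\<integral>\<^sup>+y. (\<integral>\<^sup>+v. f (v * (y + 1)) \<partial>distr ?U borel (\<lambda>u. u powr (1 / \<theta>))) \<partial>\<mu>)"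
    by (intro nn_integral_cong) (subst nn_integral_distr, auto)
  also have "\<dots> = (\<integral>\<^sup>+y. (\<integral>\<^sup>+v\<in>{0..1}. f (v * (y + 1)) * ennreal (\<theta> * v powr (\<theta> - 1)) \<partial>lborel) \<partial>\<mu>)"
    unfolding distr_uniform_powr[OF theta]
    by (intro nn_integral_cong) (subst nn_integral_density, auto intro!: nn_integral_cong simp: mult_ac)
  finally show ?thesis .
qed

text \<open>Test the fixed-point equation with an indicator and integrate out the uniform variable
  first: its power \<open>1 / \<theta>\<close> has distribution function
  \<open>z powr \<theta>\<close> on \<open>[0, 1]\<close>. The integrand is explicit in
  \<open>x\<close>, so regularity of the distribution function can be read off pointwise in
  \<open>y\<close>.\<close>

lemma emeasure_atMost_eq:
  assumes "0 \<le> x"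
  shows "emeasure \<mu> {..x} = (\<integral>\<^sup>+y. ennreal (min 1 (x / (y + 1)) powr \<theta>) \<partial>\<mu>)"
proof -
  have "emeasure \<mu> {..x} = (\<integral>\<^sup>+y. indicator {..x} y \<partial>\<mu>)" by simp
  also have "\<dots> = (\<integral>\<^sup>+y. (\<integral>\<^sup>+v\<in>{0..1}. indicator {..x} (v * (y + 1)) * ennreal (\<theta> * v powr (\<theta> - 1)) \<partial>lborel) \<partial>\<mu>)"
    by (intro nn_integral_law) auto
  also have "\<dots> = (\<integral>\<^sup>+y. ennreal (min 1 (x / (y + 1)) powr \<theta>) \<partial>\<mu>)"
  proof (rule nn_integral_cong_AE, use AE_nonneg in eventually_elim)
    case (elim y)
    have "(\<integral>\<^sup>+v\<in>{0..1}. indicator {..x} (v * (y + 1)) * ennreal (\<theta> * v powr (\<theta> - 1)) \<partial>lborel)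
      = (\<integral>\<^sup>+v\<in>{0..min 1 (x / (y + 1))}. ennreal (\<theta> * v powr (\<theta> - 1)) \<partial>lborel)"
      using elim by (intro nn_integral_cong) (auto split: split_indicator simp: field_simps)
    also have "\<dots> = ennreal (min 1 (x / (y + 1)) powr \<theta>)"
      using elim assms theta by (intro nn_integral_powr_Icc) auto
    finally show ?case .
  qed
  finally show ?thesis .
qed

lemma integrable_powr_min:
  assumes "0 \<le> x"
  shows "integrable \<mu> (\<lambda>y. min 1 (x / (y + 1)) powr \<theta>)"
proof (rule integrable_const_bound[where B = 1])
  show "AE y in \<mu>. norm (min 1 (x / (y + 1)) powr \<theta>) \<le> 1"
    using AE_nonneg by eventually_elim (use assms theta in \<open>auto intro!: powr_le1\<close>)
qed simp

lemma cdf_eq: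
  assumes "0 \<le> x"
  shows "cdf \<mu> x = (\<integral>y. min 1 (x / (y + 1)) powr \<theta> \<partial>\<mu>)"
  unfolding cdf_def measure_def emeasure_atMost_eq[OF assms]
  by (subst integral_eq_nn_integral) auto

lemma cdf_0: "cdf \<mu> 0 = 0"
  by (subst cdf_eq) auto

lemma AE_pos: "AE x in \<mu>. 0 < x"
proof -
  have "{..0} \<in> null_sets \<mu>"
    using cdf_0 by (intro null_setsI) (auto simp: cdf_def emeasure_eq_measure)
  then show ?thesis by (intro AE_I'[of "{..0}"]) auto
qed

text \<open>For \<open>x \<le> 1\<close> and \<open>y \<ge> 0\<close> the truncation at 1 is
  inactive, so the integrand of \<open>cdf_eq\<close> is homogeneous of degree
  \<open>\<theta>\<close> in \<open>x\<close>.\<close>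

lemma cdf_powr:
  assumes "0 \<le> x" "x \<le> 1"
  shows "cdf \<mu> x = cdf \<mu> 1 * x powr \<theta>"
proof -
  have "cdf \<mu> x = (\<integral>y. min 1 (1 / (y + 1)) powr \<theta> * x powr \<theta> \<partial>\<mu>)"
    unfolding cdf_eq[OF assms(1)]
  proof (rule integral_cong_AE)
    show "AE y in \<mu>. min 1 (x / (y + 1)) powr \<theta> = min 1 (1 / (y + 1)) powr \<theta> * x powr \<theta>"
      using AE_nonneg
    proof eventually_elim
      case (elim y)
      then have "x / (y + 1) \<le> 1" "1 / (y + 1) \<le> 1" using assms by auto
      then have "min 1 (x / (y + 1)) = min 1 (1 / (y + 1)) * x"
        by (simp add: min_absorb2)
      then show ?case using assms elim by (simp add: powr_divide)
    qed
  qed auto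
  then show ?thesis by (simp add: cdf_eq)
qed

text \<open>By subadditivity of the power, the integrand of \<open>cdf_eq\<close> is Hoelder
  continuous in \<open>x\<close> with exponent \<open>\<theta>\<close> and constant 1, uniformly in
  \<open>y \<ge> 0\<close>. This is the concentration bound for the regime
  \<open>\<theta> < 1\<close>.\<close>

lemma cdf_diff_le_powr:
  assumes "\<theta> \<le> 1" "0 \<le> a" "a \<le> b"
  shows "cdf \<mu> b - cdf \<mu> a \<le> (b - a) powr \<theta>"
proof -
  have "cdf \<mu> b - cdf \<mu> a = (\<integral>y. min 1 (b / (y + 1)) powr \<theta> - min 1 (a / (y + 1)) powr \<theta> \<partial>\<mu>)"
    using assms by (simp add: cdf_eq integrable_powr_min)
  also have "\<dots> \<le> (\<integral>y. (b - a) powr \<theta> \<partial>\<mu>)"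
  proof (rule integral_mono_AE)
    show "AE y in \<mu>. min 1 (b / (y + 1)) powr \<theta> - min 1 (a / (y + 1)) powr \<theta> \<le> (b - a) powr \<theta>"
      using AE_nonneg
    proof eventually_elim
      case (elim y)
      have "min 1 (b / (y + 1)) \<le> min 1 (a / (y + 1)) + (b - a)"
      proof -
        have "b / (y + 1) = a / (y + 1) + (b - a) / (y + 1)" by (simp add: diff_divide_distrib)
        moreover have "(b - a) / (y + 1) \<le> (b - a) / 1"
          using elim assms by (intro divide_left_mono) auto
        ultimately show ?thesis using assms by auto
      qed
      then have "min 1 (b / (y + 1)) powr \<theta> \<le> (min 1 (a / (y + 1)) + (b - a)) powr \<theta>"
        using elim assms theta by (intro powr_mono2) auto
      also have "\<dots> \<le> min 1 (a / (y + 1)) powr \<theta> + (b - a) powr \<theta>"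
        using elim assms theta by (intro powr_add_le) auto
      finally show ?case by simp
    qed
  qed (use assms in \<open>auto intro!: integrable_powr_min\<close>)
  finally show ?thesis using prob_space by simp
qed

text \<open>On \<open>[0, 1]\<close> the density is \<open>\<theta> * c * x powr (\<theta> - 1)\<close> with \<open>c = cdf \<mu> 1\<close>, so it suffices that
  \<open>\<theta> * c \<le> k\<close>. This comes from the increments of the distribution function over \<open>[1, 1 + h]\<close> as
  \<open>h\<close> tends to 0.\<close>

lemma cdf_diff_le_linear:
  assumes th: "1 \<le> \<theta>" and k: "0 \<le> k"
    and dens: "\<And>a b. 1 \<le> a \<Longrightarrow> a \<le> b \<Longrightarrow> cdf \<mu> b - cdf \<mu> a \<le> k * (b - a)"
    and ab: "0 \<le> a" "a \<le> b"
  shows "cdf \<mu> b - cdf \<mu> a \<le> k * (b - a)"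
proof -
  define c where "c = cdf \<mu> 1"
  have c0: "0 \<le> c" by (simp add: c_def cdf_nonneg)
  have kc: "\<theta> * c * (1 - h powr \<theta>) \<le> k" if h: "0 < h" "h \<le> 1" for h
  proof -
    define G where "G = cdf \<mu> h"
    have G: "G = c * h powr \<theta>" unfolding G_def c_def using h by (intro cdf_powr) auto
    have GI: "G = (\<integral>y. indicator {..h} y \<partial>\<mu>)" by (simp add: G_def cdf_def)
    \<comment> \<open>From 1 to \<open>1 + h\<close> the integrand of \<open>cdf_eq\<close> is
      multiplied by \<open>(1 + h) powr \<theta>\<close> where \<open>y > h\<close>, and it does not
      decrease elsewhere. Subtracting the indicator of \<open>{..h}\<close>, instead of restricting
      to \<open>y > h\<close>, only lowers the left-hand side because the integrand is at most
      1.\<close>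
    have "c - G = (\<integral>y. min 1 (1 / (y + 1)) powr \<theta> - indicator {..h} y \<partial>\<mu>)"
      unfolding GI c_def cdf_eq[OF zero_le_one] using integrable_powr_min[of 1]
      by (subst Bochner_Integration.integral_diff) (auto intro!: integrable_real_indicator simp: emeasure_eq_measure)
    then have "(c - G) * ((1 + h) powr \<theta> - 1) =
      (\<integral>y. (min 1 (1 / (y + 1)) powr \<theta> - indicator {..h} y) * ((1 + h) powr \<theta> - 1) \<partial>\<mu>)"
      by simp
    also have "\<dots> \<le>
      (\<integral>y. min 1 ((1 + h) / (y + 1)) powr \<theta> - min 1 (1 / (y + 1)) powr \<theta> \<partial>\<mu>)"
    proof (rule integral_mono_AE)
      show "AE y in \<mu>. (min 1 (1 / (y + 1)) powr \<theta> - indicator {..h} y) * ((1 + h) powr \<theta> - 1)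
        \<le> min 1 ((1 + h) / (y + 1)) powr \<theta> - min 1 (1 / (y + 1)) powr \<theta>"
        using AE_nonneg
      proof eventually_elim
        case (elim y)
        define p q m where "p = (1 / (y + 1)) powr \<theta>" and "q = (1 + h) powr \<theta>"
          and "m = min 1 ((1 + h) / (y + 1)) powr \<theta>"
        have q: "1 \<le> q" unfolding q_def using h theta by (intro ge_one_powr_ge_zero) auto
        have p: "p \<le> 1" unfolding p_def using elim theta by (intro powr_le1) auto
        have mp: "min 1 (1 / (y + 1)) = 1 / (y + 1)" using elim by (intro min_absorb2) auto
        have "1 / (y + 1) \<le> (1 + h) / (y + 1)" using elim h by (intro divide_right_mono) auto
        then have "min 1 (1 / (y + 1)) powr \<theta> \<le> m" unfolding m_def using elim h theta
          by (intro powr_mono2) auto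
        then have pm: "p \<le> m" unfolding mp p_def .
        have "(p - indicator {..h} y) * (q - 1) \<le> m - p"
        proof (cases "y \<le> h")
          case True
          have "(p - 1) * (q - 1) \<le> 0" using p q by (intro mult_nonpos_nonneg) auto
          then show ?thesis using True pm by simp
        next
          case False
          have "(1 + h) / (y + 1) \<le> 1" using False elim h by auto
          then have "m = q * p" using elim h by (simp add: m_def q_def p_def min_absorb2 powr_divide)
          then show ?thesis using False by (simp add: algebra_simps)
        qed
        then show ?case by (simp only: p_def q_def m_def mp)
      qed
    qed (use h integrable_powr_min[of 1] in \<open>auto intro!: integrable_powr_min Bochner_Integration.integrable_diff
      integrable_mult_left integrable_real_indicator simp: emeasure_eq_measure\<close>)
    also have "\<dots> = cdf \<mu> (1 + h) - cdf \<mu> 1"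
      using h by (simp add: cdf_eq integrable_powr_min)
    also have "\<dots> \<le> k * h" using dens[of 1 "1 + h"] h by simp
    finally have *: "(c - G) * ((1 + h) powr \<theta> - 1) \<le> k * h" .
    have "c * (1 - h powr \<theta>) * (\<theta> * h) \<le> c * (1 - h powr \<theta>) * ((1 + h) powr \<theta> - 1)"
      using Bernoulli_powr[of "1 + h" \<theta>] h th c0
      by (intro mult_left_mono) (auto intro!: mult_nonneg_nonneg powr_le1)
    also have "\<dots> \<le> k * h" using * by (simp add: G algebra_simps)
    finally show ?thesis using h by (simp add: mult_ac)
  qed
  have "((\<lambda>h. \<theta> * c * (1 - h powr \<theta>)) \<longlongrightarrow> \<theta> * c * (1 - 0)) (at_right 0)"
    using theta by (intro tendsto_intros tendsto_zero_powrI[of _ _ _ \<theta>]) (auto simp: eventually_at_right_less eventually_at_filter)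
  moreover have "eventually (\<lambda>h. \<theta> * c * (1 - h powr \<theta>) \<le> k) (at_right 0)"
    by (auto simp: eventually_at_right[of 0 1] intro!: kc exI[of _ 1])
  ultimately have kc': "\<theta> * c \<le> k"
    by (auto intro: tendsto_upperbound)
  have low: "cdf \<mu> b - cdf \<mu> a \<le> k * (b - a)" if ab: "0 \<le> a" "a \<le> b" "b \<le> 1" for a b
  proof (cases "b = 0")
    case False
    have "1 + \<theta> * (a / b - 1) \<le> (a / b) powr \<theta>" using that th by (intro Bernoulli_powr) auto
    then have "b powr \<theta> - a powr \<theta> \<le> b powr \<theta> * (\<theta> * (1 - a / b))"
      using that False by (simp add: powr_divide field_simps)
    also have "\<dots> = b powr (\<theta> - 1) * (\<theta> * (b - a))"
      using that False by (simp add: powr_diff field_simps)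
    also have "\<dots> \<le> 1 * (\<theta> * (b - a))"
      using that theta th by (intro mult_right_mono powr_le1) auto
    finally have "c * (b powr \<theta> - a powr \<theta>) \<le> c * (\<theta> * (b - a))" using c0 by (intro mult_left_mono) auto
    also have "\<dots> \<le> k * (b - a)" using kc' mult_right_mono[OF kc', of "b - a"] that by (simp add: mult_ac)
    finally show ?thesis using cdf_powr[of a] cdf_powr[of b] that by (simp add: c_def algebra_simps)
  qed (use that in auto)
  consider "b \<le> 1" | "1 \<le> a" | "a \<le> 1" "1 \<le> b" by linarith
  then show ?thesis
  proof cases
    case 3
    then show ?thesis using low[of a 1] dens[of 1 b] ab by (simp add: algebra_simps)
  qed (use low dens ab in auto)
qed

text \<open>Size-biasing the law amounts to adding an independent uniform variable on the unit
  interval. The substitution \<open>x = v * (y + 1)\<close> in \<open>nn_integral_law\<close>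
  exhibits a density \<open>f\<close> with \<open>x * f x = \<theta> * x powr \<theta> * E ((D + 1)
  powr - \<theta>; D > x - 1)\<close>; by \<open>key\<close> the right-hand side is
  \<open>\<theta>\<close> times the probability of \<open>x - 1 < D \<le> x\<close>, and exchanging
  the integrals gives the claim.\<close>

lemma nn_integral_stein:
  assumes [measurable]: "g \<in> borel_measurable borel"
  shows "(\<integral>\<^sup>+x. ennreal x * g x \<partial>\<mu>)
    = ennreal \<theta> * (\<integral>\<^sup>+y. (\<integral>\<^sup>+x\<in>{y<..<y + 1}. g x \<partial>lborel) \<partial>\<mu>)"
proof -
  \<comment> \<open>Split the formula of \<open>emeasure_atMost_eq\<close> at
    \<open>y = x - 1\<close>: up to there the integrand is 1, beyond it the truncation is inactive.
    The finite mass of \<open>{..x - 1}\<close> then cancels.\<close>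
  have key: "ennreal (x powr \<theta>) * (\<integral>\<^sup>+y. ennreal ((y + 1) powr - \<theta>) * indicator {x - 1<..} y \<partial>\<mu>)
      = emeasure \<mu> {x - 1<..x}" if "0 \<le> x" for x
  proof -
    have "ennreal (x powr \<theta>) * (\<integral>\<^sup>+y. ennreal ((y + 1) powr - \<theta>) * indicator {x - 1<..} y \<partial>\<mu>) + emeasure \<mu> {..x - 1}
      = (\<integral>\<^sup>+y. ennreal (x powr \<theta>) * (ennreal ((y + 1) powr - \<theta>) * indicator {x - 1<..} y) + indicator {..x - 1} y \<partial>\<mu>)"
      by (subst nn_integral_add) (auto simp: nn_integral_cmult)
    also have "\<dots> = (\<integral>\<^sup>+y. ennreal (min 1 (x / (y + 1)) powr \<theta>) \<partial>\<mu>)"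
    proof (rule nn_integral_cong_AE, use AE_nonneg in eventually_elim)
      case (elim y)
      show ?case
      proof (cases "y \<le> x - 1")
        case True
        then have "1 \<le> x / (y + 1)" using elim by simp
        then show ?thesis using True by (simp add: min_absorb1)
      next
        case False
        then have "x / (y + 1) \<le> 1" using elim by simp
        then show ?thesis using False elim that
          by (simp add: min_absorb2 powr_divide powr_minus_divide ennreal_mult'[symmetric])
      qed
    qed
    also have "\<dots> = emeasure \<mu> {..x}" using emeasure_atMost_eq[OF that] ..
    also have "\<dots> = emeasure \<mu> {x - 1<..x} + emeasure \<mu> {..x - 1}"
      by (subst plus_emeasure) (auto intro!: arg_cong[where f = "emeasure \<mu>"])
    finally show ?thesis by (simp add: emeasure_eq_measure ennreal_add_left_cancel)
  qed
  have scale: "(\<integral>\<^sup>+v\<in>{0..1}. ennreal (v * (y + 1)) * g (v * (y + 1)) * ennreal (\<theta> * v powr (\<theta> - 1)) \<partial>lborel)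
      = (\<integral>\<^sup>+x\<in>{0<..<y + 1}. ennreal \<theta> * ennreal (x powr \<theta>) * ennreal ((y + 1) powr - \<theta>) * g x \<partial>lborel)"
    if y: "0 \<le> y" for y
  proof -
    let ?f = "\<lambda>x. ennreal \<theta> * ennreal (x powr \<theta>) * ennreal ((y + 1) powr - \<theta>) * g x * indicator {0<..<y + 1} x"
    have "(\<integral>\<^sup>+x. ?f x \<partial>lborel) = ennreal \<bar>y + 1\<bar> * (\<integral>\<^sup>+v. ?f (0 + (y + 1) * v) \<partial>lborel)"
      using y by (intro nn_integral_real_affine) auto
    also have "\<dots> = (\<integral>\<^sup>+v. ennreal \<bar>y + 1\<bar> * ?f (0 + (y + 1) * v) \<partial>lborel)"
      by (subst nn_integral_cmult) auto
    also have "\<dots> = (\<integral>\<^sup>+v\<in>{0..1}. ennreal (v * (y + 1)) * g (v * (y + 1)) * ennreal (\<theta> * v powr (\<theta> - 1)) \<partial>lborel)"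
    proof (rule nn_integral_cong_AE)
      have "AE v in lborel. v \<notin> {0, 1::real}"
        by (rule AE_not_in) (simp add: finite_imp_null_set_lborel)
      then show "AE v in lborel. ennreal \<bar>y + 1\<bar> * ?f (0 + (y + 1) * v) =
         ennreal (v * (y + 1)) * g (v * (y + 1)) * ennreal (\<theta> * v powr (\<theta> - 1)) * indicator {0..1} v"
      proof eventually_elim
        case (elim v)
        have iff: "(y + 1) * v < y + 1 \<longleftrightarrow> v < 1" "0 < (y + 1) * v \<longleftrightarrow> 0 < v"
          using y by (simp_all add: zero_less_mult_iff)
        show ?case
        proof (cases "0 < v \<and> v < 1")
          case True
          have e: "(y + 1) * (\<theta> * ((y + 1) * v) powr \<theta> * (y + 1) powr - \<theta>) = v * (y + 1) * (\<theta> * v powr (\<theta> - 1))"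
          proof -
            have 1: "((y + 1) * v) powr \<theta> * (y + 1) powr - \<theta> = v powr \<theta>"
              using True y by (simp add: powr_mult powr_minus)
            have 2: "v powr \<theta> = v * v powr (\<theta> - 1)"
              using True by (simp add: powr_diff)
            show ?thesis using 1 2 by (simp add: mult_ac)
          qed
          have "ennreal \<bar>y + 1\<bar> * ?f (0 + (y + 1) * v) =
             ennreal ((y + 1) * (\<theta> * ((y + 1) * v) powr \<theta> * (y + 1) powr - \<theta>)) * g (v * (y + 1))"
            using True y theta iff by (simp add: ennreal_mult'' ennreal_mult' mult_ac)
          then show ?thesis unfolding e using True y theta
            by (simp add: ennreal_mult'' ennreal_mult' mult_ac)
        next
          case False
          then show ?thesis using iff elim by (auto split: split_indicator)
        qed
      qed
    qed
    finally show ?thesis ..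
  qed
  have "(\<integral>\<^sup>+x. ennreal x * g x \<partial>\<mu>) = (\<integral>\<^sup>+y. (\<integral>\<^sup>+v\<in>{0..1}. ennreal (v * (y + 1)) * g (v * (y + 1)) * ennreal (\<theta> * v powr (\<theta> - 1)) \<partial>lborel) \<partial>\<mu>)"
    by (rule nn_integral_law) auto
  also have "\<dots> = (\<integral>\<^sup>+y. (\<integral>\<^sup>+x\<in>{0<..<y + 1}. ennreal \<theta> * ennreal (x powr \<theta>) * ennreal ((y + 1) powr - \<theta>) * g x \<partial>lborel) \<partial>\<mu>)"
    by (rule nn_integral_cong_AE, use AE_nonneg in eventually_elim) (rule scale)
  also have "\<dots> = (\<integral>\<^sup>+x. (\<integral>\<^sup>+y. ennreal \<theta> * ennreal (x powr \<theta>) * ennreal ((y + 1) powr - \<theta>) * g x * indicator {0<..<y + 1} x \<partial>\<mu>) \<partial>lborel)"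
  proof -
    interpret P: pair_sigma_finite lborel \<mu> ..
    have [measurable]: "Measurable.pred (borel \<Otimes>\<^sub>M borel) (\<lambda>x. fst x \<in> {0<..<snd x + 1 :: real})"
      unfolding greaterThanLessThan_iff by measurable
    show ?thesis by (rule P.Fubini') measurable
  qed
  also have "\<dots> = (\<integral>\<^sup>+x. ennreal \<theta> * (g x * emeasure \<mu> {x - 1<..x} * indicator {0<..} x) \<partial>lborel)"
  proof (rule nn_integral_cong)
    fix x :: real
    have "(\<integral>\<^sup>+y. ennreal \<theta> * ennreal (x powr \<theta>) * ennreal ((y + 1) powr - \<theta>) * g x * indicator {0<..<y + 1} x \<partial>\<mu>)
       = (\<integral>\<^sup>+y. ennreal \<theta> * g x * indicator {0<..} x * (ennreal (x powr \<theta>) * (ennreal ((y + 1) powr - \<theta>) * indicator {x - 1<..} y)) \<partial>\<mu>)"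
      by (intro nn_integral_cong) (auto split: split_indicator simp: mult_ac)
    also have "\<dots> = ennreal \<theta> * g x * indicator {0<..} x * (ennreal (x powr \<theta>) * (\<integral>\<^sup>+y. ennreal ((y + 1) powr - \<theta>) * indicator {x - 1<..} y \<partial>\<mu>))"
      by (simp add: nn_integral_cmult)
    also have "\<dots> = ennreal \<theta> * (g x * emeasure \<mu> {x - 1<..x} * indicator {0<..} x)"
      using key[of x] by (auto split: split_indicator simp: mult_ac)
    finally show "(\<integral>\<^sup>+y. ennreal \<theta> * ennreal (x powr \<theta>) * ennreal ((y + 1) powr - \<theta>) * g x * indicator {0<..<y + 1} x \<partial>\<mu>)
      = ennreal \<theta> * (g x * emeasure \<mu> {x - 1<..x} * indicator {0<..} x)" .
  qed
  also have "\<dots> = (\<integral>\<^sup>+x. ennreal \<theta> * (\<integral>\<^sup>+y. g x * (if x - 1 < y \<and> y \<le> x \<and> 0 < x then 1 else 0) \<partial>\<mu>) \<partial>lborel)"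
  proof (rule nn_integral_cong)
    fix x :: real
    have "(\<integral>\<^sup>+y. g x * (if x - 1 < y \<and> y \<le> x \<and> 0 < x then 1 else 0) \<partial>\<mu>)
      = (\<integral>\<^sup>+y. g x * indicator {0<..} x * indicator {x - 1<..x} y \<partial>\<mu>)"
      by (intro nn_integral_cong) (auto split: split_indicator)
    also have "\<dots> = g x * indicator {0<..} x * emeasure \<mu> {x - 1<..x}"
      by (rule nn_integral_cmult_indicator) auto
    finally show "ennreal \<theta> * (g x * emeasure \<mu> {x - 1<..x} * indicator {0<..} x)
      = ennreal \<theta> * (\<integral>\<^sup>+y. g x * (if x - 1 < y \<and> y \<le> x \<and> 0 < x then 1 else 0) \<partial>\<mu>)"
      by (simp add: mult_ac)
  qed
  also have "\<dots> = ennreal \<theta> * (\<integral>\<^sup>+x. (\<integral>\<^sup>+y. g x * (if x - 1 < y \<and> y \<le> x \<and> 0 < x then 1 else 0) \<partial>\<mu>) \<partial>lborel)"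
    by (rule nn_integral_cmult) measurable
  also have "(\<integral>\<^sup>+x. (\<integral>\<^sup>+y. g x * (if x - 1 < y \<and> y \<le> x \<and> 0 < x then 1 else 0) \<partial>\<mu>) \<partial>lborel)
    = (\<integral>\<^sup>+y. (\<integral>\<^sup>+x. g x * (if x - 1 < y \<and> y \<le> x \<and> 0 < x then 1 else 0) \<partial>lborel) \<partial>\<mu>)"
  proof -
    interpret P: pair_sigma_finite lborel \<mu> ..
    show ?thesis by (rule P.Fubini'[symmetric]) measurable
  qed
  also have "\<dots> = (\<integral>\<^sup>+y. (\<integral>\<^sup>+x\<in>{y<..<y + 1}. g x \<partial>lborel) \<partial>\<mu>)"
  \<comment> \<open>The constraint \<open>0 < x\<close> left over from the substitution is implied
    by \<open>y \<le> x\<close> because almost surely \<open>0 < y\<close>.\<close>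
  proof (rule nn_integral_cong_AE, use AE_pos in eventually_elim)
    case (elim y)
    show ?case
    proof (rule nn_integral_cong_AE)
      show "AE x in lborel. g x * (if x - 1 < y \<and> y \<le> x \<and> 0 < x then 1 else 0) = g x * indicator {y<..<y + 1} x"
        using AE_lborel_singleton[of y] by eventually_elim (use elim in \<open>auto split: split_indicator\<close>)
    qed
  qed
  finally show ?thesis .
qed

end

section \<open>The Stein equation\<close>

text \<open>The integrating factor of the differentiated Stein equation, rescaled to
  \<open>[0, 1]\<close>. It is deliberately not normalised: the mass
  \<open>\<theta> / (\<theta> + 1)\<close> is the ratio of the geometric series that dominates
  \<open>stein_sum\<close>.\<close>

definition avg_measure :: "real \<Rightarrow> real measure" where
  "avg_measure \<theta> = density lborel (\<lambda>v. ennreal (\<theta> * v powr \<theta>) * indicator {0..1} v)"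

definition avg :: "real \<Rightarrow> (real \<Rightarrow> real) \<Rightarrow> real \<Rightarrow> real" where
  "avg \<theta> f x = (\<integral>v. f (v * x) \<partial>avg_measure \<theta>)"

primrec stein_iter :: "real \<Rightarrow> (real \<Rightarrow> real) \<Rightarrow> nat \<Rightarrow> real \<Rightarrow> real" where
  "stein_iter \<theta> f 0 = f"
| "stein_iter \<theta> f (Suc k) = avg \<theta> (\<lambda>z. stein_iter \<theta> f k (z + 1))"

text \<open>Neumann series for the equation
  \<open>u = f + avg \<theta> (\<lambda>z. u (z + 1))\<close>, see
  \<open>stein_sum_fixpoint\<close>.\<close>

definition stein_sum :: "real \<Rightarrow> (real \<Rightarrow> real) \<Rightarrow> real \<Rightarrow> real" where
  "stein_sum \<theta> f x = (\<Sum>k. stein_iter \<theta> f k x)"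

text \<open>Monotonicity on the whole line yields Borel measurability, and the bounds yield
  integrability against every finite measure. The class is stable under shifts, averages and
  expectations, so this one predicate settles the side conditions of almost all integrals
  below.\<close>

definition antimono_upto :: "real \<Rightarrow> (real \<Rightarrow> real) \<Rightarrow> bool" where
  "antimono_upto c f \<longleftrightarrow> antimono f \<and> (\<forall>x. 0 \<le> f x \<and> f x \<le> c)"

lemma antimono_uptoD:
  assumes "antimono_upto c f"
  shows "x \<le> y \<Longrightarrow> f y \<le> f x" "0 \<le> f x" "f x \<le> c" "0 \<le> c"
  using assms by (auto simp: antimono_upto_def antimono_def intro: order.trans)

lemma antimono_upto_measurable [measurable_dest]:
  assumes "antimono_upto c f"
  shows "f \<in> borel_measurable borel"
proof -
  have "mono (\<lambda>x. - f x)"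
    using antimono_uptoD(1)[OF assms] by (auto simp: mono_def)
  then have "(\<lambda>x. - f x) \<in> borel_measurable borel" by (rule borel_measurable_mono)
  then have "(\<lambda>x. - (- f x)) \<in> borel_measurable borel" by (rule borel_measurable_uminus)
  then show ?thesis by simp
qed

lemma antimono_upto_shift:
  "antimono_upto c f \<Longrightarrow> antimono_upto c (\<lambda>z. f (z + a))"
  by (auto simp: antimono_upto_def antimono_def)

lemma antimono_upto_cmult:
  "antimono_upto c f \<Longrightarrow> 0 \<le> a \<Longrightarrow> antimono_upto (a * c) (\<lambda>x. a * f x)"
  by (auto simp: antimono_upto_def antimono_def intro: mult_left_mono)

text \<open>For \<open>x > 0\<close> this is the average of the indicator of \<open>{..s}\<close>,
  see \<open>ramp_eq_avg\<close>. The maximum continues it by a constant to the left, so that it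
  decreases on the whole line; for \<open>s = 0\<close> division by zero makes it the zero
  function.\<close>

definition ramp :: "real \<Rightarrow> real \<Rightarrow> real \<Rightarrow> real" where
  "ramp \<theta> s x = \<theta> / (\<theta> + 1) * (s / max s x) powr (\<theta> + 1)"

text \<open>Solves the Stein equation for the test function \<open>\<lambda>x. min x s\<close>, see \<open>stein_equation\<close>.\<close>

definition stein_sol :: "real \<Rightarrow> real \<Rightarrow> real \<Rightarrow> real" where
  "stein_sol \<theta> s = stein_sum \<theta> (ramp \<theta> s)"

definition unit_int :: "(real \<Rightarrow> real) \<Rightarrow> real \<Rightarrow> real" where
  "unit_int f x = enn2real (\<integral>\<^sup>+v\<in>{x<..<x + 1}. ennreal (f v) \<partial>lborel)"

section \<open>The averaging operator, its Neumann series and the Stein equation\<close>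

context dickman_law
begin

abbreviation "\<rho> \<equiv> \<theta> / (\<theta> + 1)"

lemma rho: "0 < \<rho>" "\<rho> < 1"
  using theta by auto

lemma emeasure_avg_measure: "emeasure (avg_measure \<theta>) UNIV = ennreal \<rho>"
proof -
  have "emeasure (avg_measure \<theta>) UNIV = (\<integral>\<^sup>+v\<in>{0..1}. ennreal (\<theta> * v powr \<theta>) \<partial>lborel)"
    unfolding avg_measure_def by (subst emeasure_density) auto
  also have "\<dots> = (\<integral>\<^sup>+v. ennreal \<rho> * (ennreal ((\<theta> + 1) * v powr (\<theta> + 1 - 1)) * indicator {0..1} v) \<partial>lborel)"
    using theta by (intro nn_integral_cong) (auto split: split_indicator simp: ennreal_mult'[symmetric])
  also have "\<dots> = ennreal \<rho> * (\<integral>\<^sup>+v\<in>{0..1}. ennreal ((\<theta> + 1) * v powr (\<theta> + 1 - 1)) \<partial>lborel)"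
    by (rule nn_integral_cmult) auto
  also have "\<dots> = ennreal \<rho>"
    using theta by (subst nn_integral_powr_Icc) auto
  finally show ?thesis .
qed

lemma space_avg_measure [simp]: "space (avg_measure \<theta>) = UNIV"
  and sets_avg_measure [simp, measurable_cong]: "sets (avg_measure \<theta>) = sets borel"
  by (auto simp: avg_measure_def)

lemma measure_avg_measure: "measure (avg_measure \<theta>) UNIV = \<rho>"
  using theta by (simp add: measure_def emeasure_avg_measure)

lemma finite_avg_measure: "finite_measure (avg_measure \<theta>)"
  by (rule finite_measureI) (simp add: emeasure_avg_measure)

lemma AE_avg_measure: "AE v in avg_measure \<theta>. 0 \<le> v \<and> v \<le> 1"
  unfolding avg_measure_def by (subst AE_density) (auto split: split_indicator)

lemma integrable_avg:
  assumes "antimono_upto c f"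
  shows "integrable (avg_measure \<theta>) (\<lambda>v. f (v * x))"
proof -
  interpret finite_measure "avg_measure \<theta>" by (rule finite_avg_measure)
  note [measurable] = antimono_upto_measurable[OF assms]
  show ?thesis
    by (rule integrable_const_bound[where B = c]) (use antimono_uptoD[OF assms] in auto)
qed

lemma antimono_upto_avg:
  assumes f: "antimono_upto c f"
  shows "antimono_upto (\<rho> * c) (avg \<theta> f)"
proof -
  interpret finite_measure "avg_measure \<theta>" by (rule finite_avg_measure)
  have "avg \<theta> f y \<le> avg \<theta> f x" if "x \<le> y" for x y
    unfolding avg_def
  proof (rule integral_mono_AE)
    show "AE v in avg_measure \<theta>. f (v * y) \<le> f (v * x)"
      using AE_avg_measure by eventually_elim (use that in \<open>auto intro!: antimono_uptoD(1)[OF f] mult_left_mono\<close>)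
  qed (auto intro: integrable_avg[OF f])
  moreover have "0 \<le> avg \<theta> f x" for x
    unfolding avg_def using antimono_uptoD(2)[OF f] by (intro integral_nonneg_AE) auto
  moreover have "avg \<theta> f x \<le> \<rho> * c" for x
  proof -
    have "avg \<theta> f x \<le> (\<integral>v. c \<partial>avg_measure \<theta>)"
      unfolding avg_def using antimono_uptoD(3)[OF f] integrable_avg[OF f] by (intro integral_mono) auto
    then show ?thesis by (simp add: measure_avg_measure)
  qed
  ultimately show ?thesis by (auto simp: antimono_upto_def antimono_def)
qed

lemma antimono_upto_iter:
  assumes "antimono_upto c f"
  shows "antimono_upto (\<rho> ^ k * c) (stein_iter \<theta> f k)"
proof (induction k)
  case (Suc k)
  from antimono_upto_avg[OF antimono_upto_shift[OF Suc]] show ?case by (simp add: mult_ac)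
qed (use assms in simp)

text \<open>For \<open>0 \<le> x\<close> the operator evaluates the previous iterate only at points
  \<open>v * x + 1 \<ge> 1\<close>. Hence all terms but the zeroth are controlled by the value at 1,
  each step contributing one factor \<open>\<rho>\<close>.\<close>

lemma stein_iter_le:
  assumes f: "antimono_upto c f" and x: "0 \<le> x"
  shows "stein_iter \<theta> f (Suc k) x \<le> \<rho> ^ Suc k * f 1"
  using x
proof (induction k arbitrary: x)
  case 0
  interpret finite_measure "avg_measure \<theta>" by (rule finite_avg_measure)
  have "stein_iter \<theta> f (Suc 0) x \<le> (\<integral>v. f 1 \<partial>avg_measure \<theta>)"
    unfolding stein_iter.simps avg_def
  proof (rule integral_mono_AE)
    show "AE v in avg_measure \<theta>. f (v * x + 1) \<le> f 1"
      using AE_avg_measure by eventually_elim (use 0 antimono_uptoD(1)[OF f] in auto)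
  qed (auto intro: integrable_avg[OF antimono_upto_shift[OF f]])
  then show ?case by (simp add: measure_avg_measure)
next
  case (Suc k)
  interpret finite_measure "avg_measure \<theta>" by (rule finite_avg_measure)
  have "stein_iter \<theta> f (Suc (Suc k)) x \<le> (\<integral>v. \<rho> ^ Suc k * f 1 \<partial>avg_measure \<theta>)"
    unfolding stein_iter.simps(2)[of _ _ "Suc k"] avg_def
  proof (rule integral_mono_AE)
    show "AE v in avg_measure \<theta>. stein_iter \<theta> f (Suc k) (v * x + 1) \<le> \<rho> ^ Suc k * f 1"
      using AE_avg_measure by eventually_elim (use Suc.prems in \<open>intro Suc.IH, auto\<close>)
    show "integrable (avg_measure \<theta>) (\<lambda>v. stein_iter \<theta> f (Suc k) (v * x + 1))"
      using integrable_avg[OF antimono_upto_shift[OF antimono_upto_iter[OF f]]] .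
  qed auto
  then show ?case by (simp add: measure_avg_measure mult_ac)
qed

lemma summable_rho: "summable (\<lambda>k. \<rho> ^ k * c)" and suminf_rho: "(\<Sum>k. \<rho> ^ k * c) = (\<theta> + 1) * c"
proof -
  have "(\<lambda>k. \<rho> ^ k) sums (1 / (1 - \<rho>))" using rho by (intro geometric_sums) (simp only: real_norm_def abs_of_pos)
  moreover have "1 / (1 - \<rho>) = \<theta> + 1" using theta by (simp add: field_simps)
  ultimately have "(\<lambda>k. \<rho> ^ k * c) sums ((\<theta> + 1) * c)" by (metis sums_mult2)
  then show "summable (\<lambda>k. \<rho> ^ k * c)" "(\<Sum>k. \<rho> ^ k * c) = (\<theta> + 1) * c"
    by (auto simp: sums_iff)
qed

lemma summable_stein_iter:
  assumes "antimono_upto c f"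
  shows "summable (\<lambda>k. stein_iter \<theta> f k x)"
  using antimono_uptoD[OF antimono_upto_iter[OF assms]]
  by (intro summable_comparison_test[OF _ summable_rho[of c]]) auto

lemma antimono_upto_stein_sum:
  assumes "antimono_upto c f"
  shows "antimono_upto ((\<theta> + 1) * c) (stein_sum \<theta> f)"
  unfolding antimono_upto_def antimono_def stein_sum_def suminf_rho[symmetric]
  using antimono_uptoD[OF antimono_upto_iter[OF assms]] summable_stein_iter[OF assms] summable_rho
  by (auto intro!: suminf_le suminf_nonneg)

text \<open>The powers of \<open>\<rho>\<close> from the first one on sum to
  \<open>\<theta>\<close>. Keeping \<open>f x\<close>, instead of its supremum, is what later makes
  the mean at \<open>S\<close> small.\<close>

lemma stein_sum_le:
  assumes f: "antimono_upto c f" and x: "0 \<le> x"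
  shows "stein_sum \<theta> f x \<le> f x + \<theta> * f 1"
proof -
  have s: "summable (\<lambda>k. stein_iter \<theta> f k x)" by (rule summable_stein_iter[OF f])
  have "stein_sum \<theta> f x = f x + (\<Sum>k. stein_iter \<theta> f (Suc k) x)"
    unfolding stein_sum_def using suminf_split_head[OF s] by simp
  also have "(\<Sum>k. stein_iter \<theta> f (Suc k) x) \<le> (\<Sum>k. \<rho> ^ k * (\<rho> * f 1))"
    using stein_iter_le[OF f x] s
    by (intro suminf_le summable_rho summable_Suc_iff[of "\<lambda>k. stein_iter \<theta> f k x", THEN iffD2])
      (simp_all add: mult_ac)
  also have "\<dots> = \<theta> * f 1" unfolding suminf_rho using theta by simp
  finally show ?thesis by simp
qed

lemma stein_iter_diff:
  assumes f: "antimono_upto c f" and g: "antimono_upto d g"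
  shows "stein_iter \<theta> (\<lambda>x. f x - a * g x) k x = stein_iter \<theta> f k x - a * stein_iter \<theta> g k x"
proof (induction k arbitrary: x)
  case (Suc k)
  show ?case
    using integrable_avg[OF antimono_upto_shift[OF antimono_upto_iter[OF f]]]
      integrable_avg[OF antimono_upto_shift[OF antimono_upto_iter[OF g]]]
    by (simp add: Suc avg_def)
qed simp

lemma stein_sum_diff:
  assumes f: "antimono_upto c f" and g: "antimono_upto d g"
  shows "stein_sum \<theta> (\<lambda>x. f x - a * g x) x = stein_sum \<theta> f x - a * stein_sum \<theta> g x"
  unfolding stein_sum_def stein_iter_diff[OF f g]
  using summable_stein_iter[OF f] summable_stein_iter[OF g]
  by (subst suminf_diff[symmetric]) (auto simp: suminf_mult summable_mult)

lemma stein_sum_fixpoint: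
  assumes f: "antimono_upto c f"
  shows "stein_sum \<theta> f x = f x + avg \<theta> (\<lambda>z. stein_sum \<theta> f (z + 1)) x"
proof -
  have s: "summable (\<lambda>k. stein_iter \<theta> f k x)" for x by (rule summable_stein_iter[OF f])
  note g = antimono_upto_shift[OF antimono_upto_iter[OF f]]
  have "stein_sum \<theta> f x = f x + (\<Sum>k. stein_iter \<theta> f (Suc k) x)"
    unfolding stein_sum_def using suminf_split_head[OF s] by simp
  also have "(\<Sum>k. stein_iter \<theta> f (Suc k) x) = (\<integral>v. (\<Sum>k. stein_iter \<theta> f k (v * x + 1)) \<partial>avg_measure \<theta>)"
    unfolding stein_iter.simps avg_def
  proof (rule integral_suminf[symmetric])
    show "integrable (avg_measure \<theta>) (\<lambda>v. stein_iter \<theta> f k (v * x + 1))" for k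
      by (rule integrable_avg[OF g])
    show "AE v in avg_measure \<theta>. summable (\<lambda>k. norm (stein_iter \<theta> f k (v * x + 1)))"
      using antimono_uptoD(2)[OF antimono_upto_iter[OF f]] s by simp
    have eq: "(\<integral>v. norm (stein_iter \<theta> f k (v * x + 1)) \<partial>avg_measure \<theta>) = stein_iter \<theta> f (Suc k) x" for k
      using antimono_uptoD(2)[OF antimono_upto_iter[OF f]] by (simp add: avg_def)
    show "summable (\<lambda>k. \<integral>v. norm (stein_iter \<theta> f k (v * x + 1)) \<partial>avg_measure \<theta>)"
      unfolding eq by (rule summable_Suc_iff[of "\<lambda>k. stein_iter \<theta> f k x", THEN iffD2, OF s])
  qed
  finally show ?thesis by (simp add: avg_def stein_sum_def)
qed

lemma antimono_upto_ramp:
  assumes s: "0 \<le> s"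
  shows "antimono_upto \<rho> (ramp \<theta> s)"
proof -
  have "(s / max s y) powr (\<theta> + 1) \<le> (s / max s x) powr (\<theta> + 1)" if "x \<le> y" for x y
  proof (cases "s = 0")
    case False
    then show ?thesis using s that theta
      by (intro powr_mono2 divide_left_mono) auto
  qed auto
  moreover have "(s / max s x) powr (\<theta> + 1) \<le> 1" for x
    using s theta by (intro powr_le1) (auto simp: divide_le_eq_1)
  ultimately show ?thesis using rho
    unfolding antimono_upto_def antimono_def ramp_def
    by (auto intro!: mult_left_mono mult_left_le simp del: times_divide_eq_left)
qed

lemma ramp_eq_avg:
  assumes s: "0 \<le> s" and x: "0 < x"
  shows "avg \<theta> (indicator {..s}) x = ramp \<theta> s x"
proof -
  have c: "min 1 (s / x) = s / max s x" using x s by (auto simp: min_def max_def field_simps)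
  have "emeasure (avg_measure \<theta>) {..s / x} = (\<integral>\<^sup>+v. ennreal (\<theta> * v powr \<theta>) * indicator {0..1} v * indicator {..s / x} v \<partial>lborel)"
    unfolding avg_measure_def by (subst emeasure_density) auto
  also have "\<dots> = (\<integral>\<^sup>+v. ennreal \<rho> * (ennreal ((\<theta> + 1) * v powr (\<theta> + 1 - 1)) * indicator {0..min 1 (s / x)} v) \<partial>lborel)"
    using theta by (intro nn_integral_cong) (auto split: split_indicator simp: ennreal_mult'[symmetric])
  also have "\<dots> = ennreal \<rho> * (\<integral>\<^sup>+v\<in>{0..min 1 (s / x)}. ennreal ((\<theta> + 1) * v powr (\<theta> + 1 - 1)) \<partial>lborel)"
    by (rule nn_integral_cmult) auto
  also have "\<dots> = ennreal \<rho> * ennreal (min 1 (s / x) powr (\<theta> + 1))"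
    using theta x s by (subst nn_integral_powr_Icc) auto
  also have "\<dots> = ennreal (ramp \<theta> s x)"
    unfolding ramp_def c using rho by (intro ennreal_mult'[symmetric]) auto
  finally have m: "emeasure (avg_measure \<theta>) {..s / x} = ennreal (ramp \<theta> s x)" .
  have "avg \<theta> (indicator {..s}) x = (\<integral>v. indicator {..s / x} v \<partial>avg_measure \<theta>)"
    unfolding avg_def using x by (intro Bochner_Integration.integral_cong) (auto split: split_indicator simp: field_simps)
  also have "\<dots> = ramp \<theta> s x"
    using m antimono_uptoD(2)[OF antimono_upto_ramp[OF s]] by (simp add: measure_def)
  finally show ?thesis .
qed

lemma antimono_upto_stein_sol: "0 \<le> s \<Longrightarrow> antimono_upto \<theta> (stein_sol \<theta> s)"
  unfolding stein_sol_def using antimono_upto_stein_sum[OF antimono_upto_ramp[of s]] theta by simp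

lemma ennreal_avg:
  assumes [measurable]: "f \<in> borel_measurable borel" and f: "\<And>x. 0 \<le> f x" "\<And>x. f x \<le> c"
    and x: "0 < x"
  shows "ennreal (avg \<theta> f x)
    = (\<integral>\<^sup>+z\<in>{0<..<x}. ennreal (\<theta> * z powr \<theta> * x powr - (\<theta> + 1)) * ennreal (f z) \<partial>lborel)"
proof -
  interpret finite_measure "avg_measure \<theta>" by (rule finite_avg_measure)
  have "integrable (avg_measure \<theta>) (\<lambda>v. f (v * x))"
    by (rule integrable_const_bound[where B = c]) (use f in auto)
  then have "ennreal (avg \<theta> f x) = (\<integral>\<^sup>+v. ennreal (f (v * x)) \<partial>avg_measure \<theta>)"
    unfolding avg_def using f by (intro nn_integral_eq_integral[symmetric]) auto
  also have "\<dots> = (\<integral>\<^sup>+v. ennreal (\<theta> * v powr \<theta>) * indicator {0..1} v * ennreal (f (v * x)) \<partial>lborel)"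
    unfolding avg_measure_def by (subst nn_integral_density) auto
  also have "\<dots> = (\<integral>\<^sup>+v. ennreal x * (ennreal (\<theta> * (0 + x * v) powr \<theta> * x powr - (\<theta> + 1))
      * ennreal (f (0 + x * v)) * indicator {0<..<x} (0 + x * v)) \<partial>lborel)"
  proof (rule nn_integral_cong_AE)
    have "AE v in lborel. v \<notin> {0, 1::real}"
      by (rule AE_not_in) (simp add: finite_imp_null_set_lborel)
    then show "AE v in lborel. ennreal (\<theta> * v powr \<theta>) * indicator {0..1} v * ennreal (f (v * x))
      = ennreal x * (ennreal (\<theta> * (0 + x * v) powr \<theta> * x powr - (\<theta> + 1))
        * ennreal (f (0 + x * v)) * indicator {0<..<x} (0 + x * v))"
    proof eventually_elim
      case (elim v)
      have iff: "x * v < x \<longleftrightarrow> v < 1" "0 < x * v \<longleftrightarrow> 0 < v"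
        using x by (simp_all add: zero_less_mult_iff)
      show ?case
      proof (cases "0 < v \<and> v < 1")
        case True
        have e: "\<theta> * v powr \<theta> = x * (\<theta> * (x * v) powr \<theta> * x powr - (\<theta> + 1))"
        proof -
          have "x powr - (\<theta> + 1) = x powr - \<theta> / x" using x powr_diff[of x "- \<theta>" 1] by simp
          moreover have "x powr \<theta> * x powr - \<theta> = 1" using x by (simp add: powr_minus)
          ultimately show ?thesis using x True by (simp add: powr_mult)
        qed
        show ?thesis unfolding e using True x theta iff by (simp add: ennreal_mult' ennreal_mult'' mult_ac)
      next
        case False
        then show ?thesis using iff elim by (auto split: split_indicator)
      qed
    qed
  qed
  also have "\<dots> = ennreal \<bar>x\<bar> * (\<integral>\<^sup>+v. (ennreal (\<theta> * (0 + x * v) powr \<theta> * x powr - (\<theta> + 1))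
      * ennreal (f (0 + x * v)) * indicator {0<..<x} (0 + x * v)) \<partial>lborel)"
    using x by (subst nn_integral_cmult) auto
  also have "\<dots> = (\<integral>\<^sup>+z\<in>{0<..<x}. ennreal (\<theta> * z powr \<theta> * x powr - (\<theta> + 1)) * ennreal (f z) \<partial>lborel)"
    using x by (intro nn_integral_real_affine[symmetric]) auto
  finally show ?thesis .
qed

text \<open>Integrated form of the differential equation
  \<open>(x * g x)' / \<theta> + g x = f x\<close> for \<open>g = avg \<theta> f\<close>. Written
  with the kernel of \<open>ennreal_avg\<close> and after Fubini, it reduces to an identity for each
  fixed \<open>z\<close>.\<close>

lemma avg_identity:
  assumes [measurable]: "f \<in> borel_measurable borel" and f: "\<And>x. 0 \<le> f x" "\<And>x. f x \<le> c"
    and x: "0 < x"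
  shows "(\<integral>\<^sup>+y\<in>{0<..<x}. ennreal (avg \<theta> f y) \<partial>lborel) + ennreal (x / \<theta> * avg \<theta> f x)
    = (\<integral>\<^sup>+z\<in>{0<..<x}. ennreal (f z) \<partial>lborel)"
proof -
  define K where "K = (\<lambda>y z. if 0 < z \<and> z < y then ennreal (\<theta> * z powr \<theta> * y powr - (\<theta> + 1)) else 0)"
  have K[measurable]: "(\<lambda>(y, z). K y z) \<in> borel_measurable (borel \<Otimes>\<^sub>M borel)" "K y \<in> borel_measurable borel" for y
    unfolding K_def by measurable
  have a: "ennreal (avg \<theta> f y) = (\<integral>\<^sup>+z. K y z * ennreal (f z) \<partial>lborel)" if "0 < y" for y
    using ennreal_avg[OF assms(1) f that] by (auto simp: K_def intro!: nn_integral_cong split: split_indicator)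
  \<comment> \<open>The kernel integrates over \<open>y\<close> from \<open>z\<close> to
    \<open>x\<close> to \<open>1 - (z / x) powr \<theta>\<close>, and the boundary term supplies
    exactly the missing \<open>(z / x) powr \<theta>\<close>.\<close>
  have inner: "(\<integral>\<^sup>+y\<in>{0<..<x}. K y z \<partial>lborel) + ennreal (x / \<theta>) * K x z = indicator {0<..<x} z" for z
  proof (cases "0 < z \<and> z < x")
    case True
    define F where "F = (\<lambda>y. - (z powr \<theta> * y powr - \<theta>))"
    have "(\<integral>\<^sup>+y\<in>{0<..<x}. K y z \<partial>lborel) = (\<integral>\<^sup>+y\<in>{z..x}. ennreal (\<theta> * z powr \<theta> * y powr - (\<theta> + 1)) \<partial>lborel)"
    proof (rule nn_integral_cong_AE)
      have "AE v in lborel. v \<notin> {z, x}"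
        by (rule AE_not_in) (simp add: finite_imp_null_set_lborel)
      then show "AE y in lborel. K y z * indicator {0<..<x} y = ennreal (\<theta> * z powr \<theta> * y powr - (\<theta> + 1)) * indicator {z..x} y"
        by eventually_elim (use True in \<open>auto simp: K_def split: split_indicator\<close>)
    qed
    also have "\<dots> = ennreal (F x - F z)"
    proof (rule nn_integral_FTC_Icc)
      fix y assume "y \<in> {z..x}"
      then have y: "0 < y" using True by auto
      show "(F has_real_derivative \<theta> * z powr \<theta> * y powr - (\<theta> + 1)) (at y)"
        unfolding F_def using y by (auto intro!: derivative_eq_intros simp: algebra_simps minus_diff_commute)
      show "0 \<le> \<theta> * z powr \<theta> * y powr - (\<theta> + 1)" using theta by simp
    qed (use True in auto)
    also have "F x - F z = 1 - z powr \<theta> * x powr - \<theta>"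
      using True by (simp add: F_def powr_minus)
    finally have i: "(\<integral>\<^sup>+y\<in>{0<..<x}. K y z \<partial>lborel) = ennreal (1 - z powr \<theta> * x powr - \<theta>)" .
    have "x / \<theta> * (\<theta> * z powr \<theta> * x powr - (\<theta> + 1)) = z powr \<theta> * (x * x powr - (\<theta> + 1))" using theta by simp
    also have "x * x powr - (\<theta> + 1) = x powr - \<theta>"
      using x by (simp add: powr_mult_base)
    finally have "ennreal (x / \<theta>) * K x z = ennreal (z powr \<theta> * x powr - \<theta>)"
      using True theta x by (simp add: K_def ennreal_mult''[symmetric] ennreal_mult'[symmetric])
    moreover have "z powr \<theta> * x powr - \<theta> \<le> 1"
    proof -
      have "z powr \<theta> \<le> x powr \<theta>" using True theta by (intro powr_mono2) auto
      then have "z powr \<theta> * x powr - \<theta> \<le> x powr \<theta> * x powr - \<theta>" by (intro mult_right_mono) auto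
      then show ?thesis using x by (simp add: powr_minus)
    qed
    ultimately show ?thesis unfolding i using True by (simp add: ennreal_plus[symmetric] del: ennreal_plus)
  next
    case False
    then have "(\<integral>\<^sup>+y\<in>{0<..<x}. K y z \<partial>lborel) = (\<integral>\<^sup>+y. 0 \<partial>(lborel :: real measure))"
      by (intro nn_integral_cong) (auto simp: K_def split: split_indicator)
    then show ?thesis using False by (auto simp: K_def)
  qed
  have "(\<integral>\<^sup>+y\<in>{0<..<x}. ennreal (avg \<theta> f y) \<partial>lborel)
    = (\<integral>\<^sup>+y. (\<integral>\<^sup>+z. K y z * ennreal (f z) * indicator {0<..<x} y \<partial>lborel) \<partial>lborel)"
    by (intro nn_integral_cong) (auto simp: a nn_integral_multc split: split_indicator)
  also have "\<dots> = (\<integral>\<^sup>+z. (\<integral>\<^sup>+y. K y z * ennreal (f z) * indicator {0<..<x} y \<partial>lborel) \<partial>lborel)"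
    by (rule lborel_pair.Fubini') measurable
  also have "\<dots> = (\<integral>\<^sup>+z. (\<integral>\<^sup>+y\<in>{0<..<x}. K y z \<partial>lborel) * ennreal (f z) \<partial>lborel)"
    by (intro nn_integral_cong, subst nn_integral_multc[symmetric]) (auto intro!: nn_integral_cong simp: mult_ac)
  finally have 1: "(\<integral>\<^sup>+y\<in>{0<..<x}. ennreal (avg \<theta> f y) \<partial>lborel)
    = (\<integral>\<^sup>+z. (\<integral>\<^sup>+y\<in>{0<..<x}. K y z \<partial>lborel) * ennreal (f z) \<partial>lborel)" .
  have av0: "0 \<le> avg \<theta> f x" unfolding avg_def using f by (intro integral_nonneg_AE) auto
  have "ennreal (x / \<theta> * avg \<theta> f x) = ennreal (x / \<theta>) * (\<integral>\<^sup>+z. K x z * ennreal (f z) \<partial>lborel)"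
    unfolding a[OF x, symmetric] using av0 x theta by (intro ennreal_mult) auto
  also have "\<dots> = (\<integral>\<^sup>+z. ennreal (x / \<theta>) * K x z * ennreal (f z) \<partial>lborel)"
    by (subst nn_integral_cmult[symmetric]) (auto simp: mult_ac)
  finally have 2: "ennreal (x / \<theta> * avg \<theta> f x) = (\<integral>\<^sup>+z. ennreal (x / \<theta>) * K x z * ennreal (f z) \<partial>lborel)" .
  have "(\<integral>\<^sup>+y\<in>{0<..<x}. ennreal (avg \<theta> f y) \<partial>lborel) + ennreal (x / \<theta> * avg \<theta> f x)
    = (\<integral>\<^sup>+z. ((\<integral>\<^sup>+y\<in>{0<..<x}. K y z \<partial>lborel) + ennreal (x / \<theta>) * K x z) * ennreal (f z) \<partial>lborel)"
    unfolding 1 2 by (subst nn_integral_add[symmetric]) (auto simp: algebra_simps)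
  then show ?thesis unfolding inner by (simp add: mult.commute)
qed

lemma nn_unit_int:
  assumes f: "antimono_upto c f"
  shows "ennreal (unit_int f x) = (\<integral>\<^sup>+v\<in>{x<..<x + 1}. ennreal (f v) \<partial>lborel)"
proof -
  have "(\<integral>\<^sup>+v\<in>{x<..<x + 1}. ennreal (f v) \<partial>lborel) \<le> (\<integral>\<^sup>+v\<in>{x<..<x + 1}. ennreal c \<partial>lborel)"
    using antimono_uptoD(3)[OF f] by (intro nn_integral_mono mult_right_mono) (auto intro: ennreal_leI)
  also have "\<dots> < \<infinity>" by (simp add: nn_integral_cmult ennreal_mult_less_top)
  finally show ?thesis by (simp add: unit_int_def)
qed

text \<open>Apply \<open>avg_identity\<close> to the fixed-point form of \<open>u\<close>: this
  gives \<open>I 0 x + x / \<theta> * u x = min x s + I 1 (x + 1)\<close>. Adding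
  \<open>I x (x + 1)\<close> to both sides and cancelling \<open>I 1 (x + 1)\<close> leaves only
  integrals over unit windows. Terms are moved so that no subtraction occurs in
  \<open>ennreal\<close>.\<close>

lemma stein_sol_identity:
  assumes s: "0 \<le> s" and x: "0 < x"
  shows "ennreal (min x s) + (\<integral>\<^sup>+v\<in>{x<..<x + 1}. ennreal (stein_sol \<theta> s v) \<partial>lborel)
    = (\<integral>\<^sup>+v\<in>{0<..<1}. ennreal (stein_sol \<theta> s v) \<partial>lborel) + ennreal (x / \<theta> * stein_sol \<theta> s x)"
proof -
  define u where "u = stein_sol \<theta> s"
  define I where "I = (\<lambda>a b. \<integral>\<^sup>+v\<in>{a<..<b}. ennreal (u v) \<partial>lborel)"
  have u: "antimono_upto \<theta> u" unfolding u_def by (rule antimono_upto_stein_sol[OF s])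
  note [measurable] = antimono_upto_measurable[OF u]
  note u1 = antimono_upto_shift[OF u, of 1]
  interpret finite_measure "avg_measure \<theta>" by (rule finite_avg_measure)
  have u_eq: "u y = avg \<theta> (\<lambda>z. indicator {..s} z + u (z + 1)) y" if "0 < y" for y
  proof -
    have "u y = ramp \<theta> s y + avg \<theta> (\<lambda>z. u (z + 1)) y"
      unfolding u_def stein_sol_def by (rule stein_sum_fixpoint[OF antimono_upto_ramp[OF s]])
    also have "ramp \<theta> s y = avg \<theta> (indicator {..s}) y" using ramp_eq_avg[OF s that] ..
    also have "\<dots> + avg \<theta> (\<lambda>z. u (z + 1)) y = avg \<theta> (\<lambda>z. indicator {..s} z + u (z + 1)) y"
      unfolding avg_def
    proof (rule Bochner_Integration.integral_add[symmetric])
      show "integrable (avg_measure \<theta>) (\<lambda>v. indicat_real {..s} (v * y))"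
        by (rule integrable_const_bound[where B = 1]) auto
    qed (rule integrable_avg[OF u1])
    finally show ?thesis .
  qed
  have split: "I a b + I b c = I a c" if "a \<le> b" "b \<le> c" for a b c
  proof -
    have "I a b + I b c = (\<integral>\<^sup>+v. ennreal (u v) * indicator {a<..<b} v + ennreal (u v) * indicator {b<..<c} v \<partial>lborel)"
      unfolding I_def by (subst nn_integral_add) auto
    also have "\<dots> = I a c" unfolding I_def
    proof (rule nn_integral_cong_AE)
      show "AE v in lborel. ennreal (u v) * indicator {a<..<b} v + ennreal (u v) * indicator {b<..<c} v = ennreal (u v) * indicator {a<..<c} v"
        using AE_lborel_singleton[of b] by eventually_elim (use that in \<open>auto split: split_indicator\<close>)
    qed
    finally show ?thesis .
  qed
  have fin: "I a b < \<top>" for a b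
  proof -
    have "I a b \<le> (\<integral>\<^sup>+v\<in>{a<..<b}. ennreal \<theta> \<partial>lborel)" unfolding I_def
      using antimono_uptoD(3)[OF u] by (intro nn_integral_mono mult_right_mono) (auto intro: ennreal_leI)
    also have "\<dots> < \<top>" by (cases "a \<le> b") (auto simp: nn_integral_cmult ennreal_mult_less_top)
    finally show ?thesis .
  qed
  have bnd: "indicator {..s} z + u (z + 1) \<le> 1 + \<theta>" "0 \<le> indicator {..s} z + u (z + 1)" for z
    using antimono_uptoD(2,3)[OF u, of "z + 1"] by (auto split: split_indicator)
  have "I 0 x + ennreal (x / \<theta> * u x)
    = (\<integral>\<^sup>+y\<in>{0<..<x}. ennreal (avg \<theta> (\<lambda>z. indicator {..s} z + u (z + 1)) y) \<partial>lborel)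
      + ennreal (x / \<theta> * avg \<theta> (\<lambda>z. indicator {..s} z + u (z + 1)) x)"
    unfolding I_def by (intro arg_cong2[where f = "(+)"] nn_integral_cong)
      (auto simp: u_eq[OF x, symmetric] u_eq[symmetric] split: split_indicator)
  also have "\<dots> = (\<integral>\<^sup>+z\<in>{0<..<x}. ennreal (indicator {..s} z + u (z + 1)) \<partial>lborel)"
    by (rule avg_identity[where c = "1 + \<theta>"]) (use x bnd in auto)
  also have "\<dots> = (\<integral>\<^sup>+z. indicator ({..s} \<inter> {0<..<x}) z + ennreal (u (1 + 1 * z)) * indicator {1<..<x + 1} (1 + 1 * z) \<partial>lborel)"
    using antimono_uptoD(2)[OF u]
    by (intro nn_integral_cong) (auto split: split_indicator simp: add.commute)
  also have "\<dots> = emeasure lborel ({..s} \<inter> {0<..<x}) + (\<integral>\<^sup>+z. ennreal (u (1 + 1 * z)) * indicator {1<..<x + 1} (1 + 1 * z) \<partial>lborel)"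
    by (subst nn_integral_add) auto
  also have "(\<integral>\<^sup>+z. ennreal (u (1 + 1 * z)) * indicator {1<..<x + 1} (1 + 1 * z) \<partial>lborel) = I 1 (x + 1)"
    unfolding I_def using nn_integral_real_affine[of "\<lambda>v. ennreal (u v) * indicator {1<..<x + 1} v" 1 1] by simp
  also have "emeasure lborel ({..s} \<inter> {0<..<x}) = ennreal (min x s)"
  proof -
    have "{..s} \<inter> {0<..<x} = (if s < x then {0<..s} else {0<..<x})" by auto
    then show ?thesis using s x by (auto simp: min_def)
  qed
  finally have "I 0 x + ennreal (x / \<theta> * u x) + I x (x + 1) = ennreal (min x s) + I 1 (x + 1) + I x (x + 1)"
    by simp
  moreover have "I 0 x + I x (x + 1) = I 0 1 + I 1 (x + 1)"
    using split[of 0 x "x + 1"] split[of 0 1 "x + 1"] x by simp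
  ultimately have "I 1 (x + 1) + (ennreal (min x s) + I x (x + 1)) = I 1 (x + 1) + (I 0 1 + ennreal (x / \<theta> * u x))"
    by (metis add.commute add.left_commute)
  then have "ennreal (min x s) + I x (x + 1) = I 0 1 + ennreal (x / \<theta> * u x)"
    using fin[of 1 "x + 1"] by (auto simp: ennreal_add_left_cancel)
  then show ?thesis by (simp add: I_def u_def)
qed

text \<open>Integrate \<open>stein_sol_identity\<close> over the law. By
  \<open>nn_integral_stein\<close> the window integral and \<open>x / \<theta> * u x\<close> have
  the same mean, which is finite and cancels; this identifies the constant in the Stein
  equation.\<close>

lemma nn_expectation_min:
  assumes s: "0 \<le> s"
  shows "(\<integral>\<^sup>+x. ennreal (min x s) \<partial>\<mu>) = (\<integral>\<^sup>+v\<in>{0<..<1}. ennreal (stein_sol \<theta> s v) \<partial>lborel)"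
proof -
  define u where "u = stein_sol \<theta> s"
  have u: "antimono_upto \<theta> u" unfolding u_def by (rule antimono_upto_stein_sol[OF s])
  note [measurable] = antimono_upto_measurable[OF u]
  define A where "A = (\<integral>\<^sup>+x. (\<integral>\<^sup>+v\<in>{x<..<x + 1}. ennreal (u v) \<partial>lborel) \<partial>\<mu>)"
  have stein: "(\<integral>\<^sup>+x. ennreal x * ennreal (u x) \<partial>\<mu>) = ennreal \<theta> * A"
    unfolding A_def by (rule nn_integral_stein) measurable
  have "(\<integral>\<^sup>+x. ennreal (x / \<theta> * u x) \<partial>\<mu>) = (\<integral>\<^sup>+x. ennreal (1 / \<theta>) * (ennreal x * ennreal (u x)) \<partial>\<mu>)"
  proof (rule nn_integral_cong_AE, use AE_nonneg in eventually_elim)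
    case (elim x)
    have "ennreal (1 / \<theta>) * (ennreal x * ennreal (u x)) = ennreal (1 / \<theta> * (x * u x))"
      using elim theta antimono_uptoD(2)[OF u, of x] by (simp only: ennreal_mult mult_nonneg_nonneg
          divide_nonneg_pos zero_le_one)
    then show ?case by simp
  qed
  also have "\<dots> = ennreal (1 / \<theta>) * (ennreal \<theta> * A)" by (simp add: nn_integral_cmult stein)
  also have "\<dots> = ennreal (1 / \<theta> * \<theta>) * A"
    using theta by (subst ennreal_mult) (auto simp: mult.assoc)
  also have "\<dots> = A" using theta by simp
  finally have s1: "(\<integral>\<^sup>+x. ennreal (x / \<theta> * u x) \<partial>\<mu>) = A" .
  have "A \<le> (\<integral>\<^sup>+x. ennreal \<theta> \<partial>\<mu>)" unfolding A_def
  proof (rule nn_integral_mono)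
    fix x
    have "(\<integral>\<^sup>+v\<in>{x<..<x + 1}. ennreal (u v) \<partial>lborel) \<le> (\<integral>\<^sup>+v\<in>{x<..<x + 1}. ennreal \<theta> \<partial>lborel)"
      using antimono_uptoD(3)[OF u] by (intro nn_integral_mono mult_right_mono) (auto intro: ennreal_leI)
    then show "(\<integral>\<^sup>+v\<in>{x<..<x + 1}. ennreal (u v) \<partial>lborel) \<le> ennreal \<theta>"
      by (simp add: nn_integral_cmult)
  qed
  also have "\<dots> < \<top>" using emeasure_space_1 by simp
  finally have fin: "A < \<top>" .
  have meas[measurable]: "(\<lambda>x. \<integral>\<^sup>+v\<in>{x<..<x + 1}. ennreal (u v) \<partial>lborel) \<in> borel_measurable \<mu>"
  proof -
    have eq: "(\<lambda>x. \<integral>\<^sup>+v\<in>{x<..<x + 1}. ennreal (u v) \<partial>lborel)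
      = (\<lambda>x. \<integral>\<^sup>+v. (if x < v \<and> v < x + 1 then ennreal (u v) else 0) \<partial>lborel)"
      by (intro ext nn_integral_cong) (auto split: split_indicator)
    show ?thesis unfolding eq by measurable
  qed
  have "(\<integral>\<^sup>+x. ennreal (min x s) \<partial>\<mu>) + A
    = (\<integral>\<^sup>+x. ennreal (min x s) + (\<integral>\<^sup>+v\<in>{x<..<x + 1}. ennreal (u v) \<partial>lborel) \<partial>\<mu>)"
    unfolding A_def by (subst nn_integral_add) auto
  also have "\<dots> = (\<integral>\<^sup>+x. (\<integral>\<^sup>+v\<in>{0<..<1}. ennreal (u v) \<partial>lborel) + ennreal (x / \<theta> * u x) \<partial>\<mu>)"
    by (rule nn_integral_cong_AE, use AE_pos in eventually_elim) (simp add: stein_sol_identity[OF s] u_def)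
  also have "\<dots> = (\<integral>\<^sup>+v\<in>{0<..<1}. ennreal (u v) \<partial>lborel) + A"
    using s1 emeasure_space_1 by (subst nn_integral_add) auto
  finally show ?thesis using fin by (auto simp: ennreal_add_left_cancel add.commute[of _ A] u_def)
qed

lemma stein_equation:
  assumes s: "0 \<le> s" and x: "0 \<le> x"
  shows "min x s - expectation (\<lambda>y. min y s)
    = x / \<theta> * stein_sol \<theta> s x - unit_int (stein_sol \<theta> s) x"
proof -
  note u = antimono_upto_stein_sol[OF s]
  have eD: "expectation (\<lambda>y. min y s) = unit_int (stein_sol \<theta> s) 0"
    unfolding unit_int_def add_0 nn_expectation_min[OF s, symmetric]
    by (rule integral_eq_nn_integral) (use AE_nonneg s in \<open>auto elim: eventually_mono\<close>)
  show ?thesis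
  proof (cases "x = 0")
    case False
    then have x: "0 < x" using x by simp
    have nn: "0 \<le> unit_int (stein_sol \<theta> s) y" for y by (simp add: unit_int_def)
    have nu: "0 \<le> x / \<theta> * stein_sol \<theta> s x" using x theta antimono_uptoD(2)[OF u] by simp
    have "ennreal (min x s) + ennreal (unit_int (stein_sol \<theta> s) x)
      = ennreal (unit_int (stein_sol \<theta> s) 0) + ennreal (x / \<theta> * stein_sol \<theta> s x)"
      using stein_sol_identity[OF s x] by (simp add: nn_unit_int[OF u])
    then have "min x s + unit_int (stein_sol \<theta> s) x = unit_int (stein_sol \<theta> s) 0 + x / \<theta> * stein_sol \<theta> s x"
      using nn nu x s by (simp add: ennreal_plus[symmetric] del: ennreal_plus)
    then show ?thesis unfolding eD by simp
  qed (use s eD in simp)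
qed

lemma stein_sol_le:
  assumes "0 \<le> s" "0 \<le> x"
  shows "stein_sol \<theta> s x \<le> ramp \<theta> s x + \<theta> * ramp \<theta> s 1"
  unfolding stein_sol_def by (rule stein_sum_le[OF antimono_upto_ramp]) (use assms in auto)

lemma stein_iter_mono:
  assumes f: "antimono_upto c f" and g: "antimono_upto d g" and fg: "\<And>x. f x \<le> g x"
  shows "stein_iter \<theta> f k x \<le> stein_iter \<theta> g k x"
proof (induction k arbitrary: x)
  case (Suc k)
  then show ?case
    unfolding stein_iter.simps avg_def
    by (intro integral_mono integrable_avg[OF antimono_upto_shift[OF antimono_upto_iter[OF f]]]
        integrable_avg[OF antimono_upto_shift[OF antimono_upto_iter[OF g]]])
qed (use fg in simp)

lemma stein_sol_mono:
  assumes "0 \<le> t" "t \<le> s"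
  shows "stein_sol \<theta> t x \<le> stein_sol \<theta> s x"
proof -
  have at: "antimono_upto \<rho> (ramp \<theta> t)" and as: "antimono_upto \<rho> (ramp \<theta> s)"
    by (rule antimono_upto_ramp; use assms in auto)+
  have "ramp \<theta> t x \<le> ramp \<theta> s x" for x
  proof -
    have "t / max t x \<le> s / max s x"
    proof (cases "t = 0")
      case False
      then show ?thesis using assms by (auto simp: max_def field_simps)
    qed (use assms in auto)
    then have "(t / max t x) powr (\<theta> + 1) \<le> (s / max s x) powr (\<theta> + 1)"
      using assms theta by (intro powr_mono2) auto
    then show ?thesis unfolding ramp_def using rho by (intro mult_left_mono) auto
  qed
  then show ?thesis
    unfolding stein_sol_def stein_sum_def
    by (intro suminf_le stein_iter_mono[OF at as] summable_stein_iter[OF at] summable_stein_iter[OF as])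
qed

text \<open>From \<open>s\<close> on both ramps are multiples of
  \<open>x powr - (\<theta> + 1)\<close>, and \<open>(t / s) powr (\<theta> + 1)\<close> is their
  ratio, so that the combination of ramps vanishes there. Up to \<open>s\<close> the ramp for
  \<open>s\<close> is constant, so the combination decreases like the ramp for \<open>t\<close>. A
  decreasing function that ends at 0 is non-negative, and \<open>stein_sum\<close> preserves all of
  this.\<close>

lemma antimono_upto_stein_sol_diff:
  assumes t: "0 \<le> t" "t < s"
  shows "antimono_upto \<theta> (\<lambda>x. stein_sol \<theta> t x - (t / s) powr (\<theta> + 1) * stein_sol \<theta> s x)"
proof -
  define q where "q = (t / s) powr (\<theta> + 1)"
  define b where "b = (\<lambda>x. ramp \<theta> t x - q * ramp \<theta> s x)"
  have q: "0 \<le> q" "q \<le> 1" using t theta by (auto simp: q_def intro!: powr_le1)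
  have rs: "ramp \<theta> s x = \<rho>" if "x \<le> s" for x using that t by (simp add: ramp_def max_absorb1)
  have b0: "b x = 0" if "s \<le> x" for x
  proof -
    have "(t / x) powr (\<theta> + 1) = q * (s / x) powr (\<theta> + 1)"
      unfolding q_def using that t by (simp add: powr_divide)
    then show ?thesis using that t by (simp add: b_def ramp_def max_absorb2)
  qed
  note at = antimono_uptoD[OF antimono_upto_ramp[OF t(1)]]
  have b1: "b x = ramp \<theta> t x - q * \<rho>" if "x \<le> s" for x using rs[OF that] by (simp add: b_def)
  have anti: "b y \<le> b x" if "x \<le> y" for x y
  proof -
    consider "y \<le> s" | "x \<le> s" "s \<le> y" | "s \<le> x" by linarith
    then show ?thesis
    proof cases
      case 2
      have "b s \<le> b x" using 2 at(1)[of x s] by (simp add: b1)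
      then show ?thesis using 2 b0[of s] b0[of y] by simp
    qed (use that at(1)[OF that] b0 in \<open>auto simp: b1\<close>)
  qed
  have "antimono_upto \<rho> b"
    unfolding antimono_upto_def antimono_def
  proof (intro conjI allI impI)
    fix x
    show "0 \<le> b x" using anti[of x "max x s"] b0[of "max x s"] by simp
    have "0 \<le> q * ramp \<theta> s x" using q antimono_uptoD(2)[OF antimono_upto_ramp, of s] t by simp
    then show "b x \<le> \<rho>" using at(3)[of x] by (simp add: b_def)
  qed (rule anti)
  from antimono_upto_stein_sum[OF this]
  have "antimono_upto \<theta> (stein_sum \<theta> b)" using theta by simp
  moreover have "stein_sum \<theta> b x = stein_sol \<theta> t x - q * stein_sol \<theta> s x" for x
    unfolding b_def stein_sol_def
    by (rule stein_sum_diff[OF antimono_upto_ramp antimono_upto_ramp]) (use t in auto)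
  ultimately show ?thesis by (simp add: q_def antimono_upto_def antimono_def)
qed

end

section \<open>Size bias and the Stein operator of a weighted sum\<close>

lemma bdd_above_tv: "bdd_above (range (\<lambda>A. \<bar>measure (measure_pmf p) A - measure (measure_pmf q) A\<bar>))"
proof (rule bdd_aboveI2)
  fix A
  show "\<bar>measure (measure_pmf p) A - measure (measure_pmf q) A\<bar> \<le> 1"
    using measure_pmf.prob_le_1[of p A] measure_pmf.prob_le_1[of q A]
      measure_nonneg[of "measure_pmf p" A] measure_nonneg[of "measure_pmf q" A] by linarith
qed

lemma tv_dist_ge: "\<bar>measure (measure_pmf p) A - measure (measure_pmf q) A\<bar> \<le> tv_dist p q"
  unfolding tv_dist_def by (rule cSUP_upper[OF _ bdd_above_tv]) auto

lemma tv_dist_nonneg: "0 \<le> tv_dist p q"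
  using tv_dist_ge[of p "{}" q] by simp

lemma tv_dist_commute: "tv_dist p q = tv_dist q p"
  by (simp add: tv_dist_def abs_minus_commute)

text \<open>Drop the points where the difference of the masses is not positive and replace
  \<open>f\<close> by \<open>c\<close> on the others; since \<open>f \<ge> 0\<close> this gives the
  factor \<open>c\<close> and not \<open>2 * c\<close>. Bounds are asked for on the supports only,
  because in \<open>size_bias_step\<close> the function may be larger below the smallest
  atom.\<close>

lemma expectation_diff_le_tv_dist:
  fixes f :: "'b \<Rightarrow> real"
  assumes f: "\<And>x. x \<in> set_pmf p \<union> set_pmf q \<Longrightarrow> 0 \<le> f x \<and> f x \<le> c"
  shows "\<bar>measure_pmf.expectation p f - measure_pmf.expectation q f\<bar> \<le> tv_dist p q * c"
proof -
  have *: "measure_pmf.expectation p f - measure_pmf.expectation q f \<le> tv_dist p q * c"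
    if f: "\<And>x. x \<in> set_pmf p \<union> set_pmf q \<Longrightarrow> 0 \<le> f x \<and> f x \<le> c" for p q :: "'b pmf"
  proof -
    define A where "A = {x. pmf q x < pmf p x}"
    obtain x0 where "x0 \<in> set_pmf p" using set_pmf_not_empty[of p] by auto
    then have c: "0 \<le> c" using f[of x0] by auto
    have e: "measure_pmf.expectation r g = (\<integral>x. pmf r x * g x \<partial>count_space UNIV)" for r :: "'b pmf" and g :: "'b \<Rightarrow> real"
      by (simp add: measure_pmf_eq_density integral_density)
    have i: "integrable (count_space UNIV) (\<lambda>x. pmf r x * g x)"
      if "\<And>x. x \<in> set_pmf r \<Longrightarrow> \<bar>g x\<bar> \<le> c" for r :: "'b pmf" and g :: "'b \<Rightarrow> real"
    proof (rule Bochner_Integration.integrable_bound)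
      show "integrable (count_space UNIV) (\<lambda>x. c * pmf r x)" by (simp add: integrable_pmf)
      show "AE x in count_space UNIV. norm (pmf r x * g x) \<le> norm (c * pmf r x)"
      proof (rule AE_I2)
        fix x show "norm (pmf r x * g x) \<le> norm (c * pmf r x)"
          using that[of x] c by (cases "x \<in> set_pmf r")
            (auto simp: abs_mult mult.commute set_pmf_iff intro: mult_right_mono)
      qed
    qed simp
    have m: "measure (measure_pmf r) A = (\<integral>x. pmf r x * indicator A x \<partial>count_space UNIV)" for r :: "'b pmf"
      using e[of r "indicator A"] by simp
    have if1: "integrable (count_space UNIV) (\<lambda>x. pmf p x * f x)" "integrable (count_space UNIV) (\<lambda>x. pmf q x * f x)"
      using f by (intro i; force)+
    have if2: "integrable (count_space UNIV) (\<lambda>x. pmf r x * indicator A x)" for r :: "'b pmf"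
    proof (rule Bochner_Integration.integrable_bound)
      show "integrable (count_space UNIV) (pmf r)" by (rule integrable_pmf)
      show "AE x in count_space UNIV. norm (pmf r x * indicator A x) \<le> norm (pmf r x)"
        by (auto split: split_indicator)
    qed simp
    have "measure_pmf.expectation p f - measure_pmf.expectation q f
      = (\<integral>x. pmf p x * f x - pmf q x * f x \<partial>count_space UNIV)"
      unfolding e using if1 by simp
    also have "\<dots> \<le> (\<integral>x. c * (pmf p x * indicator A x - pmf q x * indicator A x) \<partial>count_space UNIV)"
    proof (rule integral_mono)
      fix x
      have "(pmf p x - pmf q x) * f x \<le> c * ((pmf p x - pmf q x) * indicator A x)"
      proof (cases "x \<in> set_pmf p \<union> set_pmf q")
        case True
        then have fx: "0 \<le> f x" "f x \<le> c" using f by auto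
        show ?thesis
        proof (cases "x \<in> A")
          case True
          then show ?thesis using fx mult_left_mono[of "f x" c "pmf p x - pmf q x"] by (simp add: A_def mult_ac)
        next
          case False
          then show ?thesis using fx by (auto simp: A_def not_less intro: mult_nonpos_nonneg)
        qed
      qed (auto simp: set_pmf_iff)
      then show "pmf p x * f x - pmf q x * f x \<le> c * (pmf p x * indicator A x - pmf q x * indicator A x)"
        by (simp add: algebra_simps)
    qed (use if1 if2 in auto)
    also have "\<dots> = c * (measure (measure_pmf p) A - measure (measure_pmf q) A)"
      unfolding m using if2 by simp
    also have "\<dots> \<le> c * tv_dist p q"
      using tv_dist_ge[of p A q] c by (intro mult_left_mono) auto
    finally show ?thesis by (simp add: mult.commute)
  qed
  from *[of p q] *[of q p] f show ?thesis by (auto simp: tv_dist_commute abs_le_iff)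
qed

lemma size_biased_size_biased_pmf:
  assumes "integrable (measure_pmf p) real" "measure_pmf.expectation p real > 0"
  shows "size_biased p (size_biased_pmf p)"
  unfolding size_biased_pmf_def by (rule theI'[OF size_biased_ex1[OF assms]])

lemma pmf_size_biased:
  assumes r: "size_biased p r"
  shows "real x * pmf p x = measure_pmf.expectation p real * pmf r x"
proof -
  have e: "(\<lambda>y. real y * indicator {x} y) = (\<lambda>y. real x * indicator {x} y)"
    by (auto simp: fun_eq_iff split: split_indicator)
  have "measure_pmf.expectation p (\<lambda>y. real y * indicator {x} y)
      = measure_pmf.expectation p real * measure_pmf.expectation r (indicator {x})"
    by (rule r[unfolded size_biased_def, rule_format])
       (simp_all add: e integrable_real_indicator measure_pmf.emeasure_eq_measure)
  then show ?thesis unfolding e by (simp add: pmf.rep_eq)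
qed

definition tv_ratio :: "nat pmf \<Rightarrow> real" where
  "tv_ratio p = tv_dist (size_biased_pmf p) (map_pmf Suc p) / pmf p (LEAST x. pmf p x > 0)"

lemma tv_ratio_nonneg: "0 \<le> tv_ratio p"
  by (simp add: tv_ratio_def tv_dist_nonneg)

text \<open>Dividing by the mass of the smallest atom \<open>m\<close> pays for comparing \<open>f m\<close>, the largest value
  of \<open>f\<close> on the supports, with the mean of \<open>f\<close>.\<close>

lemma size_bias_step:
  fixes f :: "nat \<Rightarrow> real"
  assumes int: "integrable (measure_pmf p) real"
    and f: "antimono f" "\<And>x. 0 \<le> f x" "\<And>x. f x \<le> c"
  defines "l \<equiv> measure_pmf.expectation p real"
  shows "\<bar>measure_pmf.expectation p (\<lambda>x. real x * f x) - l * measure_pmf.expectation p (\<lambda>x. f (Suc x))\<bar>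
    \<le> l * tv_ratio p * measure_pmf.expectation p f"
proof -
  have ifp: "integrable (measure_pmf r) f" for r
    by (rule measure_pmf.integrable_const_bound[where B = c]) (use f in auto)
  have ixf: "integrable (measure_pmf p) (\<lambda>x. real x * f x)"
  proof (rule Bochner_Integration.integrable_bound)
    show "integrable (measure_pmf p) (\<lambda>x. c * real x)" using int by simp
    show "AE x in measure_pmf p. norm (real x * f x) \<le> norm (c * real x)"
    proof (rule AE_I2)
      fix x
      have "real x * f x \<le> real x * c" by (rule mult_left_mono) (use f in auto)
      then show "norm (real x * f x) \<le> norm (c * real x)"
        using f(2)[of x] f(3)[of x] by (simp add: abs_mult mult.commute)
    qed
  qed simp
  have l0: "0 \<le> l" by (simp add: l_def)
  show ?thesis
  \<comment> \<open>For mean 0 the size-biased law is unspecified, but both terms inside the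
    absolute value vanish by themselves.\<close>
  proof (cases "l = 0")
    case True
    have "measure_pmf.expectation p (\<lambda>x. real x * f x) \<le> measure_pmf.expectation p (\<lambda>x. c * real x)"
      using f int ixf by (intro integral_mono) (auto simp: mult.commute[of c] intro: mult_left_mono)
    also have "\<dots> = 0" using True by (simp add: l_def)
    finally have "measure_pmf.expectation p (\<lambda>x. real x * f x) \<le> 0" .
    moreover have "0 \<le> measure_pmf.expectation p (\<lambda>x. real x * f x)" using f by simp
    ultimately show ?thesis using True by simp
  next
    case False
    then have l: "0 < l" using l0 by simp
    define q where "q = size_biased_pmf p"
    define m where "m = (LEAST x. pmf p x > 0)"
    have sb: "size_biased p q" unfolding q_def
      by (rule size_biased_size_biased_pmf[OF int]) (use l in \<open>simp add: l_def\<close>)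
    obtain x0 where "x0 \<in> set_pmf p" using set_pmf_not_empty[of p] by auto
    then have ex: "pmf p x0 > 0" by (simp add: pmf_positive)
    have pm: "pmf p m > 0" unfolding m_def by (rule LeastI[of _ x0]) (rule ex)
    have m_le: "m \<le> x" if "pmf p x > 0" for x unfolding m_def by (rule Least_le) (rule that)
    \<comment> \<open>Size-biasing does not enlarge the support and adding 1 moves it to the right,
      so \<open>f m\<close> bounds the decreasing \<open>f\<close> on both supports.\<close>
    have sup: "m \<le> x" if "x \<in> set_pmf q \<union> set_pmf (map_pmf Suc p)" for x
      using that
    proof
      assume "x \<in> set_pmf q"
      then have "real x * pmf p x > 0" using l by (simp add: pmf_size_biased[OF sb] l_def pmf_positive)
      then show "m \<le> x" by (intro m_le) (auto simp: zero_less_mult_iff)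
    next
      assume "x \<in> set_pmf (map_pmf Suc p)"
      then obtain y where "x = Suc y" "y \<in> set_pmf p" by auto
      then show "m \<le> x" using m_le[of y] by (simp add: pmf_positive)
    qed
    have 1: "measure_pmf.expectation p (\<lambda>x. real x * f x) = l * measure_pmf.expectation q f"
      unfolding l_def using sb ixf ifp by (auto simp: size_biased_def)
    have fm: "f m * pmf p m \<le> measure_pmf.expectation p f"
    proof -
      have "f m * pmf p m = measure_pmf.expectation p (\<lambda>x. f m * indicator {m} x)"
        by (simp add: pmf.rep_eq)
      also have "\<dots> \<le> measure_pmf.expectation p f"
        by (rule integral_mono[OF _ ifp])
          (use f in \<open>auto split: split_indicator simp: integrable_real_indicator measure_pmf.emeasure_eq_measure\<close>)
      finally show ?thesis .
    qed
    have "\<bar>measure_pmf.expectation q f - measure_pmf.expectation (map_pmf Suc p) f\<bar>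
      \<le> tv_dist q (map_pmf Suc p) * f m"
      using sup f by (intro expectation_diff_le_tv_dist) (auto simp: antimono_def)
    also have "\<dots> \<le> tv_dist q (map_pmf Suc p) * (measure_pmf.expectation p f / pmf p m)"
      using fm pm tv_dist_nonneg by (intro mult_left_mono) (auto simp: field_simps)
    also have "\<dots> = tv_ratio p * measure_pmf.expectation p f"
      by (simp add: tv_ratio_def q_def m_def)
    finally have "l * \<bar>measure_pmf.expectation q f - measure_pmf.expectation p (\<lambda>x. f (Suc x))\<bar>
      \<le> l * (tv_ratio p * measure_pmf.expectation p f)"
      using l by (intro mult_left_mono) auto
    then show ?thesis
      unfolding 1 right_diff_distrib[symmetric] abs_mult abs_of_pos[OF l] by (simp only: mult.assoc)
  qed
qed

lemma integrable_pmf_antimono: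
  assumes "antimono_upto c u"
  shows "integrable (measure_pmf P) (\<lambda>x. u (g x))"
  by (rule measure_pmf.integrable_const_bound[where B = c]) (use antimono_uptoD[OF assms] in auto)

lemma antimono_upto_expectation:
  assumes u: "antimono_upto c u"
  shows "antimono_upto c (\<lambda>v. measure_pmf.expectation P (\<lambda>x. u (g x + v)))"
proof -
  have "measure_pmf.expectation P (\<lambda>x. u (g x + v)) \<le> measure_pmf.expectation P (\<lambda>x. c)" for v
    using antimono_uptoD(3)[OF u] by (intro integral_mono integrable_pmf_antimono[OF u]) auto
  moreover have "measure_pmf.expectation P (\<lambda>x. u (g x + v)) \<ge> measure_pmf.expectation P (\<lambda>x. u (g x + w))"
    if "v \<le> w" for v w
    using antimono_uptoD(1)[OF u] that by (intro integral_mono integrable_pmf_antimono[OF u]) auto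
  ultimately show ?thesis
    using antimono_uptoD(2)[OF u] by (auto simp: antimono_upto_def antimono_def)
qed

lemma expectation_pair_pmf_nonneg:
  fixes f :: "'b \<times> 'c \<Rightarrow> real"
  assumes "\<And>x. 0 \<le> f x" and "\<And>x. integrable (measure_pmf q) (\<lambda>y. f (x, y))"
  shows "measure_pmf.expectation (pair_pmf p q) f
    = measure_pmf.expectation p (\<lambda>x. measure_pmf.expectation q (\<lambda>y. f (x, y)))"
proof -
  have "measure_pmf.expectation (pair_pmf p q) f = enn2real (\<integral>\<^sup>+x. ennreal (f x) \<partial>pair_pmf p q)"
    by (rule integral_eq_nn_integral) (use assms in auto)
  also have "(\<integral>\<^sup>+x. ennreal (f x) \<partial>pair_pmf p q) = (\<integral>\<^sup>+x. \<integral>\<^sup>+y. ennreal (f (x, y)) \<partial>q \<partial>p)"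
    by (rule nn_integral_pair_pmf')
  also have "\<dots> = (\<integral>\<^sup>+x. ennreal (measure_pmf.expectation q (\<lambda>y. f (x, y))) \<partial>p)"
    by (intro nn_integral_cong nn_integral_eq_integral) (use assms in auto)
  also have "enn2real \<dots> = measure_pmf.expectation p (\<lambda>x. measure_pmf.expectation q (\<lambda>y. f (x, y)))"
    by (rule integral_eq_nn_integral[symmetric]) (use assms in auto)
  finally show ?thesis .
qed

text \<open>Integrate out the independent rest \<open>R\<close> first. As \<open>0 \<le> w\<close>,
  what remains is a decreasing function of the single count with the same bound, and
  \<open>size_bias_step\<close> applies; raising the count by 1 shifts the sum by
  \<open>w\<close>.\<close>

lemma size_bias_step_sum:
  fixes w :: real and R :: "'b pmf"
  assumes int: "integrable (measure_pmf p) real" and w: "0 \<le> w" and u: "antimono_upto c u"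
  defines "l \<equiv> measure_pmf.expectation p real" and "P \<equiv> pair_pmf p R"
  shows "\<bar>measure_pmf.expectation P (\<lambda>(x, r). real x * u (w * real x + g r))
      - l * measure_pmf.expectation P (\<lambda>(x, r). u (w * real x + g r + w))\<bar>
    \<le> l * tv_ratio p * measure_pmf.expectation P (\<lambda>(x, r). u (w * real x + g r))"
proof -
  define f where "f = (\<lambda>x. measure_pmf.expectation R (\<lambda>r. u (g r + w * real x)))"
  note fa = antimono_uptoD[OF antimono_upto_expectation[OF u, of R g]]
  have f: "antimono f" "0 \<le> f x" "f x \<le> c" for x
    using fa w by (auto simp: f_def antimono_def intro!: fa mult_left_mono)
  note u0 = antimono_uptoD(2)[OF u]
  have 1: "measure_pmf.expectation P (\<lambda>(x, r). real x * u (w * real x + g r)) = measure_pmf.expectation p (\<lambda>x. real x * f x)"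
    unfolding P_def using u0
    by (subst expectation_pair_pmf_nonneg)
      (auto simp: f_def add.commute intro!: integrable_pmf_antimono[OF u] integrable_mult_right)
  have 2: "measure_pmf.expectation P (\<lambda>(x, r). u (w * real x + g r + w)) = measure_pmf.expectation p (\<lambda>x. f (Suc x))"
    unfolding P_def using u0
    by (subst expectation_pair_pmf_nonneg)
      (auto simp: f_def algebra_simps intro!: integrable_pmf_antimono[OF u])
  have 3: "measure_pmf.expectation P (\<lambda>(x, r). u (w * real x + g r)) = measure_pmf.expectation p f"
    unfolding P_def using u0
    by (subst expectation_pair_pmf_nonneg)
      (auto simp: f_def add.commute intro!: integrable_pmf_antimono[OF u] integrable_mult_right)
  show ?thesis unfolding 1 2 3 l_def by (rule size_bias_step[OF int f])
qed

text \<open>The induction keeps the last partial sum times the last coefficient subtracted, with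
  error at most \<open>B * (a 1 - a m)\<close>. Restoring it costs \<open>B * a n\<close>, so the
  total telescopes to \<open>B * a 1\<close> without a factor 2.\<close>

lemma abel_bound:
  fixes d a :: "nat \<Rightarrow> real"
  assumes "1 \<le> n" and B: "\<And>k. 1 \<le> k \<Longrightarrow> k \<le> n \<Longrightarrow> \<bar>\<Sum>j=1..k. d j\<bar> \<le> B"
    and a: "\<And>k. 1 \<le> k \<Longrightarrow> k < n \<Longrightarrow> a (Suc k) \<le> a k" and a0: "0 \<le> a n"
  shows "\<bar>\<Sum>k=1..n. d k * a k\<bar> \<le> B * a 1"
proof -
  have "\<bar>(\<Sum>k=1..m. d k * a k) - (\<Sum>k=1..m. d k) * a m\<bar> \<le> B * (a 1 - a m)" if "1 \<le> m" "m \<le> n" for m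
    using that
  proof (induction m rule: dec_induct)
    case (step m)
    have "(\<Sum>k=1..Suc m. d k * a k) - (\<Sum>k=1..Suc m. d k) * a (Suc m)
      = ((\<Sum>k=1..m. d k * a k) - (\<Sum>k=1..m. d k) * a m) + (\<Sum>k=1..m. d k) * (a m - a (Suc m))"
      using step by (simp add: algebra_simps)
    also have "\<bar>\<dots>\<bar> \<le> B * (a 1 - a m) + B * (a m - a (Suc m))"
    proof (rule order.trans[OF abs_triangle_ineq], rule add_mono)
      show "\<bar>(\<Sum>k=1..m. d k) * (a m - a (Suc m))\<bar> \<le> B * (a m - a (Suc m))"
        using B[of m] a[of m] step by (simp add: abs_mult mult_right_mono)
    qed (use step in auto)
    finally show ?case by (simp add: algebra_simps)
  qed simp
  from this[of n] have "\<bar>(\<Sum>k=1..n. d k * a k) - (\<Sum>k=1..n. d k) * a n\<bar> \<le> B * (a 1 - a n)" using assms by simp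
  moreover have "\<bar>(\<Sum>k=1..n. d k) * a n\<bar> \<le> B * a n"
    using B[of n] a0 \<open>1 \<le> n\<close> by (simp add: abs_mult mult_right_mono)
  ultimately show ?thesis by (simp add: algebra_simps)
qed

definition prim :: "(real \<Rightarrow> real) \<Rightarrow> real \<Rightarrow> real" where
  "prim f b = enn2real (\<integral>\<^sup>+v\<in>{0<..<b}. ennreal (f v) \<partial>lborel)"

lemma prim_diff:
  assumes f: "antimono_upto c f" and ab: "0 \<le> a" "a \<le> b"
  shows "(b - a) * f b \<le> prim f b - prim f a" "prim f b - prim f a \<le> (b - a) * f a"
proof -
  define I where "I = (\<lambda>a b. \<integral>\<^sup>+v\<in>{a<..<b}. ennreal (f v) \<partial>lborel)"
  note [measurable] = antimono_upto_measurable[OF f]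
  have up: "I x y \<le> ennreal ((y - x) * f x)" if "x \<le> y" for x y
  proof -
    have "I x y \<le> (\<integral>\<^sup>+v\<in>{x<..<y}. ennreal (f x) \<partial>lborel)" unfolding I_def
      using antimono_uptoD(1)[OF f] by (intro nn_integral_mono) (auto intro: ennreal_leI split: split_indicator)
    also have "\<dots> = ennreal ((y - x) * f x)" using that antimono_uptoD(2)[OF f]
      by (simp add: nn_integral_cmult ennreal_mult'[symmetric] mult.commute)
    finally show ?thesis .
  qed
  have low: "ennreal ((y - x) * f y) \<le> I x y" if "x \<le> y" for x y
  proof -
    have "ennreal ((y - x) * f y) = (\<integral>\<^sup>+v\<in>{x<..<y}. ennreal (f y) \<partial>lborel)" using that antimono_uptoD(2)[OF f]
      by (simp add: nn_integral_cmult ennreal_mult'[symmetric] mult.commute)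
    also have "\<dots> \<le> I x y" unfolding I_def
      using antimono_uptoD(1)[OF f] by (intro nn_integral_mono) (auto intro: ennreal_leI split: split_indicator)
    finally show ?thesis .
  qed
  have split: "I 0 a + I a b = I 0 b"
  proof -
    have "I 0 a + I a b = (\<integral>\<^sup>+v. ennreal (f v) * indicator {0<..<a} v + ennreal (f v) * indicator {a<..<b} v \<partial>lborel)"
      unfolding I_def by (subst nn_integral_add) auto
    also have "\<dots> = I 0 b" unfolding I_def
    proof (rule nn_integral_cong_AE)
      show "AE v in lborel. ennreal (f v) * indicator {0<..<a} v + ennreal (f v) * indicator {a<..<b} v = ennreal (f v) * indicator {0<..<b} v"
        using AE_lborel_singleton[of a] by eventually_elim (use ab in \<open>auto split: split_indicator\<close>)
    qed
    finally show ?thesis .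
  qed
  have fin: "I 0 a < \<top>" "I a b < \<top>"
    using up[of 0 a] up[of a b] ab by (auto intro: le_less_trans)
  have "enn2real (I 0 b) = enn2real (I 0 a) + enn2real (I a b)"
    unfolding split[symmetric] using fin by (rule enn2real_plus)
  then have d: "prim f b - prim f a = enn2real (I a b)" by (simp add: prim_def I_def)
  have nn: "0 \<le> (b - a) * f b" "0 \<le> (b - a) * f a" using ab antimono_uptoD(2)[OF f] by auto
  show "(b - a) * f b \<le> prim f b - prim f a"
    unfolding d using enn2real_mono[OF low[OF ab(2)] fin(2)] nn by simp
  show "prim f b - prim f a \<le> (b - a) * f a"
    unfolding d using enn2real_mono[OF up[OF ab(2)]] nn by simp
qed

section \<open>Deterministic weights: the Stein operator of the weighted sum\<close>

locale weighted_sum =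
  fixes \<theta> :: real and n :: nat and w :: "nat \<Rightarrow> real" and p :: "nat \<Rightarrow> nat pmf"
  assumes theta_pos: "0 < \<theta>" and n: "1 \<le> n" and w0: "w 0 = 0"
    and w_mono: "\<And>k. 1 \<le> k \<Longrightarrow> k \<le> n \<Longrightarrow> w (k - 1) \<le> w k"
    and int_p: "\<And>k. 1 \<le> k \<Longrightarrow> k \<le> n \<Longrightarrow> integrable (measure_pmf (p k)) real"
begin

definition law :: "(nat \<Rightarrow> nat) pmf" where
  "law = Pi_pmf {1..n} 0 p"

definition S :: "(nat \<Rightarrow> nat) \<Rightarrow> real" where
  "S x = (\<Sum>k=1..n. w k * real (x k))"

abbreviation "E \<equiv> measure_pmf.expectation law"

definition mean :: "nat \<Rightarrow> real" where
  "mean k = measure_pmf.expectation (p k) real"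

definition tv_error :: real where
  "tv_error = (\<Sum>k=1..n. mean k * w k * tv_ratio (p k))"

definition drift :: real where
  "drift = (MAX k\<in>{1..n}. \<bar>\<Sum>j=1..k. mean j * w j - \<theta> * (w j - w (j - 1))\<bar>)"

definition width :: real where
  "width = (MAX k\<in>{1..n}. w k - w (k - 1))"

definition err :: real where
  "err = width + 2 / \<theta> * drift + 2 / \<theta> * tv_error + \<bar>w n - 1\<bar>"

lemma w_nonneg: "k \<le> n \<Longrightarrow> 0 \<le> w k"
proof (induction k)
  case (Suc k)
  then show ?case using w_mono[of "Suc k"] by simp
qed (simp add: w0)

lemma S_nonneg: "0 \<le> S x"
  unfolding S_def by (intro sum_nonneg mult_nonneg_nonneg) (auto intro: w_nonneg)

lemma mean_nonneg: "0 \<le> mean k"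
  by (simp add: mean_def)

lemma tv_error_nonneg: "0 \<le> tv_error"
  unfolding tv_error_def
  by (intro sum_nonneg mult_nonneg_nonneg mean_nonneg tv_ratio_nonneg) (auto intro: w_nonneg)

lemma drift_ge: "1 \<le> k \<Longrightarrow> k \<le> n \<Longrightarrow> \<bar>\<Sum>j=1..k. mean j * w j - \<theta> * (w j - w (j - 1))\<bar> \<le> drift"
  unfolding drift_def by (rule Max_ge) auto

lemma drift_nonneg: "0 \<le> drift"
  using drift_ge[of 1] n by (meson abs_ge_zero order_trans order_refl)

lemma width_ge: "1 \<le> k \<Longrightarrow> k \<le> n \<Longrightarrow> w k - w (k - 1) \<le> width"
  unfolding width_def by (rule Max_ge) auto

lemma width_nonneg: "0 \<le> width"
  using width_ge[of 1] w_mono[of 1] n by simp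

lemma w_le_width: "m \<le> n \<Longrightarrow> w m \<le> real m * width"
proof (induction m)
  case (Suc m)
  then show ?case using width_ge[of "Suc m"] by (simp add: algebra_simps)
qed (simp add: w0)

text \<open>Since \<open>w n \<le> n * width\<close>, the numbers \<open>width\<close> and
  \<open>\<bar>w n - 1\<bar>\<close> cannot both be small. Positivity of \<open>err\<close> makes it
  usable as a bandwidth; that the bound does not depend on the weights keeps the mean error positive
  when they are random.\<close>

lemma err_ge: "1 / real n \<le> err"
proof -
  have "1 \<le> w n + \<bar>w n - 1\<bar>" by simp
  also have "\<dots> \<le> real n * width + real n * \<bar>w n - 1\<bar>"
    using w_le_width[of n] n mult_right_mono[of 1 "real n" "\<bar>w n - 1\<bar>"] by simp
  also have "\<dots> = real n * (width + \<bar>w n - 1\<bar>)" by (simp add: algebra_simps)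
  also have "\<dots> \<le> real n * err"
    using drift_nonneg tv_error_nonneg theta_pos n
    by (intro mult_left_mono) (auto simp: err_def)
  finally show ?thesis using n by (simp add: field_simps)
qed

lemma err_pos: "0 < err"
  by (rule less_le_trans[OF _ err_ge]) (use n in auto)

lemma law_split:
  assumes k: "k \<in> {1..n}"
  shows "law = map_pmf (\<lambda>(y, f). f(k := y)) (pair_pmf (p k) (Pi_pmf ({1..n} - {k}) 0 p))"
proof -
  have "law = Pi_pmf (insert k ({1..n} - {k})) 0 p" unfolding law_def using k by (simp add: insert_absorb)
  also have "\<dots> = map_pmf (\<lambda>(y, f). f(k := y)) (pair_pmf (p k) (Pi_pmf ({1..n} - {k}) 0 p))"
    by (rule Pi_pmf_insert) auto
  finally show ?thesis .
qed

lemma S_upd: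
  assumes k: "k \<in> {1..n}"
  shows "S (f(k := y)) = w k * real y + (\<Sum>j\<in>{1..n} - {k}. w j * real (f j))"
  unfolding S_def using k by (subst sum.remove[of _ k]) (auto intro!: sum.cong)

lemma size_bias_component:
  assumes k: "k \<in> {1..n}" and u: "antimono_upto c u"
  shows "\<bar>E (\<lambda>x. real (x k) * u (S x)) - mean k * E (\<lambda>x. u (S x + w k))\<bar>
    \<le> mean k * tv_ratio (p k) * E (\<lambda>x. u (S x))"
  using size_bias_step_sum[OF int_p w_nonneg u, of k k "Pi_pmf ({1..n} - {k}) 0 p" "\<lambda>f. \<Sum>j\<in>{1..n} - {k}. w j * real (f j)"] k
  by (simp add: law_split[OF k] S_upd[OF k] case_prod_beta' mean_def)

lemma integrable_component:
  assumes k: "k \<in> {1..n}"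
  shows "integrable (measure_pmf law) (\<lambda>x. real (x k))"
proof -
  have "map_pmf (\<lambda>x. x k) law = p k" unfolding law_def using k by (subst Pi_pmf_component) auto
  then have "integrable (measure_pmf (map_pmf (\<lambda>x. x k) law)) real" using int_p k by simp
  then show ?thesis by simp
qed

lemma integrable_component_mult:
  assumes k: "k \<in> {1..n}" and u: "antimono_upto c u"
  shows "integrable (measure_pmf law) (\<lambda>x. real (x k) * u (S x))"
proof (rule Bochner_Integration.integrable_bound)
  show "integrable (measure_pmf law) (\<lambda>x. c * real (x k))" using integrable_component[OF k] by simp
  show "AE x in measure_pmf law. norm (real (x k) * u (S x)) \<le> norm (c * real (x k))"
  proof (rule AE_I2)
    fix x
    have "real (x k) * u (S x) \<le> real (x k) * c"
      by (rule mult_left_mono) (use antimono_uptoD[OF u] in auto)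
    then show "norm (real (x k) * u (S x)) \<le> norm (c * real (x k))"
      using antimono_uptoD(2)[OF u, of "S x"] antimono_uptoD(4)[OF u] by (simp add: abs_mult mult.commute)
  qed
qed simp

lemma S_mult_eq: "S x * u (S x) = (\<Sum>k=1..n. w k * (real (x k) * u (S x)))"
  by (simp add: S_def sum_distrib_right mult.assoc)

lemma integrable_S_mult:
  assumes u: "antimono_upto c u"
  shows "integrable (measure_pmf law) (\<lambda>x. S x * u (S x))"
  unfolding S_mult_eq using integrable_component_mult[OF _ u] by (intro Bochner_Integration.integrable_sum) auto

lemma integrable_unit_int:
  assumes u: "antimono_upto c u"
  shows "integrable (measure_pmf law) (\<lambda>x. unit_int u (S x))"
proof (rule measure_pmf.integrable_const_bound[where B = c])
  have "unit_int u y \<le> c" for y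
  proof -
    have "(\<integral>\<^sup>+v\<in>{y<..<y + 1}. ennreal (u v) \<partial>lborel) \<le> (\<integral>\<^sup>+v\<in>{y<..<y + 1}. ennreal c \<partial>lborel)"
      using antimono_uptoD(3)[OF u] by (intro nn_integral_mono mult_right_mono) (auto intro: ennreal_leI)
    also have "\<dots> = ennreal c" by (simp add: nn_integral_cmult)
    finally show ?thesis unfolding unit_int_def using antimono_uptoD(4)[OF u] by (metis enn2real_ennreal enn2real_mono ennreal_less_top)
  qed
  then show "AE x in measure_pmf law. norm (unit_int u (S x)) \<le> c" by (simp add: unit_int_def)
qed simp

text \<open>Fubini turns the window integral at \<open>S\<close> into an integral over
  \<open>[0, 1]\<close> of the decreasing function \<open>v \<mapsto> E (u (S + v))\<close>.
  Size-biasing produces values of this same function at the points \<open>w k\<close>, so the two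
  sides can be compared as a Riemann sum and an integral.\<close>

lemma expectation_unit_int:
  assumes u: "antimono_upto c u"
  shows "E (\<lambda>x. unit_int u (S x)) = prim (\<lambda>v. E (\<lambda>x. u (S x + v))) 1"
proof -
  note [measurable] = antimono_upto_measurable[OF u]
  have 1: "ennreal (unit_int u y) = (\<integral>\<^sup>+v\<in>{0<..<1}. ennreal (u (y + v)) \<partial>lborel)" for y
  proof -
    have "(\<integral>\<^sup>+v\<in>{y<..<y + 1}. ennreal (u v) \<partial>lborel) \<le> (\<integral>\<^sup>+v\<in>{y<..<y + 1}. ennreal c \<partial>lborel)"
      using antimono_uptoD(3)[OF u] by (intro nn_integral_mono mult_right_mono) (auto intro: ennreal_leI)
    also have "\<dots> < \<top>" by (simp add: nn_integral_cmult ennreal_mult_less_top)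
    finally have "ennreal (unit_int u y) = (\<integral>\<^sup>+v\<in>{y<..<y + 1}. ennreal (u v) \<partial>lborel)" by (simp add: unit_int_def)
    also have "\<dots> = ennreal \<bar>1\<bar> * (\<integral>\<^sup>+v. ennreal (u (y + 1 * v)) * indicator {y<..<y + 1} (y + 1 * v) \<partial>lborel)"
      by (rule nn_integral_real_affine) auto
    also have "\<dots> = (\<integral>\<^sup>+v\<in>{0<..<1}. ennreal (u (y + v)) \<partial>lborel)"
      by (simp, intro nn_integral_cong) (auto split: split_indicator)
    finally show ?thesis .
  qed
  have "E (\<lambda>x. unit_int u (S x)) = enn2real (\<integral>\<^sup>+x. ennreal (unit_int u (S x)) \<partial>law)"
    by (rule integral_eq_nn_integral) (auto simp: unit_int_def)
  also have "(\<integral>\<^sup>+x. ennreal (unit_int u (S x)) \<partial>law) = (\<integral>\<^sup>+x. (\<integral>\<^sup>+v\<in>{0<..<1}. ennreal (u (S x + v)) \<partial>lborel) \<partial>law)"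
    by (simp only: 1)
  also have "\<dots> = (\<integral>\<^sup>+v. (\<integral>\<^sup>+x. ennreal (u (S x + v)) * indicator {0<..<1} v \<partial>law) \<partial>lborel)"
  proof -
    interpret P: pair_sigma_finite lborel "measure_pmf law" ..
    have [measurable]: "(\<lambda>(v, x). u (S x + v)) \<in> borel_measurable (lborel \<Otimes>\<^sub>M measure_pmf law)"
    proof -
      have [measurable]: "S \<in> borel_measurable (measure_pmf law)" by simp
      show ?thesis by measurable
    qed
    show ?thesis by (rule P.Fubini') measurable
  qed
  also have "\<dots> = (\<integral>\<^sup>+v\<in>{0<..<1}. ennreal (E (\<lambda>x. u (S x + v))) \<partial>lborel)"
    by (intro nn_integral_cong, subst nn_integral_multc, simp, subst nn_integral_eq_integral)
      (auto intro: integrable_pmf_antimono[OF u] antimono_uptoD(2)[OF u])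
  finally show ?thesis by (simp add: prim_def)
qed

text \<open>Right endpoints underestimate the integral of a decreasing function, which fixes the
  sign. The error on one cell is at most \<open>width\<close> times the decrease of \<open>f\<close>
  over the cell, and these decreases telescope.\<close>

lemma riemann_bound:
  assumes f: "antimono_upto c f"
  shows "- width * f 0 \<le> (\<Sum>k=1..n. (w k - w (k - 1)) * f (w k)) - prim f (w n)"
    and "(\<Sum>k=1..n. (w k - w (k - 1)) * f (w k)) - prim f (w n) \<le> 0"
proof -
  have "- width * (f 0 - f (w m)) \<le> (\<Sum>k=1..m. (w k - w (k - 1)) * f (w k)) - prim f (w m) \<and>
    (\<Sum>k=1..m. (w k - w (k - 1)) * f (w k)) - prim f (w m) \<le> 0" if "m \<le> n" for m
    using that
  proof (induction m)
    case 0
    then show ?case by (simp add: w0 prim_def)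
  next
    case (Suc m)
    have wm: "0 \<le> w m" "w m \<le> w (Suc m)" using w_nonneg[of m] w_mono[of "Suc m"] Suc by auto
    note d = prim_diff[OF f wm]
    have "(w (Suc m) - w m) * (f (w m) - f (w (Suc m))) \<le> width * (f (w m) - f (w (Suc m)))"
      using width_ge[of "Suc m"] antimono_uptoD(1)[OF f wm(2)] Suc by (intro mult_right_mono) auto
    with d Suc show ?case by (simp add: algebra_simps)
  qed
  from this[of n] have "- width * (f 0 - f (w n)) \<le> (\<Sum>k=1..n. (w k - w (k - 1)) * f (w k)) - prim f (w n)"
     "(\<Sum>k=1..n. (w k - w (k - 1)) * f (w k)) - prim f (w n) \<le> 0" by auto
  moreover have "- width * f 0 \<le> - width * (f 0 - f (w n))"
    using width_nonneg antimono_uptoD(2)[OF f, of "w n"] by (simp add: mult_left_mono)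
  ultimately show "- width * f 0 \<le> (\<Sum>k=1..n. (w k - w (k - 1)) * f (w k)) - prim f (w n)"
    "(\<Sum>k=1..n. (w k - w (k - 1)) * f (w k)) - prim f (w n) \<le> 0" by auto
qed

definition stein_op :: "(real \<Rightarrow> real) \<Rightarrow> real" where
  "stein_op u = E (\<lambda>x. S x * u (S x)) / \<theta> - E (\<lambda>x. unit_int u (S x))"

text \<open>Two-sided bounds with \<open>lower + upper = err\<close>: for a difference of two decreasing functions the
  one-signed errors (Riemann sum, \<open>w n \<noteq> 1\<close>) are then counted only once, the others twice.\<close>

definition lower :: real where
  "lower = width + max 0 (1 - w n) + (drift + tv_error) / \<theta>"

definition upper :: real where
  "upper = max 0 (w n - 1) + (drift + tv_error) / \<theta>"

lemma lower_upper: "lower + upper = err" "0 \<le> lower" "0 \<le> upper"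
  using width_nonneg drift_nonneg tv_error_nonneg theta_pos
  by (auto simp: lower_def upper_def err_def field_simps max_def abs_if)

lemma stein_op_bounds:
  assumes u: "antimono_upto c u"
  shows "- lower * E (\<lambda>x. u (S x)) \<le> stein_op u" "stein_op u \<le> upper * E (\<lambda>x. u (S x))"
proof -
  define f where "f = (\<lambda>v. E (\<lambda>x. u (S x + v)))"
  define m where "m = E (\<lambda>x. u (S x))"
  have f: "antimono_upto c f" unfolding f_def by (rule antimono_upto_expectation[OF u])
  have f0: "f 0 = m" by (simp add: f_def m_def)
  note fD = antimono_uptoD[OF f]
  have m0: "0 \<le> m" using fD(2)[of 0] by (simp add: f0)
  \<comment> \<open>The four errors satisfy
    \<open>stein_op u = (T1 + T2) / \<theta> + T3 + T4\<close>: size bias, drift, Riemann sum, and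
    integration up to \<open>w n\<close> in place of 1. Each is bounded by a multiple of
    \<open>f 0 = m\<close>, the largest value of \<open>f\<close> on the half-line.\<close>
  define T1 where "T1 = E (\<lambda>x. S x * u (S x)) - (\<Sum>k=1..n. mean k * w k * f (w k))"
  define T2 where "T2 = (\<Sum>k=1..n. (mean k * w k - \<theta> * (w k - w (k - 1))) * f (w k))"
  define T3 where "T3 = (\<Sum>k=1..n. (w k - w (k - 1)) * f (w k)) - prim f (w n)"
  define T4 where "T4 = prim f (w n) - prim f 1"
  have "E (\<lambda>x. S x * u (S x)) = (\<Sum>k=1..n. w k * E (\<lambda>x. real (x k) * u (S x)))"
    unfolding S_mult_eq using integrable_component_mult[OF _ u]
    by (subst Bochner_Integration.integral_sum) auto
  then have "T1 = (\<Sum>k=1..n. w k * (E (\<lambda>x. real (x k) * u (S x)) - mean k * f (w k)))"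
    by (simp add: T1_def sum_subtractf algebra_simps)
  also have "\<bar>\<dots>\<bar> \<le> (\<Sum>k=1..n. w k * (mean k * tv_ratio (p k) * m))"
  proof (rule order.trans[OF sum_abs sum_mono])
    fix k assume k: "k \<in> {1..n}"
    have "w k * \<bar>E (\<lambda>x. real (x k) * u (S x)) - mean k * f (w k)\<bar> \<le> w k * (mean k * tv_ratio (p k) * m)"
      using size_bias_component[OF k u] w_nonneg[of k] k by (intro mult_left_mono) (auto simp: f_def m_def)
    then show "\<bar>w k * (E (\<lambda>x. real (x k) * u (S x)) - mean k * f (w k))\<bar> \<le> w k * (mean k * tv_ratio (p k) * m)"
      using w_nonneg[of k] k by (simp add: abs_mult)
  qed
  also have "\<dots> = tv_error * m" by (simp add: tv_error_def sum_distrib_left mult_ac)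
  finally have T1: "\<bar>T1\<bar> \<le> tv_error * m" .
  have "\<bar>T2\<bar> \<le> drift * f (w 1)" unfolding T2_def
  proof (rule abel_bound[OF n])
    show "f (w (Suc k)) \<le> f (w k)" if "1 \<le> k" "k < n" for k
      using w_mono[of "Suc k"] that by (intro fD(1)) simp
  qed (use drift_ge fD in auto)
  also have "\<dots> \<le> drift * m"
    using drift_nonneg fD(1)[of 0 "w 1"] w_nonneg[of 1] n f0 by (intro mult_left_mono) auto
  finally have T2: "\<bar>T2\<bar> \<le> drift * m" .
  have T3: "- width * m \<le> T3" "T3 \<le> 0"
    using riemann_bound[OF f] by (auto simp: T3_def f0)
  have T4: "- max 0 (1 - w n) * m \<le> T4 \<and> T4 \<le> max 0 (w n - 1) * m"
  proof (cases "1 \<le> w n")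
    case True
    have "(w n - 1) * f 1 \<le> (w n - 1) * m" using True fD(1)[of 0 1] f0 by (intro mult_left_mono) auto
    moreover have "0 \<le> (w n - 1) * f (w n)" using True fD(2) by simp
    ultimately show ?thesis using prim_diff[OF f, of 1 "w n"] True by (auto simp: T4_def)
  next
    case False
    have wn: "0 \<le> w n" using w_nonneg[of n] by simp
    have "(1 - w n) * f (w n) \<le> (1 - w n) * m" using False fD(1)[OF wn] f0 by (intro mult_left_mono) auto
    moreover have "0 \<le> (1 - w n) * f 1" using False fD(2) by simp
    ultimately have "prim f 1 - prim f (w n) \<le> (1 - w n) * m" "0 \<le> prim f 1 - prim f (w n)"
      using prim_diff[OF f, of "w n" 1] False wn by linarith+
    moreover have "max 0 (1 - w n) = 1 - w n" "max 0 (w n - 1) = 0" using False by auto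
    ultimately show ?thesis by (simp add: T4_def algebra_simps)
  qed
  have "T2 = (\<Sum>k=1..n. mean k * w k * f (w k)) - \<theta> * (\<Sum>k=1..n. (w k - w (k - 1)) * f (w k))"
    by (simp only: T2_def left_diff_distrib right_diff_distrib sum_subtractf sum_distrib_left mult.assoc)
  then have "(T1 + T2) / \<theta> = E (\<lambda>x. S x * u (S x)) / \<theta> - (\<Sum>k=1..n. (w k - w (k - 1)) * f (w k))"
    using theta_pos by (simp add: T1_def diff_divide_distrib)
  moreover have "E (\<lambda>x. unit_int u (S x)) = prim f 1" unfolding f_def by (rule expectation_unit_int[OF u])
  ultimately have "stein_op u = (T1 + T2) / \<theta> + T3 + T4"
    by (simp add: stein_op_def T3_def T4_def)
  moreover have "T1 + T2 \<le> (drift + tv_error) * m" "- ((drift + tv_error) * m) \<le> T1 + T2"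
    using T1 T2 by (auto simp: abs_le_iff algebra_simps)
  from divide_right_mono[OF this(1), of \<theta>] divide_right_mono[OF this(2), of \<theta>]
  have "(T1 + T2) / \<theta> \<le> (drift + tv_error) / \<theta> * m" "- ((drift + tv_error) / \<theta> * m) \<le> (T1 + T2) / \<theta>"
    using theta_pos by auto
  ultimately show "- lower * E (\<lambda>x. u (S x)) \<le> stein_op u" "stein_op u \<le> upper * E (\<lambda>x. u (S x))"
    using T3 T4 unfolding m_def[symmetric] lower_def upper_def by (auto simp: algebra_simps)
qed

text \<open>The upper bound for one function meets the lower bound for the other. As the mean of
  \<open>b\<close> is at most that of \<open>a\<close>, in both directions the constants add up to
  \<open>lower + upper = err\<close>.\<close>

lemma stein_op_diff:
  assumes a: "antimono_upto c a" and b: "antimono_upto d b" and ba: "E (\<lambda>x. b (S x)) \<le> E (\<lambda>x. a (S x))"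
  shows "\<bar>stein_op a - stein_op b\<bar> \<le> err * E (\<lambda>x. a (S x))"
proof -
  have "upper * E (\<lambda>x. b (S x)) \<le> upper * E (\<lambda>x. a (S x))" "lower * E (\<lambda>x. b (S x)) \<le> lower * E (\<lambda>x. a (S x))"
    using ba lower_upper by (auto intro: mult_left_mono)
  then show ?thesis
    using stein_op_bounds[OF a] stein_op_bounds[OF b] lower_upper(1)[symmetric]
    by (auto simp: algebra_simps abs_le_iff)
qed

end

section \<open>The bound for deterministic weights\<close>

context dickman_law
begin

abbreviation "Z \<equiv> zeta (1 + \<theta>)"

lemma zeta_summable: "summable (\<lambda>m. 1 / real (Suc m) powr (1 + \<theta>))"
proof -
  have "summable (\<lambda>m. real m powr - (1 + \<theta>))"
    using theta by (subst summable_real_powr_iff) auto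
  then have "summable (\<lambda>m. real (Suc m) powr - (1 + \<theta>))" by (subst summable_Suc_iff)
  then show ?thesis by (simp only: powr_minus_divide)
qed

lemma zeta_nonneg: "0 \<le> Z"
  unfolding zeta_def using zeta_summable by (intro suminf_nonneg) auto

end

text \<open>One concentration hypothesis serves both regimes: \<open>K = k\<^sub>\<theta>\<close>
  and \<open>\<alpha> = 1\<close> if \<open>\<theta> \<ge> 1\<close>, and \<open>K = 1\<close> and
  \<open>\<alpha> = \<theta>\<close> otherwise.\<close>

locale dickman_approx = dickman_law \<theta> \<mu> + weighted_sum \<theta> n w p
  for \<theta> \<mu> n w p +
  fixes K \<alpha> :: real
  assumes K: "0 \<le> K" and alpha: "0 < \<alpha>" "\<alpha> \<le> 1"
    and concentration: "\<And>a b. 0 \<le> a \<Longrightarrow> a \<le> b \<Longrightarrow> cdf \<mu> b - cdf \<mu> a \<le> K * (b - a) powr \<alpha>"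
begin

definition dist_fun :: "real \<Rightarrow> real" where
  "dist_fun t = measure (measure_pmf law) {x. S x \<le> t}"

definition dK :: real where
  "dK = (SUP t\<in>{0..}. \<bar>dist_fun t - cdf \<mu> t\<bar>)"

lemma dist_le_1: "\<bar>dist_fun t - cdf \<mu> t\<bar> \<le> 1"
  using measure_pmf.prob_le_1[of law "{x. S x \<le> t}"] measure_nonneg[of "measure_pmf law" "{x. S x \<le> t}"]
    cdf_nonneg[of t] cdf_bounded_prob[of t] unfolding dist_fun_def by linarith

lemma dK_ge: "0 \<le> t \<Longrightarrow> \<bar>dist_fun t - cdf \<mu> t\<bar> \<le> dK"
  unfolding dK_def by (rule cSUP_upper) (auto intro!: bdd_aboveI2[where M = 1] dist_le_1)

lemma dK_nonneg: "0 \<le> dK"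
  using dK_ge[of 0] by simp

lemma dK_le: "(\<And>t. 0 \<le> t \<Longrightarrow> \<bar>dist_fun t - cdf \<mu> t\<bar> \<le> c) \<Longrightarrow> dK \<le> c"
  unfolding dK_def by (rule cSUP_least) auto

lemma integrable_law_bounded:
  fixes f :: "(nat \<Rightarrow> nat) \<Rightarrow> real"
  shows "(\<And>x. \<bar>f x\<bar> \<le> c) \<Longrightarrow> integrable (measure_pmf law) f"
  by (rule measure_pmf.integrable_const_bound[where B = c]) auto

lemma prob_interval:
  assumes "0 \<le> a" "a \<le> b"
  shows "measure (measure_pmf law) {x. a < S x \<and> S x \<le> b} \<le> 2 * dK + K * (b - a) powr \<alpha>"
proof -
  have sub: "{x. S x \<le> a} \<subseteq> {x. S x \<le> b}" using assms by auto
  have eq: "{x. a < S x \<and> S x \<le> b} = {x. S x \<le> b} - {x. S x \<le> a}" by auto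
  have "measure (measure_pmf law) {x. a < S x \<and> S x \<le> b} = dist_fun b - dist_fun a"
    unfolding dist_fun_def eq by (rule measure_pmf.finite_measure_Diff[OF _ _ sub]) simp_all
  then show ?thesis using dK_ge[of a] dK_ge[of b] concentration[OF assms] assms by linarith
qed

lemma dist_fun_le: "0 \<le> s \<Longrightarrow> dist_fun s \<le> dK + K * s powr \<alpha>"
  using dK_ge[of s] concentration[of 0 s] by (simp add: cdf_0 abs_le_iff)

lemma ramp_tail:
  assumes s: "0 < s" and x: "0 \<le> x"
  shows "ennreal ((s / max s x) powr (\<theta> + 1)) \<le> indicator {..s} x
    + (\<Sum>m. ennreal (1 / real (Suc m) powr (1 + \<theta>)) * indicator {real (Suc m) * s<..real (Suc m) * s + s} x)"
proof (cases "x \<le> s")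
  case False
  \<comment> \<open>\<open>Suc m\<close> numbers, from 0, the block of length \<open>s\<close> that
    contains \<open>x\<close>. Blocks are open on the left, hence the ceiling; \<open>x > s\<close>
    makes it at least 2.\<close>
  define m where "m = nat (\<lceil>x / s\<rceil> - 2)"
  have "1 < x / s" using False s by simp
  then have c2: "2 \<le> \<lceil>x / s\<rceil>" by linarith
  then have m: "real (Suc m) = of_int \<lceil>x / s\<rceil> - 1" by (simp add: m_def)
  have "real (Suc m) < x / s" "x / s \<le> real (Suc m) + 1" unfolding m by linarith+
  then have mx: "real (Suc m) * s < x" "x \<le> real (Suc m) * s + s"
    using s by (auto simp: field_simps)
  have "0 < x" using False s by simp
  then have "s / x \<le> 1 / real (Suc m)" using mx by (simp add: field_simps)
  then have sx: "(s / x) powr (\<theta> + 1) \<le> (1 / real (Suc m)) powr (\<theta> + 1)"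
    using s x theta by (intro powr_mono2) auto
  define F where "F = (\<lambda>m. ennreal (1 / real (Suc m) powr (1 + \<theta>)) * indicator {real (Suc m) * s<..real (Suc m) * s + s} x)"
  have "ennreal ((s / max s x) powr (\<theta> + 1)) \<le> F m"
  proof -
    have "max s x = x" using False by simp
    moreover have "F m = ennreal (1 / real (Suc m) powr (1 + \<theta>))"
      unfolding F_def using mx by (simp only: greaterThanAtMost_iff indicator_simps mult_1_right simp_thms)
    moreover have "(1 / real (Suc m)) powr (\<theta> + 1) = 1 / real (Suc m) powr (1 + \<theta>)"
      by (simp add: powr_divide add.commute del: of_nat_Suc)
    ultimately show ?thesis using ennreal_leI[OF sx] by (simp only:)
  qed
  also have "F m = sum F {m}" by simp
  also have "\<dots> \<le> suminf F" by (rule sum_le_suminf) auto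
  finally show ?thesis by (simp add: False F_def)
qed (use s in \<open>simp add: max_absorb1\<close>)

text \<open>The block starting at 0 costs \<open>dK\<close> once, because the Dickman distribution
  function vanishes at 0 and nothing is subtracted for \<open>S\<close>; every other block has two
  endpoints and costs \<open>2 * dK\<close>. So \<open>dK\<close> gets the factor
  \<open>1 + 2 * Z\<close>, but \<open>k\<close> only \<open>1 + Z\<close>.\<close>

lemma expectation_ramp_tail:
  assumes s: "0 < s"
  defines "k \<equiv> K * s powr \<alpha>"
  shows "E (\<lambda>x. (s / max s (S x)) powr (\<theta> + 1)) \<le> (dK + k) + Z * (2 * dK + k)"
proof -
  have k0: "0 \<le> k" using K by (simp add: k_def)
  define I where "I = (\<lambda>m. {x. real (Suc m) * s < S x \<and> S x \<le> real (Suc m) * s + s})"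
  define c where "c = (\<lambda>m. 1 / real (Suc m) powr (1 + \<theta>))"
  have c0: "0 \<le> c m" for m by (simp add: c_def)
  have "(\<integral>\<^sup>+x. ennreal ((s / max s (S x)) powr (\<theta> + 1)) \<partial>law)
    \<le> (\<integral>\<^sup>+x. indicator {x. S x \<le> s} x + (\<Sum>m. ennreal (c m) * indicator (I m) x) \<partial>law)"
  proof (rule nn_integral_mono)
    fix x
    have "indicator {..s} (S x) = (indicator {x. S x \<le> s} x :: ennreal)"
      "indicator {real (Suc m) * s<..real (Suc m) * s + s} (S x) = (indicator (I m) x :: ennreal)" for m
      by (auto simp: I_def split: split_indicator)
    then show "ennreal ((s / max s (S x)) powr (\<theta> + 1)) \<le> indicator {x. S x \<le> s} x + (\<Sum>m. ennreal (c m) * indicator (I m) x)"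
      using ramp_tail[OF s S_nonneg, of x] by (simp add: c_def)
  qed
  also have "\<dots> = emeasure (measure_pmf law) {x. S x \<le> s} + (\<Sum>m. \<integral>\<^sup>+x. ennreal (c m) * indicator (I m) x \<partial>law)"
    by (subst nn_integral_add) (auto simp: nn_integral_suminf)
  also have "\<dots> \<le> ennreal (dK + k) + (\<Sum>m. ennreal (c m * (2 * dK + k)))"
  proof (intro add_mono suminf_le)
    show "emeasure (measure_pmf law) {x. S x \<le> s} \<le> ennreal (dK + k)"
      using dist_fun_le[of s] s by (auto simp: measure_pmf.emeasure_eq_measure dist_fun_def k_def intro: ennreal_leI)
    fix m
    have "(\<integral>\<^sup>+x. ennreal (c m) * indicator (I m) x \<partial>law) = ennreal (c m * measure (measure_pmf law) (I m))"
      by (simp only: nn_integral_cmult_indicator sets_measure_pmf UNIV_I Pow_UNIV measure_pmf.emeasure_eq_measure ennreal_mult'[OF c0])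
    also have "measure (measure_pmf law) (I m) \<le> 2 * dK + k"
      using prob_interval[of "real (Suc m) * s" "real (Suc m) * s + s"] s by (simp add: I_def k_def)
    then have "ennreal (c m * measure (measure_pmf law) (I m)) \<le> ennreal (c m * (2 * dK + k))"
      by (intro ennreal_leI mult_left_mono) (auto simp: c_def)
    finally show "(\<integral>\<^sup>+x. ennreal (c m) * indicator (I m) x \<partial>law) \<le> ennreal (c m * (2 * dK + k))" .
  qed auto
  also have "(\<Sum>m. ennreal (c m * (2 * dK + k))) = ennreal (\<Sum>m. c m * (2 * dK + k))"
    using zeta_summable dK_nonneg k0 by (intro suminf_ennreal2 summable_mult2) (auto simp: c_def)
  also have "(\<Sum>m. c m * (2 * dK + k)) = Z * (2 * dK + k)"
    unfolding zeta_def c_def using zeta_summable by (rule suminf_mult2[symmetric])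
  also have "ennreal (dK + k) + ennreal (Z * (2 * dK + k)) = ennreal ((dK + k) + Z * (2 * dK + k))"
    using dK_nonneg k0 zeta_nonneg by (intro ennreal_plus[symmetric]) auto
  finally have le: "(\<integral>\<^sup>+x. ennreal ((s / max s (S x)) powr (\<theta> + 1)) \<partial>law) \<le> ennreal ((dK + k) + Z * (2 * dK + k))" .
  have "E (\<lambda>x. (s / max s (S x)) powr (\<theta> + 1)) = enn2real (\<integral>\<^sup>+x. ennreal ((s / max s (S x)) powr (\<theta> + 1)) \<partial>law)"
    by (rule integral_eq_nn_integral) auto
  also have "\<dots> \<le> (dK + k) + Z * (2 * dK + k)"
    using le dK_nonneg k0 zeta_nonneg by (intro enn2real_leI) auto
  finally show ?thesis .
qed

lemma unit_int_add:
  assumes f: "antimono_upto c f" and g: "antimono_upto d g" and q: "0 \<le> q"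
  shows "unit_int (\<lambda>x. f x + q * g x) y = unit_int f y + q * unit_int g y"
proof -
  note [measurable] = antimono_upto_measurable[OF f] antimono_upto_measurable[OF g]
  have nn: "0 \<le> unit_int h y" for h by (simp add: unit_int_def)
  have "(\<integral>\<^sup>+v\<in>{y<..<y + 1}. ennreal (f v + q * g v) \<partial>lborel)
    = (\<integral>\<^sup>+v. ennreal (f v) * indicator {y<..<y + 1} v + ennreal q * (ennreal (g v) * indicator {y<..<y + 1} v) \<partial>lborel)"
    using antimono_uptoD(2)[OF f] antimono_uptoD(2)[OF g] q
    by (intro nn_integral_cong) (auto split: split_indicator simp: ennreal_mult')
  also have "\<dots> = ennreal (unit_int f y) + ennreal q * ennreal (unit_int g y)"
    by (simp add: nn_integral_add nn_integral_cmult nn_unit_int[OF f] nn_unit_int[OF g])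
  also have "\<dots> = ennreal (unit_int f y + q * unit_int g y)"
    using q nn by (simp add: ennreal_mult')
  finally show ?thesis unfolding unit_int_def[of "\<lambda>x. f x + q * g x"] using q nn
    by (simp del: ennreal_plus)
qed

lemma stein_op_add:
  assumes f: "antimono_upto c f" and g: "antimono_upto d g" and q: "0 \<le> q"
  shows "stein_op (\<lambda>x. f x + q * g x) = stein_op f + q * stein_op g"
proof -
  have "E (\<lambda>x. S x * (f (S x) + q * g (S x))) = E (\<lambda>x. S x * f (S x)) + q * E (\<lambda>x. S x * g (S x))"
    using integrable_S_mult[OF f] integrable_S_mult[OF g] by (simp add: distrib_left mult.left_commute)
  moreover have "E (\<lambda>x. unit_int f (S x) + q * unit_int g (S x)) = E (\<lambda>x. unit_int f (S x)) + q * E (\<lambda>x. unit_int g (S x))"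
    using integrable_unit_int[OF f] integrable_unit_int[OF g] by simp
  ultimately show ?thesis
    by (simp add: stein_op_def unit_int_add[OF f g q] algebra_simps add_divide_distrib)
qed

lemma stein_op_stein_sol:
  assumes s: "0 \<le> s"
  shows "stein_op (stein_sol \<theta> s) = E (\<lambda>x. min (S x) s) - expectation (\<lambda>y. min y s)"
proof -
  note u = antimono_upto_stein_sol[OF s]
  have i: "integrable (measure_pmf law) (\<lambda>x. min (S x) s)"
    by (rule integrable_law_bounded[where c = s]) (use S_nonneg s in \<open>auto simp: abs_le_iff min_def\<close>)
  have "E (\<lambda>x. min (S x) s) - expectation (\<lambda>y. min y s) = E (\<lambda>x. min (S x) s - expectation (\<lambda>y. min y s))"
    using i by simp
  also have "\<dots> = E (\<lambda>x. (1 / \<theta>) * (S x * stein_sol \<theta> s (S x)) - unit_int (stein_sol \<theta> s) (S x))"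
    by (simp add: stein_equation[OF s S_nonneg])
  also have "\<dots> = stein_op (stein_sol \<theta> s)"
    using integrable_S_mult[OF u] integrable_unit_int[OF u]
    by (subst Bochner_Integration.integral_diff) (auto simp: stein_op_def)
  finally show ?thesis ..
qed

text \<open>The solution for the smoothed indicator is the difference of two decreasing functions \<open>b \<le> a\<close>,
  where \<open>a\<close> is a multiple of \<open>stein_sol \<theta> s\<close> so small that its mean is controlled by the probabilities
  of intervals of length \<open>s\<close>.\<close>

lemma smooth_bound:
  assumes t: "0 \<le> t" and h: "0 < h"
  defines "s \<equiv> t + h" and "k \<equiv> K * h powr \<alpha>"
  shows "\<bar>stein_op (stein_sol \<theta> s) - stein_op (stein_sol \<theta> t)\<bar>
    \<le> err * (\<theta>\<^sup>2 * h + \<theta> * (dK + k) + \<theta> * Z * (2 * dK + k))"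
proof -
  have s: "0 < s" "t < s" using t h by (auto simp: s_def)
  define q where "q = (t / s) powr (\<theta> + 1)"
  have q: "0 \<le> q" "q \<le> 1" using t s theta by (auto simp: q_def intro!: powr_le1)
  define a where "a = (\<lambda>x. (1 - q) * stein_sol \<theta> s x)"
  define b where "b = (\<lambda>x. stein_sol \<theta> t x - q * stein_sol \<theta> s x)"
  note us = antimono_upto_stein_sol[OF less_imp_le[OF s(1)]]
  note ut = antimono_upto_stein_sol[OF t]
  have a: "antimono_upto ((1 - q) * \<theta>) a"
    unfolding a_def using q by (intro antimono_upto_cmult[OF us]) auto
  have b: "antimono_upto \<theta> b" unfolding b_def q_def by (rule antimono_upto_stein_sol_diff[OF t s(2)])
  \<comment> \<open>\<open>stein_op_add\<close> covers non-negative coefficients only, so instead of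
    splitting a difference the same multiple of \<open>stein_sol \<theta> s\<close> is added to
    \<open>a\<close> and to \<open>b\<close>.\<close>
  have "stein_sol \<theta> s = (\<lambda>x. a x + q * stein_sol \<theta> s x)" "stein_sol \<theta> t = (\<lambda>x. b x + q * stein_sol \<theta> s x)"
    by (auto simp: a_def b_def algebra_simps)
  then have "stein_op (stein_sol \<theta> s) = stein_op a + q * stein_op (stein_sol \<theta> s)"
    "stein_op (stein_sol \<theta> t) = stein_op b + q * stein_op (stein_sol \<theta> s)"
    using stein_op_add[OF a us q(1)] stein_op_add[OF b us q(1)] by simp_all
  then have eq: "stein_op (stein_sol \<theta> s) - stein_op (stein_sol \<theta> t) = stein_op a - stein_op b" by linarith
  have ba: "b x \<le> a x" for x
    using stein_sol_mono[OF t less_imp_le[OF s(2)], of x] by (simp add: a_def b_def algebra_simps)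
  have "\<bar>stein_op a - stein_op b\<bar> \<le> err * E (\<lambda>x. a (S x))"
    by (rule stein_op_diff[OF a b]) (intro integral_mono integrable_pmf_antimono[OF a] integrable_pmf_antimono[OF b] ba)
  also have "E (\<lambda>x. a (S x)) \<le> \<theta>\<^sup>2 * h + \<theta> * (dK + k) + \<theta> * Z * (2 * dK + k)"
  proof -
    define c where "c = (\<lambda>x. (s / max s x) powr (\<theta> + 1))"
    have c01: "0 \<le> c x \<and> c x \<le> 1" for x
      using s theta by (auto simp: c_def intro!: powr_le1)
    \<comment> \<open>The factor \<open>\<theta> + 1\<close> produced here cancels against the
      height \<open>\<rho>\<close> of the ramp and leaves \<open>\<theta> * h / s\<close>.\<close>
    have "1 + (\<theta> + 1) * (t / s - 1) \<le> q" unfolding q_def using t s theta by (intro Bernoulli_powr) auto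
    then have "1 - q \<le> (\<theta> + 1) * (h / s)" using s by (simp add: s_def field_simps)
    then have "(1 - q) * \<rho> \<le> (\<theta> + 1) * (h / s) * \<rho>" using rho by (intro mult_right_mono) auto
    also have "\<dots> = \<theta> * h / s" using theta s by simp
    finally have qr: "(1 - q) * \<rho> \<le> \<theta> * h / s" .
    have "a x \<le> \<theta> * h / s * (c x + \<theta> * c 1)" if "0 \<le> x" for x
    proof -
      have "a x \<le> (1 - q) * (\<rho> * c x + \<theta> * (\<rho> * c 1))"
        unfolding a_def c_def ramp_def[symmetric] using q s that by (intro mult_left_mono stein_sol_le) auto
      also have "\<dots> = ((1 - q) * \<rho>) * (c x + \<theta> * c 1)" by (simp only: distrib_left mult.assoc mult.left_commute)
      also have "\<dots> \<le> \<theta> * h / s * (c x + \<theta> * c 1)"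
        using qr c01 theta by (intro mult_right_mono add_nonneg_nonneg mult_nonneg_nonneg) auto
      finally show ?thesis .
    qed
    then have "E (\<lambda>x. a (S x)) \<le> E (\<lambda>x. \<theta> * h / s * (c (S x) + \<theta> * c 1))"
      using S_nonneg c01
      by (intro integral_mono integrable_pmf_antimono[OF a] integrable_mult_right Bochner_Integration.integrable_add
          integrable_law_bounded[where c = 1]) auto
    also have "\<dots> = \<theta> * h / s * E (\<lambda>x. c (S x)) + \<theta> * h / s * (\<theta> * c 1)"
    proof -
      have "integrable (measure_pmf law) (\<lambda>x. c (S x))"
        by (rule integrable_law_bounded[where c = 1]) (use c01 in auto)
      then have "E (\<lambda>x. c (S x) + \<theta> * c 1) = E (\<lambda>x. c (S x)) + \<theta> * c 1" by simp
      moreover have "E (\<lambda>x. \<theta> * h / s * (c (S x) + \<theta> * c 1)) = \<theta> * h / s * E (\<lambda>x. c (S x) + \<theta> * c 1)"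
        by (rule integral_mult_right_zero)
      ultimately show ?thesis by (simp only: distrib_left)
    qed
    also have "\<theta> * h / s * (\<theta> * c 1) \<le> \<theta>\<^sup>2 * h"
    proof -
      \<comment> \<open>This absorbs the \<open>1 / s\<close> of the prefactor, so that the
        contribution of the value at 1 is at most \<open>\<theta>\<^sup>2 * h\<close> uniformly in
        \<open>t\<close>.\<close>
      have "c 1 \<le> s"
      proof (cases "s \<le> 1")
        case True
        have "s powr (\<theta> + 1) \<le> s powr 1" using s True theta by (intro powr_mono') auto
        then show ?thesis using s True by (simp add: c_def max_absorb2)
      next
        case False
        then show ?thesis using c01[of 1] by simp
      qed
      then have "\<theta>\<^sup>2 * h * (c 1 / s) \<le> \<theta>\<^sup>2 * h * 1"
        using s h by (intro mult_left_mono) auto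
      then show ?thesis by (simp add: power2_eq_square mult_ac)
    qed
    also have "\<theta> * h / s * E (\<lambda>x. c (S x)) \<le> \<theta> * ((dK + k) + Z * (2 * dK + k))"
    proof -
      define k' where "k' = K * s powr \<alpha>"
      have k'0: "0 \<le> k'" using K by (simp add: k'_def)
      have hs: "0 \<le> h / s" "h / s \<le> 1" using h t by (auto simp: s_def)
      \<comment> \<open>Concentration at scale \<open>s\<close> is traded for concentration at scale
        \<open>h\<close>: as \<open>\<alpha> \<le> 1\<close>, the factor \<open>h / s\<close> more
        than compensates for passing from \<open>h powr \<alpha>\<close> to
        \<open>s powr \<alpha>\<close>.\<close>
      have "s powr (\<alpha> - 1) \<le> h powr (\<alpha> - 1)" using alpha h t by (intro powr_mono2') (auto simp: s_def)
      then have "h * s powr (\<alpha> - 1) \<le> h * h powr (\<alpha> - 1)" using h by (intro mult_left_mono) auto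
      then have "h / s * s powr \<alpha> \<le> h powr \<alpha>" using h s by (simp add: powr_diff)
      then have "K * (h / s * s powr \<alpha>) \<le> K * h powr \<alpha>" using K by (intro mult_left_mono) auto
      then have hk: "h / s * k' \<le> k" by (simp add: k'_def k_def mult_ac)
      have hd: "h / s * dK \<le> dK" using mult_right_mono[OF hs(2) dK_nonneg] by simp
      have "\<theta> * h / s * E (\<lambda>x. c (S x)) \<le> \<theta> * h / s * ((dK + k') + Z * (2 * dK + k'))"
        using expectation_ramp_tail[OF s(1)] theta h s by (intro mult_left_mono) (auto simp: c_def k'_def)
      also have "\<dots> = \<theta> * ((h / s * dK + h / s * k') + Z * (2 * (h / s * dK) + h / s * k'))"
        by (simp add: algebra_simps add_divide_distrib)
      also have "\<dots> \<le> \<theta> * ((dK + k) + Z * (2 * dK + k))"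
        using theta hk hd zeta_nonneg by (intro mult_left_mono add_mono) auto
      finally show ?thesis .
    qed
    finally show ?thesis by (simp add: algebra_simps)
  qed
  finally show ?thesis unfolding eq using err_pos by (simp add: mult_left_mono)
qed

section \<open>Smoothing and the self-referential inequality for \<open>dK\<close>\<close>

lemma smooth_indicator:
  fixes x :: real
  assumes "0 \<le> t" "0 < h"
  shows "indicator {..t} x \<le> 1 - (min x (t + h) - min x t) / h"
    "1 - (min x (t + h) - min x t) / h \<le> indicator {..t + h} x"
proof -
  define y where "y = (min x (t + h) - min x t) / h"
  have "0 \<le> y" "y \<le> 1" using assms by (auto simp: y_def min_def divide_le_eq)
  moreover have "x \<le> t \<Longrightarrow> y = 0" "t + h < x \<Longrightarrow> y = 1" using assms by (auto simp: y_def min_def)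
  ultimately show "indicator {..t} x \<le> 1 - (min x (t + h) - min x t) / h"
    "1 - (min x (t + h) - min x t) / h \<le> indicator {..t + h} x"
    unfolding y_def[symmetric] by (auto split: split_indicator)
qed

text \<open>Both distribution functions are sandwiched by smoothed indicators starting at
  \<open>t\<close> and at \<open>t - h\<close>. Shifting the argument by \<open>h\<close> is paid
  for on the Dickman side only, where it costs \<open>k\<close>.\<close>

lemma smoothing:
  assumes h: "0 < h"
  defines "k \<equiv> K * h powr \<alpha>"
  shows "dK \<le> err * (\<theta>\<^sup>2 * h + \<theta> * (dK + k) + \<theta> * Z * (2 * dK + k)) / h + k"
proof -
  define G where "G = err * (\<theta>\<^sup>2 * h + \<theta> * (dK + k) + \<theta> * Z * (2 * dK + k))"
  have k0: "0 \<le> k" using K by (simp add: k_def)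
  have G0: "0 \<le> G" unfolding G_def using err_pos theta h dK_nonneg k0 zeta_nonneg
    by (intro mult_nonneg_nonneg add_nonneg_nonneg) auto
  have main: "dist_fun t - cdf \<mu> (t + h) \<le> G / h" "cdf \<mu> t - dist_fun (t + h) \<le> G / h" if t: "0 \<le> t" for t
  proof -
    define f where "f = (\<lambda>x. 1 - (min x (t + h) - min x t) / h)"
    have f01: "0 \<le> f x" "f x \<le> 1" for x
      using h unfolding f_def by (auto simp: min_def field_simps)
    have iE: "integrable (measure_pmf law) (\<lambda>x. f (S x))" by (rule integrable_law_bounded[where c = 1]) (use f01 in auto)
    have [measurable]: "f \<in> borel_measurable borel" unfolding f_def by measurable
    have iD: "integrable \<mu> f" by (rule integrable_const_bound[where B = 1]) (use f01 in auto)
    have i1: "integrable (measure_pmf law) (\<lambda>x. min (S x) r)" if "0 \<le> r" for r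
      by (rule integrable_law_bounded[where c = r]) (use S_nonneg that in \<open>auto simp: abs_le_iff min_def\<close>)
    have i2: "integrable \<mu> (\<lambda>x. min x r)" if "0 \<le> r" for r
      by (rule integrable_const_bound[where B = r]) (use AE_nonneg that in \<open>auto elim!: eventually_mono simp: abs_le_iff min_def\<close>)
    have eE: "E (\<lambda>x. f (S x)) = 1 - (E (\<lambda>x. min (S x) (t + h)) - E (\<lambda>x. min (S x) t)) / h"
      unfolding f_def using i1[of t] i1[of "t + h"] t h by simp
    have eD: "expectation f = 1 - (expectation (\<lambda>x. min x (t + h)) - expectation (\<lambda>x. min x t)) / h"
      unfolding f_def using i2[of t] i2[of "t + h"] t h prob_space by simp
    have "E (\<lambda>x. f (S x)) - expectation f = - (stein_op (stein_sol \<theta> (t + h)) - stein_op (stein_sol \<theta> t)) / h"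
      unfolding eE eD using t h by (simp add: stein_op_stein_sol diff_divide_distrib)
    then have "\<bar>E (\<lambda>x. f (S x)) - expectation f\<bar> = \<bar>stein_op (stein_sol \<theta> (t + h)) - stein_op (stein_sol \<theta> t)\<bar> / h"
      using h by (simp add: abs_divide)
    also have "\<dots> \<le> G / h"
      using smooth_bound[OF t h] h unfolding G_def k_def by (intro divide_right_mono) auto
    finally have dG: "\<bar>E (\<lambda>x. f (S x)) - expectation f\<bar> \<le> G / h" .
    have F1: "dist_fun t \<le> E (\<lambda>x. f (S x))"
    proof -
      have "dist_fun t = E (indicator {x. S x \<le> t})" by (simp add: dist_fun_def)
      also have "\<dots> \<le> E (\<lambda>x. f (S x))"
      proof (rule integral_mono[OF _ iE])
        show "indicator {x. S x \<le> t} x \<le> f (S x)" for x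
          using smooth_indicator(1)[OF t h, of "S x"] by (simp add: f_def indicator_def)
      qed (auto simp: integrable_real_indicator measure_pmf.emeasure_eq_measure)
      finally show ?thesis .
    qed
    have F2: "E (\<lambda>x. f (S x)) \<le> dist_fun (t + h)"
    proof -
      have "E (\<lambda>x. f (S x)) \<le> E (indicator {x. S x \<le> t + h})"
      proof (rule integral_mono[OF iE])
        show "f (S x) \<le> indicator {x. S x \<le> t + h} x" for x
          using smooth_indicator(2)[OF t h, of "S x"] by (simp add: f_def indicator_def)
      qed (auto simp: integrable_real_indicator measure_pmf.emeasure_eq_measure)
      then show ?thesis by (simp add: dist_fun_def)
    qed
    have D1: "cdf \<mu> t \<le> expectation f"
    proof -
      have "cdf \<mu> t = expectation (indicator {..t})" by (simp add: cdf_def)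
      also have "\<dots> \<le> expectation f"
        using smooth_indicator(1)[OF t h] by (intro integral_mono iD)
          (auto simp: f_def integrable_real_indicator emeasure_eq_measure)
      finally show ?thesis .
    qed
    have D2: "expectation f \<le> cdf \<mu> (t + h)"
    proof -
      have "expectation f \<le> expectation (indicator {..t + h})"
        using smooth_indicator(2)[OF t h] by (intro integral_mono iD)
          (auto simp: f_def integrable_real_indicator emeasure_eq_measure)
      then show ?thesis by (simp add: cdf_def)
    qed
    show "dist_fun t - cdf \<mu> (t + h) \<le> G / h" "cdf \<mu> t - dist_fun (t + h) \<le> G / h"
      using dG F1 F2 D1 D2 by linarith+
  qed
  have "\<bar>dist_fun t - cdf \<mu> t\<bar> \<le> G / h + k" if t: "0 \<le> t" for t
  proof -
    have 1: "dist_fun t - cdf \<mu> t \<le> G / h + k"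
      using main(1)[OF t] concentration[of t "t + h"] t h by (simp add: k_def)
    have 2: "cdf \<mu> t - dist_fun t \<le> G / h + k"
    \<comment> \<open>For \<open>t < h\<close> there is no smoothed indicator starting at
      \<open>t - h\<close> within the half-line; but there the Dickman distribution function is
      itself at most \<open>k\<close>.\<close>
    proof (cases "h \<le> t")
      case True
      then show ?thesis using main(2)[of "t - h"] concentration[of "t - h" t] t h by (simp add: k_def)
    next
      case False
      have "cdf \<mu> t \<le> K * t powr \<alpha>" using concentration[of 0 t] t by (simp add: cdf_0)
      also have "\<dots> \<le> k" unfolding k_def using K False t alpha by (intro mult_left_mono powr_mono2) auto
      finally have "cdf \<mu> t \<le> k" .
      moreover have "0 \<le> dist_fun t" by (simp add: dist_fun_def)
      moreover have "0 \<le> G / h" using G0 h by simp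
      ultimately show ?thesis by linarith
    qed
    from 1 2 show ?thesis by linarith
  qed
  then show ?thesis unfolding G_def by (rule dK_le)
qed

text \<open>Absorbing \<open>dK\<close> doubles the remaining terms, whence
  \<open>2 * \<theta>\<^sup>2\<close>. The term \<open>k\<close> enters with weight
  \<open>1 + Z\<close> from the solution and, after clearing the denominator,
  \<open>2 * (1 + 2 * Z)\<close> from the smoothing; their sum is \<open>3 + 5 * Z\<close>.\<close>

lemma dK_bound:
  defines "h \<equiv> (2 * \<theta> + 4 * \<theta> * Z) * err"
  shows "dK * (1 + 2 * Z) \<le> 2 * \<theta>\<^sup>2 * err * (1 + 2 * Z) + K * h powr \<alpha> * (3 + 5 * Z)"
proof -
  define k where "k = K * h powr \<alpha>"
  define c where "c = 2 * \<theta> + 4 * \<theta> * Z"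
  have c: "0 < c" unfolding c_def using theta zeta_nonneg by (intro add_pos_nonneg) auto
  have h: "0 < h" using c err_pos by (simp add: h_def c_def)
  have hc: "err / h = 1 / c" using err_pos c by (simp add: h_def c_def)
  have "dK \<le> err * (\<theta>\<^sup>2 * h + \<theta> * (dK + k) + \<theta> * Z * (2 * dK + k)) / h + k"
    unfolding k_def by (rule smoothing[OF h])
  also have "\<dots> = \<theta>\<^sup>2 * err + (err / h) * (\<theta> * (dK + k) + \<theta> * Z * (2 * dK + k)) + k"
    using h by (simp add: field_simps)
  also have "\<dots> = \<theta>\<^sup>2 * err + (\<theta> * (dK + k) + \<theta> * Z * (2 * dK + k)) / c + k"
    unfolding hc by simp
  finally have "dK * c \<le> (\<theta>\<^sup>2 * err + (\<theta> * (dK + k) + \<theta> * Z * (2 * dK + k)) / c + k) * c"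
    using c by (intro mult_right_mono) auto
  also have "\<dots> = \<theta>\<^sup>2 * err * c + (\<theta> * (dK + k) + \<theta> * Z * (2 * dK + k)) + k * c"
    using c by (simp add: field_simps)
  finally have "\<theta> * (dK * (1 + 2 * Z)) \<le> \<theta> * (2 * \<theta>\<^sup>2 * err * (1 + 2 * Z) + k * (3 + 5 * Z))"
    by (simp add: c_def algebra_simps power2_eq_square)
  then show ?thesis using theta by (simp add: k_def)
qed

text \<open>Here \<open>h\<close> contributes the factor \<open>2 * \<theta> * (1 + 2 * Z)\<close>,
  whose bracket cancels, so \<open>3 + 5 * Z\<close> becomes
  \<open>6 * \<theta> + 10 * \<theta> * Z\<close>.\<close>

lemma dK_bound_linear:
  assumes "\<alpha> = 1"
  shows "dK \<le> (2 * \<theta>\<^sup>2 + (6 * \<theta> + 10 * \<theta> * Z) * K) * err"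
proof -
  have "0 < (2 * \<theta> + 4 * \<theta> * Z) * err"
    using theta zeta_nonneg err_pos by (auto intro!: mult_pos_pos add_pos_nonneg)
  then have "dK * (1 + 2 * Z) \<le> 2 * \<theta>\<^sup>2 * err * (1 + 2 * Z) + K * ((2 * \<theta> + 4 * \<theta> * Z) * err) * (3 + 5 * Z)"
    using dK_bound assms by simp
  also have "\<dots> = (2 * \<theta>\<^sup>2 + (6 * \<theta> + 10 * \<theta> * Z) * K) * err * (1 + 2 * Z)"
    by (simp add: algebra_simps)
  finally show ?thesis by (rule mult_right_le_imp_le) (use zeta_nonneg in auto)
qed

lemma dK_bound_powr:
  assumes "K = 1"
  shows "dK \<le> 2 * \<theta>\<^sup>2 * err + 3 * (2 * \<theta> + 4 * \<theta> * Z) powr \<alpha> * err powr \<alpha>"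
proof -
  define h where "h = (2 * \<theta> + 4 * \<theta> * Z) * err"
  have hp: "h powr \<alpha> = (2 * \<theta> + 4 * \<theta> * Z) powr \<alpha> * err powr \<alpha>"
    unfolding h_def by (rule powr_mult)
  have "dK * (1 + 2 * Z) \<le> 2 * \<theta>\<^sup>2 * err * (1 + 2 * Z) + h powr \<alpha> * (3 + 5 * Z)"
    using dK_bound assms by (simp add: h_def)
  \<comment> \<open>The power of \<open>h\<close> does not cancel the bracket here; rounding
    \<open>3 + 5 * Z\<close> up to \<open>3 * (1 + 2 * Z)\<close> is the source of the 3 in
    \<open>C2\<close>.\<close>
  also have "\<dots> \<le> 2 * \<theta>\<^sup>2 * err * (1 + 2 * Z) + h powr \<alpha> * (3 * (1 + 2 * Z))"
    using zeta_nonneg by (intro add_left_mono mult_left_mono) auto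
  also have "\<dots> = (2 * \<theta>\<^sup>2 * err + 3 * h powr \<alpha>) * (1 + 2 * Z)" by (simp add: algebra_simps)
  finally have "dK \<le> 2 * \<theta>\<^sup>2 * err + 3 * h powr \<alpha>"
    by (rule mult_right_le_imp_le) (use zeta_nonneg in auto)
  then show ?thesis by (simp add: hp)
qed

end

section \<open>Random weights\<close>

lemma subalgebra_weight_sigma:
  assumes "\<And>n k. 1 \<le> k \<Longrightarrow> k \<le> n \<Longrightarrow> W n k \<in> borel_measurable M"
  shows "subalgebra M (weight_sigma M W)"
proof -
  let ?I = "SIGMA n:{1..}. {1..n}"
  let ?f = "\<lambda>\<omega>. \<lambda>(n, k)\<in>?I. W n k \<omega>"
  have "?f \<in> measurable M (\<Pi>\<^sub>M i\<in>?I. borel)"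
    by (rule measurable_restrict) (use assms in auto)
  then have "?f -` A \<inter> space M \<in> sets M" if "A \<in> sets (\<Pi>\<^sub>M i\<in>?I. borel)" for A
    using that by (rule measurable_sets)
  then show ?thesis
    unfolding weight_sigma_def Let_def subalgebra_def
    by (auto simp: sets_vimage_algebra2 space_PiM PiE_def extensional_def)
qed

lemma weight_sigma_measurable:
  assumes k: "1 \<le> k" "k \<le> n"
  shows "W n k \<in> borel_measurable (weight_sigma M W)"
proof -
  let ?I = "SIGMA n:{1..}. {1..n}"
  let ?f = "\<lambda>\<omega>. \<lambda>(n, k)\<in>?I. W n k \<omega>"
  have nk: "(n, k) \<in> ?I" using k by auto
  have "?f \<in> measurable (weight_sigma M W) (\<Pi>\<^sub>M i\<in>?I. borel)"
    unfolding weight_sigma_def Let_def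
    by (rule measurable_vimage_algebra1) (auto simp: space_PiM PiE_def extensional_def)
  then have "(\<lambda>\<omega>. ?f \<omega> (n, k)) \<in> borel_measurable (weight_sigma M W)"
    by (rule measurable_compose[OF _ measurable_component_singleton[OF nk]])
  then show ?thesis using nk by simp
qed

context prob_space
begin

lemma emeasure_Int_cond_prob_sub:
  assumes F: "subalgebra M F" and A: "A \<in> sets M" and B: "B \<in> sets F"
  shows "emeasure M (A \<inter> B) = (\<integral>\<^sup>+\<omega>. ennreal (indicator B \<omega> * cond_prob_sub M F A \<omega>) \<partial>M)"
proof -
  interpret finite_measure_subalgebra M F by unfold_locales fact
  have BM: "B \<in> sets M" using B F by (auto simp: subalgebra_def)
  have eq: "(\<lambda>\<omega>. indicator B \<omega> * indicator A \<omega> :: real) = indicator (A \<inter> B)"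
    by (auto split: split_indicator)
  have i: "integrable M (\<lambda>\<omega>. indicator B \<omega> * indicator A \<omega> :: real)"
    unfolding eq using A BM by (intro integrable_real_indicator) (auto simp: emeasure_eq_measure)
  note c = real_cond_exp_intg[OF i]
  have pos: "AE \<omega> in M. 0 \<le> cond_prob_sub M F A \<omega>"
    unfolding cond_prob_sub_def by (rule real_cond_exp_pos) (use A in auto)
  have "emeasure M (A \<inter> B) = ennreal (\<integral>\<omega>. indicator B \<omega> * indicator A \<omega> \<partial>M)"
    unfolding eq using A BM by (simp add: emeasure_eq_measure)
  also have "(\<integral>\<omega>. indicator B \<omega> * indicator A \<omega> \<partial>M) = (\<integral>\<omega>. indicator B \<omega> * cond_prob_sub M F A \<omega> \<partial>M)"
    unfolding cond_prob_sub_def by (rule c(2)[symmetric]) (use A B in auto)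
  also have "ennreal \<dots> = (\<integral>\<^sup>+\<omega>. ennreal (indicator B \<omega> * cond_prob_sub M F A \<omega>) \<partial>M)"
  proof (rule nn_integral_eq_integral[symmetric])
    show "integrable M (\<lambda>\<omega>. indicator B \<omega> * cond_prob_sub M F A \<omega>)"
      unfolding cond_prob_sub_def by (rule c(1)) (use A B in auto)
    show "AE \<omega> in M. 0 \<le> indicator B \<omega> * cond_prob_sub M F A \<omega>"
      using pos by eventually_elim auto
  qed
  finally show ?thesis .
qed

lemma cond_prob_sub_measurable [measurable]: "cond_prob_sub M F A \<in> borel_measurable F"
  unfolding cond_prob_sub_def by simp

text \<open>The series of \<open>x\<close> times the conditional probability of \<open>X = x\<close>
  has the defining property of the conditional expectation. This links \<open>lam\<close>, a
  conditional expectation, to the mean of \<open>count_law\<close>, which is what the deterministic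
  argument sees.\<close>

lemma cond_pmf_mean:
  assumes F: "subalgebra M F" and X: "X \<in> measurable M (count_space UNIV)"
    and fin: "AE \<omega> in M. nn_cond_exp M F (\<lambda>\<omega>. ennreal (real (X \<omega>))) \<omega> < \<infinity>"
  shows "AE \<omega> in M. integrable (measure_pmf (cond_pmf M F X \<omega>)) real \<and>
    measure_pmf.expectation (cond_pmf M F X \<omega>) real = enn2real (nn_cond_exp M F (\<lambda>\<omega>. ennreal (real (X \<omega>))) \<omega>)"
proof -
  interpret finite_measure_subalgebra M F by unfold_locales fact
  note X[measurable]
  define A where "A = (\<lambda>x. {\<omega> \<in> space M. X \<omega> = x})"
  have A[measurable]: "A x \<in> sets M" for x unfolding A_def by measurable
  have [measurable]: "(\<lambda>\<omega>. ennreal (real (X \<omega>))) \<in> borel_measurable M" by measurable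
  have "AE \<omega> in M. (\<Sum>x. ennreal (real x) * ennreal (cond_prob_sub M F (A x) \<omega>))
      = nn_cond_exp M F (\<lambda>\<omega>. ennreal (real (X \<omega>))) \<omega>"
  proof (rule nn_cond_exp_charact)
    fix B assume B: "B \<in> sets F"
    have BM[measurable]: "B \<in> sets M" using B F by (auto simp: subalgebra_def)
    have "(\<integral>\<^sup>+\<omega>\<in>B. ennreal (real (X \<omega>)) \<partial>M) = (\<integral>\<^sup>+\<omega>. (\<Sum>x. ennreal (real x) * indicator (A x \<inter> B) \<omega>) \<partial>M)"
    proof (rule nn_integral_cong)
      fix \<omega> assume w: "\<omega> \<in> space M"
      have ind: "indicator (A x \<inter> B) \<omega> = (if x = X \<omega> then indicator B \<omega> else 0 :: ennreal)" for x
        using w by (auto simp: A_def indicator_def)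
      define G where "G = (\<lambda>x. ennreal (real x) * (if x = X \<omega> then indicator B \<omega> else 0))"
      have "suminf G = sum G {X \<omega>}" by (rule suminf_finite) (simp_all add: G_def)
      also have "\<dots> = G (X \<omega>)" by simp
      also have "\<dots> = ennreal (real (X \<omega>)) * indicator B \<omega>" by (simp add: G_def)
      finally show "ennreal (real (X \<omega>)) * indicator B \<omega> = (\<Sum>x. ennreal (real x) * indicator (A x \<inter> B) \<omega>)"
        by (simp only: ind G_def)
    qed
    also have "\<dots> = (\<Sum>x. ennreal (real x) * emeasure M (A x \<inter> B))"
      by (simp add: nn_integral_suminf nn_integral_cmult)
    also have "\<dots> = (\<Sum>x. ennreal (real x) * (\<integral>\<^sup>+\<omega>. ennreal (indicator B \<omega> * cond_prob_sub M F (A x) \<omega>) \<partial>M))"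
      by (simp add: emeasure_Int_cond_prob_sub[OF F A B])
    also have "\<dots> = (\<integral>\<^sup>+\<omega>. (\<Sum>x. ennreal (real x) * ennreal (indicator B \<omega> * cond_prob_sub M F (A x) \<omega>)) \<partial>M)"
    proof -
      have [measurable]: "cond_prob_sub M F (A x) \<in> borel_measurable M" for x
        by (rule measurable_from_subalg[OF F cond_prob_sub_measurable])
      show ?thesis by (simp add: nn_integral_suminf nn_integral_cmult)
    qed
    also have "\<dots> = (\<integral>\<^sup>+\<omega>\<in>B. (\<Sum>x. ennreal (real x) * ennreal (cond_prob_sub M F (A x) \<omega>)) \<partial>M)"
      by (intro nn_integral_cong) (auto split: split_indicator)
    finally show "(\<integral>\<^sup>+\<omega>\<in>B. ennreal (real (X \<omega>)) \<partial>M) = (\<integral>\<^sup>+\<omega>\<in>B. (\<Sum>x. ennreal (real x) * ennreal (cond_prob_sub M F (A x) \<omega>)) \<partial>M)" .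
  qed measurable
  with fin pmf_cond_pmf[OF prob_space_axioms F X] show ?thesis
  proof eventually_elim
    case (elim \<omega>)
    have "(\<integral>\<^sup>+x. ennreal (real x) \<partial>cond_pmf M F X \<omega>) = (\<Sum>x. ennreal (real x) * ennreal (cond_prob_sub M F (A x) \<omega>))"
      using elim(2) by (simp add: nn_integral_measure_pmf nn_integral_count_space_nat A_def mult.commute)
    then have e: "(\<integral>\<^sup>+x. ennreal (real x) \<partial>cond_pmf M F X \<omega>) = nn_cond_exp M F (\<lambda>\<omega>. ennreal (real (X \<omega>))) \<omega>"
      using elim(3) by simp
    have "integrable (measure_pmf (cond_pmf M F X \<omega>)) real"
      by (rule integrableI_nonneg) (use e elim(1) in auto)
    moreover have "measure_pmf.expectation (cond_pmf M F X \<omega>) real = enn2real (nn_cond_exp M F (\<lambda>\<omega>. ennreal (real (X \<omega>))) \<omega>)"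
      by (subst integral_eq_nn_integral) (use e in auto)
    ultimately show ?case by simp
  qed
qed

text \<open>Freezing the weights: the event is a disjoint union over the countably many count
  vectors \<open>x\<close> of \<open>A x\<close>, which concerns the counts, and \<open>B x\<close>,
  which lies in \<open>F\<close>. Conditional independence turns the conditional probability of
  \<open>A x\<close> into the mass of the product law at \<open>x\<close>. A measurable version
  \<open>R\<close> is supplied because the conditional laws are determined only almost
  everywhere.\<close>

lemma prob_sum_conditional:
  fixes V :: "nat \<Rightarrow> 'a \<Rightarrow> real" and X :: "nat \<Rightarrow> 'a \<Rightarrow> nat"
  assumes F: "subalgebra M F" and X: "cond_indep_vars M F (\<lambda>_. count_space UNIV) X {1..}"
    and V: "\<And>k. 1 \<le> k \<Longrightarrow> k \<le> n \<Longrightarrow> V k \<in> borel_measurable F"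
  shows "\<exists>R \<in> borel_measurable M.
    (AE \<omega> in M. R \<omega> = measure (measure_pmf (Pi_pmf {1..n} 0 (\<lambda>k. cond_pmf M F (X k) \<omega>)))
      {x. (\<Sum>k=1..n. V k \<omega> * real (x k)) \<le> t}) \<and>
    integrable M R \<and> prob {\<omega> \<in> space M. (\<Sum>k=1..n. V k \<omega> * real (X k \<omega>)) \<le> t} = (\<integral>\<omega>. R \<omega> \<partial>M)"
proof -
  interpret finite_measure_subalgebra M F by unfold_locales fact
  have sp: "space F = space M" using F by (simp add: subalgebra_def)
  have Xm[measurable]: "X k \<in> measurable M (count_space UNIV)" if "1 \<le> k" for k
    using X that by (auto simp: cond_indep_vars_def)
  \<comment> \<open>Count vectors take the value 0 outside \<open>{1..n}\<close>, the default of
    \<open>Pi_pmf\<close>; this makes the set countable and the decomposition disjoint.\<close>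
  define \<X> :: "(nat \<Rightarrow> nat) set" where "\<X> = PiE_dflt {1..n} 0 (\<lambda>_. UNIV)"
  have cnt: "countable \<X>" unfolding \<X>_def dflt_image_PiE[symmetric]
    by (intro countable_image countable_PiE) auto
  define A where "A = (\<lambda>x. {\<omega> \<in> space M. \<forall>k\<in>{1..n}. X k \<omega> = x k})"
  define B where "B = (\<lambda>x :: nat \<Rightarrow> nat. {\<omega> \<in> space F. (\<Sum>k=1..n. V k \<omega> * real (x k)) \<le> t})"
  have A: "A x \<in> sets M" for x
  proof -
    have "A x = {\<omega> \<in> space M. \<forall>k\<in>{1..n}. X k \<omega> \<in> {x k}}" by (simp add: A_def)
    also have "\<dots> \<in> sets M"
      by (intro sets.sets_Collect_finite_All measurable_sets_Collect[of "X _" M "count_space UNIV" "\<lambda>y. y \<in> {_}"]) (auto intro: Xm)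
    finally show ?thesis .
  qed
  have B: "B x \<in> sets F" for x
  proof -
    have [measurable]: "(\<lambda>\<omega>. \<Sum>k=1..n. V k \<omega> * real (x k)) \<in> borel_measurable F"
      using V by (intro borel_measurable_sum borel_measurable_times) auto
    show ?thesis unfolding B_def by measurable
  qed
  define c where "c = (\<lambda>x \<omega>. cond_prob_sub M F (A x) \<omega>)"
  define Q where "Q = (\<lambda>\<omega>. \<integral>\<^sup>+x. ennreal (indicator (B x) \<omega> * c x \<omega>) \<partial>count_space \<X>)"
  have fM[measurable]: "(\<lambda>\<omega>. ennreal (indicator (B x) \<omega> * c x \<omega>)) \<in> borel_measurable M" for x
  proof -
    have "B x \<in> sets M" using B[of x] F by (auto simp: subalgebra_def)
    moreover have "c x \<in> borel_measurable M" unfolding c_def by (rule measurable_from_subalg[OF F]) simp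
    ultimately show ?thesis by measurable
  qed
  have Qm[measurable]: "Q \<in> borel_measurable M"
  proof -
    interpret C: sigma_finite_measure "count_space \<X>"
      by (rule sigma_finite_measure_count_space_countable[OF cnt])
    have "(\<lambda>(x, \<omega>). ennreal (indicator (B x) \<omega> * c x \<omega>)) \<in> borel_measurable (count_space \<X> \<Otimes>\<^sub>M M)"
      by (rule measurable_pair_measure_countable1[OF cnt]) (simp add: fM)
    from measurable_pair_swap[OF this] show ?thesis unfolding Q_def
      by (intro C.borel_measurable_nn_integral) (simp add: split_def)
  qed
  let ?S = "{\<omega> \<in> space M. (\<Sum>k=1..n. V k \<omega> * real (X k \<omega>)) \<le> t}"
  have dis: "disjoint_family_on (\<lambda>x. A x \<inter> B x) \<X>"
    unfolding disjoint_family_on_def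
  proof (intro ballI impI)
    fix x y assume xy: "x \<in> \<X>" "y \<in> \<X>" "x \<noteq> y"
    then obtain k where "x k \<noteq> y k" by auto
    then have "k \<in> {1..n}" using xy by (auto simp: \<X>_def PiE_dflt_def)
    with \<open>x k \<noteq> y k\<close> show "A x \<inter> B x \<inter> (A y \<inter> B y) = {}" by (auto simp: A_def)
  qed
  have S_eq: "?S = (\<Union>x\<in>\<X>. A x \<inter> B x)"
  proof (intro set_eqI iffI)
    fix \<omega> assume w: "\<omega> \<in> ?S"
    define x where "x = (\<lambda>k. if k \<in> {1..n} then X k \<omega> else 0)"
    have "x \<in> \<X>" by (auto simp: \<X>_def PiE_dflt_def x_def)
    moreover have "(\<Sum>k=1..n. V k \<omega> * real (x k)) = (\<Sum>k=1..n. V k \<omega> * real (X k \<omega>))"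
      by (intro sum.cong) (auto simp: x_def)
    moreover have "\<omega> \<in> A x" using w by (simp add: A_def x_def)
    ultimately show "\<omega> \<in> (\<Union>x\<in>\<X>. A x \<inter> B x)" using w by (auto simp: B_def sp)
  next
    fix \<omega> assume "\<omega> \<in> (\<Union>x\<in>\<X>. A x \<inter> B x)"
    then obtain x where x: "\<omega> \<in> A x" "\<omega> \<in> B x" by auto
    have "(\<Sum>k=1..n. V k \<omega> * real (x k)) = (\<Sum>k=1..n. V k \<omega> * real (X k \<omega>))"
      using x by (intro sum.cong) (auto simp: A_def)
    moreover have "(\<Sum>k=1..n. V k \<omega> * real (x k)) \<le> t" using x(2) unfolding B_def by blast
    moreover have "\<omega> \<in> space M" using x(1) unfolding A_def by blast
    ultimately show "\<omega> \<in> ?S" by simp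
  qed
  have BM: "B x \<in> sets M" for x using B[of x] F by (auto simp: subalgebra_def)
  have "emeasure M ?S = (\<integral>\<^sup>+x. emeasure M (A x \<inter> B x) \<partial>count_space \<X>)"
    unfolding S_eq by (rule emeasure_UN_countable[OF _ cnt dis]) (rule sets.Int[OF A BM])
  also have "\<dots> = (\<integral>\<^sup>+x. (\<integral>\<^sup>+\<omega>. ennreal (indicator (B x) \<omega> * c x \<omega>) \<partial>M) \<partial>count_space \<X>)"
    by (simp add: emeasure_Int_cond_prob_sub[OF F A B] c_def)
  also have "\<dots> = (\<integral>\<^sup>+\<omega>. Q \<omega> \<partial>M)"
    unfolding Q_def by (rule nn_integral_count_space_nn_integral[symmetric, OF cnt]) (rule fM)
  finally have S: "emeasure M ?S = (\<integral>\<^sup>+\<omega>. Q \<omega> \<partial>M)" .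
  have "AE \<omega> in M. \<forall>x\<in>\<X>. c x \<omega> = (\<Prod>k\<in>{1..n}. cond_prob_sub M F {\<omega>' \<in> space M. X k \<omega>' = x k} \<omega>)"
    unfolding AE_ball_countable[OF cnt]
  proof
    fix x
    have "AE \<omega> in M. cond_prob_sub M F {\<omega>' \<in> space M. \<forall>j\<in>{1..n}. X j \<omega>' \<in> {x j}} \<omega>
      = (\<Prod>j\<in>{1..n}. cond_prob_sub M F {\<omega>' \<in> space M. X j \<omega>' \<in> {x j}} \<omega>)"
      using X unfolding cond_indep_vars_def by (elim conjE allE[of _ "{1..n}"] allE[of _ "\<lambda>j. {x j}"]) auto
    then show "AE \<omega> in M. c x \<omega> = (\<Prod>k\<in>{1..n}. cond_prob_sub M F {\<omega>' \<in> space M. X k \<omega>' = x k} \<omega>)"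
      by (simp add: c_def A_def)
  qed
  moreover have "AE \<omega> in M. \<forall>k\<in>{1..n}. \<forall>y. pmf (cond_pmf M F (X k) \<omega>) y = cond_prob_sub M F {\<omega>' \<in> space M. X k \<omega>' = y} \<omega>"
    by (rule AE_finite_allI) (auto intro!: pmf_cond_pmf[OF prob_space_axioms F] Xm)
  ultimately have Q: "AE \<omega> in M. Q \<omega> = ennreal (measure (measure_pmf (Pi_pmf {1..n} 0 (\<lambda>k. cond_pmf M F (X k) \<omega>)))
      {x. (\<Sum>k=1..n. V k \<omega> * real (x k)) \<le> t})"
    using AE_space
  proof eventually_elim
    case (elim \<omega>)
    let ?P = "Pi_pmf {1..n} 0 (\<lambda>k. cond_pmf M F (X k) \<omega>)"
    let ?T = "{x. (\<Sum>k=1..n. V k \<omega> * real (x k)) \<le> t}"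
    have "ennreal (measure (measure_pmf ?P) ?T) = (\<integral>\<^sup>+x. indicator ?T x \<partial>?P)"
      by (simp add: measure_pmf.emeasure_eq_measure)
    also have "\<dots> = (\<integral>\<^sup>+x. ennreal (pmf ?P x) * indicator ?T x \<partial>count_space UNIV)"
      by (rule nn_integral_measure_pmf)
    also have "\<dots> = (\<integral>\<^sup>+x. ennreal (indicator (B x) \<omega> * c x \<omega>) * indicator \<X> x \<partial>count_space UNIV)"
    proof (rule nn_integral_cong)
      fix x
      show "ennreal (pmf ?P x) * indicator ?T x = ennreal (indicator (B x) \<omega> * c x \<omega>) * indicator \<X> x"
      proof (cases "x \<in> \<X>")
        case True
        then have "pmf ?P x = (\<Prod>k\<in>{1..n}. pmf (cond_pmf M F (X k) \<omega>) (x k))"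
          by (intro pmf_Pi') (auto simp: \<X>_def PiE_dflt_def)
        also have "\<dots> = c x \<omega>" using elim(1,2) True by simp
        finally show ?thesis using True elim(3) by (auto simp: B_def sp split: split_indicator)
      next
        case False
        then have "pmf ?P x = 0" by (intro pmf_Pi_outside) (auto simp: \<X>_def PiE_dflt_def)
        then show ?thesis using False by simp
      qed
    qed
    also have "\<dots> = Q \<omega>" unfolding Q_def by (simp add: nn_integral_count_space_indicator)
    finally show ?case ..
  qed
  define R where "R = (\<lambda>\<omega>. enn2real (Q \<omega>))"
  have R: "AE \<omega> in M. R \<omega> = measure (measure_pmf (Pi_pmf {1..n} 0 (\<lambda>k. cond_pmf M F (X k) \<omega>)))
      {x. (\<Sum>k=1..n. V k \<omega> * real (x k)) \<le> t}"
    using Q by eventually_elim (simp add: R_def)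
  have Rm[measurable]: "R \<in> borel_measurable M" unfolding R_def by measurable
  have int: "integrable M R"
    by (rule integrable_const_bound[where B = 1]) (use R in \<open>auto elim!: eventually_mono\<close>)
  have "(\<integral>\<^sup>+\<omega>. Q \<omega> \<partial>M) = (\<integral>\<^sup>+\<omega>. ennreal (R \<omega>) \<partial>M)"
    by (rule nn_integral_cong_AE) (use Q in \<open>eventually_elim, simp add: R_def\<close>)
  also have "\<dots> = ennreal (\<integral>\<omega>. R \<omega> \<partial>M)"
    by (rule nn_integral_eq_integral[OF int]) (simp add: R_def)
  finally have "ennreal (prob ?S) = ennreal (\<integral>\<omega>. R \<omega> \<partial>M)"
    using S by (simp add: emeasure_eq_measure)
  moreover have "0 \<le> (\<integral>\<omega>. R \<omega> \<partial>M)" by (simp add: R_def)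
  ultimately have "prob ?S = (\<integral>\<omega>. R \<omega> \<partial>M)" by simp
  with R int Rm show ?thesis by blast
qed

text \<open>No measurability of \<open>f\<close> is needed: \<open>(\<bar>R - g\<bar> - a) / b\<close> is a measurable minorant.\<close>

lemma expectation_diff_le_affine:
  fixes R f :: "'a \<Rightarrow> real"
  assumes R: "integrable M R" and b: "0 < b"
    and le: "AE \<omega> in M. \<bar>R \<omega> - g\<bar> \<le> a + b * f \<omega>"
    and fin: "(\<integral>\<^sup>+\<omega>. ennreal (f \<omega>) \<partial>M) < \<infinity>"
  shows "\<bar>(\<integral>\<omega>. R \<omega> \<partial>M) - g\<bar> \<le> a + b * enn2real (\<integral>\<^sup>+\<omega>. ennreal (f \<omega>) \<partial>M)"
proof -
  define m where "m = (\<lambda>\<omega>. (\<bar>R \<omega> - g\<bar> - a) / b)"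
  have mi: "integrable M m" unfolding m_def using R by auto
  then have [measurable]: "m \<in> borel_measurable M" by auto
  have mi': "integrable M (\<lambda>\<omega>. max 0 (m \<omega>))" using mi by auto
  have "(\<integral>\<omega>. m \<omega> \<partial>M) \<le> (\<integral>\<omega>. max 0 (m \<omega>) \<partial>M)" using mi mi' by (intro integral_mono) auto
  also have "\<dots> = enn2real (\<integral>\<^sup>+\<omega>. ennreal (max 0 (m \<omega>)) \<partial>M)" by (rule integral_eq_nn_integral) auto
  also have "\<dots> \<le> enn2real (\<integral>\<^sup>+\<omega>. ennreal (f \<omega>) \<partial>M)"
  proof (rule enn2real_mono)
    show "(\<integral>\<^sup>+\<omega>. ennreal (max 0 (m \<omega>)) \<partial>M) \<le> (\<integral>\<^sup>+\<omega>. ennreal (f \<omega>) \<partial>M)"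
    proof (rule nn_integral_mono_AE, use le in eventually_elim)
      case (elim \<omega>)
      then have "m \<omega> \<le> f \<omega>" using b by (simp add: m_def field_simps)
      then show ?case by (simp add: max_def ennreal_leI)
    qed
  qed (use fin in simp)
  finally have "(\<integral>\<omega>. m \<omega> \<partial>M) \<le> enn2real (\<integral>\<^sup>+\<omega>. ennreal (f \<omega>) \<partial>M)" .
  moreover have "(\<integral>\<omega>. m \<omega> \<partial>M) = ((\<integral>\<omega>. \<bar>R \<omega> - g\<bar> \<partial>M) - a) / b"
    unfolding m_def using R prob_space by simp
  moreover have "\<bar>(\<integral>\<omega>. R \<omega> \<partial>M) - g\<bar> \<le> (\<integral>\<omega>. \<bar>R \<omega> - g\<bar> \<partial>M)"
  proof -
    have "(\<integral>\<omega>. R \<omega> \<partial>M) - g = (\<integral>\<omega>. R \<omega> - g \<partial>M)" using R prob_space by simp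
    then show ?thesis by (simp add: integral_abs_bound)
  qed
  ultimately show ?thesis using b by (simp add: field_simps)
qed

end

text \<open>Tangent of the concave power at \<open>y\<close>. With \<open>y\<close> the mean error
  it takes the place of Jensen's inequality: an affine bound can be integrated by
  \<open>expectation_diff_le_affine\<close>.\<close>

lemma powr_le_tangent:
  fixes x y a :: real
  assumes "0 < y" "0 \<le> x" "0 < a" "a \<le> 1"
  shows "x powr a \<le> (1 - a) * y powr a + a * y powr (a - 1) * x"
proof -
  have "x powr a = y powr a * (x / y) powr a" using assms by (simp add: powr_divide)
  also have "\<dots> \<le> y powr a * (1 + a * (x / y - 1))"
    using assms by (intro mult_left_mono Bernoulli_powr_concave) auto
  also have "\<dots> = (1 - a) * y powr a + a * y powr (a - 1) * x"
    using assms by (simp add: powr_diff field_simps)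
  finally show ?thesis .
qed

theorem theorem1p1:
  fixes \<theta> k\<^sub>\<theta> :: real
    and M :: "'a measure" and W :: "nat \<Rightarrow> nat \<Rightarrow> 'a \<Rightarrow> real" and X :: "nat \<Rightarrow> 'a \<Rightarrow> nat"
    and N :: "'b measure" and D :: "'b \<Rightarrow> real" and p\<^sub>\<theta> :: "real \<Rightarrow> ennreal"
  assumes theta: "\<theta> > 0"
    and dickman: "prob_space N" "D \<in> borel_measurable N" "gen_dickman \<theta> (distr N borel D)"
    and density: "distributed N lborel D p\<^sub>\<theta>"
    and k_theta: "k\<^sub>\<theta> > 0" "\<And>x. x \<ge> 1 \<Longrightarrow> p\<^sub>\<theta> x \<le> ennreal k\<^sub>\<theta>"
    and M: "prob_space M"
    and W_meas: "\<And>n k. 1 \<le> k \<Longrightarrow> k \<le> n \<Longrightarrow> W n k \<in> borel_measurable M"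
    and W_zero: "\<And>n \<omega>. W n 0 \<omega> = 0"
    and W_mono: "AE \<omega> in M. \<forall>n\<ge>1. \<forall>k\<in>{1..n}. W n (k - 1) \<omega> \<le> W n k \<omega>"
    and W_max: "\<And>n. n \<ge> 1 \<Longrightarrow> integrable M (W n n)"
    and X_indep: "cond_indep_vars M (weight_sigma M W) (\<lambda>_. count_space UNIV) X {1..}"
    and X_mean: "\<And>k. k \<ge> 1 \<Longrightarrow> AE \<omega> in M. cond_mean M W X k \<omega> < \<infinity>"
    and n: "n \<ge> 1"
    and finite: "(\<integral>\<^sup>+ \<omega>. ennreal (eps \<theta> M W X n \<omega>) \<partial>M) < \<infinity>"
  defines "e \<equiv> enn2real (\<integral>\<^sup>+ \<omega>. ennreal (eps \<theta> M W X n \<omega>) \<partial>M)"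
    and "S \<equiv> (\<lambda>\<omega>. \<Sum>k=1..n. W n k \<omega> * real (X k \<omega>))"
  shows "kolmogorov_dist (distr M borel S) (distr N borel D)
      \<le> (if \<theta> \<ge> 1 then C1 \<theta> k\<^sub>\<theta> * e else 2 * \<theta>\<^sup>2 * e + C2 \<theta> * e powr \<theta>)"
proof -
  interpret M: prob_space M by fact
  define \<mu> where "\<mu> = distr N borel D"
  interpret L: dickman_law \<theta> \<mu>
    by unfold_locales (use theta dickman in \<open>auto simp: \<mu>_def\<close>)
  define F where "F = weight_sigma M W"
  have F: "subalgebra M F" unfolding F_def by (rule subalgebra_weight_sigma[OF W_meas])
  have Xm[measurable]: "X k \<in> measurable M (count_space UNIV)" if "1 \<le> k" for k
    using X_indep that by (auto simp: cond_indep_vars_def)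
  have S_meas: "S \<in> borel_measurable M"
    unfolding S_def
    by (intro borel_measurable_sum borel_measurable_times W_meas measurable_compose[OF Xm]) auto
  have mu_density: "\<mu> = density lborel p\<^sub>\<theta>"
  proof -
    have "\<mu> = distr N lborel D" unfolding \<mu>_def by (rule distr_cong) auto
    then show ?thesis using density by (simp add: distributed_distr_eq_density)
  qed
  have tail: "cdf \<mu> b - cdf \<mu> a \<le> k\<^sub>\<theta> * (b - a)" if ab: "1 \<le> a" "a \<le> b" for a b
  proof (cases "a = b")
    case False
    have [measurable]: "p\<^sub>\<theta> \<in> borel_measurable borel" using density by (auto simp: distributed_def)
    have "emeasure \<mu> {a<..b} = (\<integral>\<^sup>+x\<in>{a<..b}. p\<^sub>\<theta> x \<partial>lborel)"
      unfolding mu_density by (subst emeasure_density) auto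
    also have "\<dots> \<le> (\<integral>\<^sup>+x\<in>{a<..b}. ennreal k\<^sub>\<theta> \<partial>lborel)"
      using k_theta(2) ab by (intro nn_integral_mono) (auto split: split_indicator)
    also have "\<dots> = ennreal (k\<^sub>\<theta> * (b - a))"
      using k_theta(1) ab by (simp add: nn_integral_cmult_indicator ennreal_mult')
    finally have "measure \<mu> {a<..b} \<le> k\<^sub>\<theta> * (b - a)"
      using k_theta(1) ab by (simp add: L.emeasure_eq_measure)
    then show ?thesis using L.cdf_diff_eq[of a b] ab False by simp
  qed simp
  define K where "K = (if 1 \<le> \<theta> then k\<^sub>\<theta> else 1)"
  define \<alpha> where "\<alpha> = min 1 \<theta>"
  have conc: "cdf \<mu> b - cdf \<mu> a \<le> K * (b - a) powr \<alpha>" if "0 \<le> a" "a \<le> b" for a b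
  proof (cases "1 \<le> \<theta>")
    case True
    then show ?thesis
      using L.cdf_diff_le_linear[OF True less_imp_le[OF k_theta(1)] tail that] that
      by (simp add: K_def \<alpha>_def)
  next
    case False
    then show ?thesis using L.cdf_diff_le_powr[of a b] that by (simp add: K_def \<alpha>_def)
  qed
  let ?p = "\<lambda>\<omega> k. count_law M W X k \<omega>"
  have "AE \<omega> in M. \<forall>k\<in>{1..n}. integrable (measure_pmf (?p \<omega> k)) real \<and>
      measure_pmf.expectation (?p \<omega> k) real = lam M W X k \<omega>"
  proof (rule AE_finite_allI)
    fix k assume "k \<in> {1..n}"
    then show "AE \<omega> in M. integrable (measure_pmf (?p \<omega> k)) real \<and>
      measure_pmf.expectation (?p \<omega> k) real = lam M W X k \<omega>"
      using M.cond_pmf_mean[OF F Xm, of k] X_mean[of k]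
      by (simp add: count_law_def lam_def cond_mean_def F_def)
  qed simp
  \<comment> \<open>For almost every outcome the realised weights and the conditional laws of the
    counts form an instance of the deterministic setting.\<close>
  with W_mono have approx: "AE \<omega> in M. dickman_approx \<theta> \<mu> n (\<lambda>k. W n k \<omega>) (?p \<omega>) K \<alpha> \<and>
      weighted_sum.err \<theta> n (\<lambda>k. W n k \<omega>) (?p \<omega>) = eps \<theta> M W X n \<omega>"
  proof eventually_elim
    case (elim \<omega>)
    have "dickman_approx \<theta> \<mu> n (\<lambda>k. W n k \<omega>) (?p \<omega>) K \<alpha>"
      by unfold_locales (use theta n elim W_zero k_theta(1) conc in \<open>auto simp: K_def \<alpha>_def\<close>)
    then interpret A: dickman_approx \<theta> \<mu> n "\<lambda>k. W n k \<omega>" "?p \<omega>" K \<alpha> .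
    have mean: "A.mean k = lam M W X k \<omega>" if "k \<in> {1..n}" for k
      using elim(2) that by (simp add: A.mean_def)
    have "A.drift = Dstar \<theta> M W X n \<omega>"
      unfolding A.drift_def Dstar_def Dsum_def Delta_def
      by (intro arg_cong[where f = Max] image_cong refl arg_cong[where f = abs] sum.cong) (auto simp: mean)
    moreover have "A.tv_error = (\<Sum>k=1..n. lam M W X k \<omega> * W n k \<omega>
         * (let p = ?p \<omega> k in tv_dist (size_biased_pmf p) (map_pmf Suc p) / pmf p (x_min M W X k \<omega>)))"
      unfolding A.tv_error_def by (intro sum.cong) (auto simp: mean tv_ratio_def x_min_def Let_def)
    ultimately have "A.err = eps \<theta> M W X n \<omega>"
      by (simp add: A.err_def eps_def A.width_def mesh_def)
    then show ?case using A.dickman_approx_axioms by simp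
  qed
  have e_pos: "0 < e"
  proof -
    have "ennreal (1 / real n) = (\<integral>\<^sup>+\<omega>. ennreal (1 / real n) \<partial>M)" by (simp add: M.emeasure_space_1)
    also have "\<dots> \<le> (\<integral>\<^sup>+\<omega>. ennreal (eps \<theta> M W X n \<omega>) \<partial>M)"
    proof (rule nn_integral_mono_AE, use approx in eventually_elim)
      case (elim \<omega>)
      then interpret A: dickman_approx \<theta> \<mu> n "\<lambda>k. W n k \<omega>" "?p \<omega>" K \<alpha> by simp
      show ?case using A.err_ge elim by (intro ennreal_leI) simp
    qed
    finally have "1 / real n \<le> e"
      unfolding e_def using finite enn2real_mono by fastforce
    then show ?thesis using n by (smt (verit) divide_pos_pos of_nat_0_less_iff less_le_trans zero_less_one)
  qed
  \<comment> \<open>Affine majorant \<open>a + b * \<epsilon>\<close> of the claimed bound as a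
    function of the error: for \<open>\<theta> < 1\<close> the power is replaced by its tangent at
    \<open>e\<close>, so that inserting \<open>e\<close> returns the claimed value, see
    \<open>total\<close>. The tangent exists because \<open>e > 0\<close>.\<close>
  define a where "a = (if 1 \<le> \<theta> then 0 else C2 \<theta> * ((1 - \<theta>) * e powr \<theta>))"
  define b where "b = (if 1 \<le> \<theta> then C1 \<theta> k\<^sub>\<theta> else 2 * \<theta>\<^sup>2 + C2 \<theta> * (\<theta> * e powr (\<theta> - 1)))"
  have zeta: "0 \<le> zeta (1 + \<theta>)" by (rule L.zeta_nonneg)
  have C2: "0 \<le> C2 \<theta>" by (simp add: C2_def)
  have C1: "2 * \<theta>\<^sup>2 + (6 * \<theta> + 10 * \<theta> * zeta (1 + \<theta>)) * k\<^sub>\<theta> \<le> C1 \<theta> k\<^sub>\<theta>"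
    unfolding C1_def using theta zeta by (intro add_left_mono mult_left_mono) auto
  have "0 < 2 * \<theta>\<^sup>2 + (6 * \<theta> + 10 * \<theta> * zeta (1 + \<theta>)) * k\<^sub>\<theta>"
    using theta zeta k_theta(1) by (intro add_pos_nonneg) auto
  then have b: "0 < b"
    using C1 C2 theta by (auto simp: b_def intro: add_pos_nonneg)
  have total: "a + b * e = (if \<theta> \<ge> 1 then C1 \<theta> k\<^sub>\<theta> * e else 2 * \<theta>\<^sup>2 * e + C2 \<theta> * e powr \<theta>)"
  proof (cases "1 \<le> \<theta>")
    case False
    have "e powr (\<theta> - 1) * e = e powr \<theta>" using e_pos by (simp add: powr_diff)
    then have "C2 \<theta> * (\<theta> * e powr (\<theta> - 1)) * e = C2 \<theta> * (\<theta> * e powr \<theta>)" by (simp only: mult.assoc)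
    then show ?thesis using False by (simp add: a_def b_def distrib_right left_diff_distrib right_diff_distrib)
  qed (simp add: a_def b_def)
  have bound: "AE \<omega> in M. \<forall>t\<ge>0. \<bar>measure (measure_pmf (Pi_pmf {1..n} 0 (\<lambda>k. cond_pmf M F (X k) \<omega>)))
      {x. (\<Sum>k=1..n. W n k \<omega> * real (x k)) \<le> t} - cdf \<mu> t\<bar> \<le> a + b * eps \<theta> M W X n \<omega>"
    using approx
  proof (eventually_elim, intro allI impI)
    fix \<omega> t :: _ assume \<omega>: "dickman_approx \<theta> \<mu> n (\<lambda>k. W n k \<omega>) (?p \<omega>) K \<alpha> \<and>
      weighted_sum.err \<theta> n (\<lambda>k. W n k \<omega>) (?p \<omega>) = eps \<theta> M W X n \<omega>" and t: "0 \<le> (t :: real)"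
    interpret A: dickman_approx \<theta> \<mu> n "\<lambda>k. W n k \<omega>" "?p \<omega>" K \<alpha> using \<omega> by simp
    have err: "A.err = eps \<theta> M W X n \<omega>" using \<omega> by simp
    have "A.dK \<le> a + b * A.err"
    proof (cases "1 \<le> \<theta>")
      case True
      then have "A.dK \<le> (2 * \<theta>\<^sup>2 + (6 * \<theta> + 10 * \<theta> * zeta (1 + \<theta>)) * k\<^sub>\<theta>) * A.err"
        using A.dK_bound_linear by (simp add: \<alpha>_def K_def)
      also have "\<dots> \<le> C1 \<theta> k\<^sub>\<theta> * A.err" using C1 A.err_pos by (intro mult_right_mono) auto
      finally show ?thesis using True by (simp add: a_def b_def)
    next
      case False
      then have "A.dK \<le> 2 * \<theta>\<^sup>2 * A.err + C2 \<theta> * A.err powr \<theta>"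
        using A.dK_bound_powr by (simp add: \<alpha>_def K_def C2_def)
      also have "C2 \<theta> * A.err powr \<theta> \<le> C2 \<theta> * ((1 - \<theta>) * e powr \<theta> + \<theta> * e powr (\<theta> - 1) * A.err)"
        using C2 e_pos A.err_pos theta False by (intro mult_left_mono powr_le_tangent) auto
      finally show ?thesis using False by (simp add: a_def b_def distrib_left distrib_right mult.assoc)
    qed
    then have "\<bar>A.dist_fun t - cdf \<mu> t\<bar> \<le> a + b * eps \<theta> M W X n \<omega>"
      using A.dK_ge[OF t] by (simp only: err)
    moreover have "(\<lambda>k. cond_pmf M F (X k) \<omega>) = ?p \<omega>" by (simp add: count_law_def F_def)
    ultimately show "\<bar>measure (measure_pmf (Pi_pmf {1..n} 0 (\<lambda>k. cond_pmf M F (X k) \<omega>)))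
      {x. (\<Sum>k=1..n. W n k \<omega> * real (x k)) \<le> t} - cdf \<mu> t\<bar> \<le> a + b * eps \<theta> M W X n \<omega>"
      by (simp only: A.dist_fun_def A.law_def A.S_def)
  qed
  have "\<bar>cdf (distr M borel S) t - cdf \<mu> t\<bar> \<le> a + b * e" if t: "0 \<le> t" for t
  proof -
    obtain R where R: "AE \<omega> in M. R \<omega> = measure (measure_pmf (Pi_pmf {1..n} 0 (\<lambda>k. cond_pmf M F (X k) \<omega>)))
        {x. (\<Sum>k=1..n. W n k \<omega> * real (x k)) \<le> t}" "integrable M R"
      and P: "M.prob {\<omega> \<in> space M. (\<Sum>k=1..n. W n k \<omega> * real (X k \<omega>)) \<le> t} = (\<integral>\<omega>. R \<omega> \<partial>M)"
      using M.prob_sum_conditional[OF F X_indep[folded F_def], of n "W n" t] weight_sigma_measurable[of _ n W M]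
      by (auto simp: F_def)
    have "cdf (distr M borel S) t = (\<integral>\<omega>. R \<omega> \<partial>M)"
      unfolding P[symmetric] cdf_def by (subst measure_distr) (use S_meas in \<open>auto simp: S_def vimage_def Int_def conj_commute\<close>)
    moreover have "AE \<omega> in M. \<bar>R \<omega> - cdf \<mu> t\<bar> \<le> a + b * eps \<theta> M W X n \<omega>"
      using R(1) bound by eventually_elim (use t in simp)
    then have "\<bar>(\<integral>\<omega>. R \<omega> \<partial>M) - cdf \<mu> t\<bar> \<le> a + b * e"
      unfolding e_def by (rule M.expectation_diff_le_affine[OF R(2) b _ finite])
    ultimately show ?thesis by simp
  qed
  then show ?thesis
    unfolding total[symmetric] kolmogorov_dist_def \<mu>_def by (intro cSUP_least) auto
qed

end
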